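(* For every integer $m\ge1$ the following three identities hold for $\tau$ in the upper half-plane: \[ \theta_\triangle(\tau)^{4m^2}=\frac{(2m)!}{\prod_{j=1}^m(2j)!^2}\sum_{x_j,y_j\in\frac12+\mathbb{Z}}\prod_{j=1}^m\big(\operatorname{sgn}(x_j)+\operatorname{sgn}(y_j)\big)f_1(\vec{\bm x})\,q^{Q_m(\vec{\bm x})}, \] \[ \theta_\triangle(\tau)^{4m(m+1)}=\frac{1}{\prod_{j=1}^m(2j)!^2}\sum_{x_j\in\mathbb{Z},\ y_j\in\frac12+\mathbb{Z}}\prod_{j=1}^m\big(\operatorname{sgn}(x_j)+\operatorname{sgn}(y_j)\big)f_2(\vec{\bm x})\,q^{Q_m(\vec{\bm x})}, \] \[ \theta_\triangle(\tau)^{4m^2}=\frac{(2m)!}{2^m\prod_{j=1}^m(2j)!^2}\sum_{x_j,y_j\in\frac12+\mathbb{Z}}\prod_{j=1}^m\big(\operatorname{sgn}(x_j)+\operatorname{sgn}(y_j)\big)f_3(\vec{\bm x})\,q^{Q_m(\vec{\bm x})}, \] where in each sum all $x_1,\dots,x_m,y_1,\dots,y_m$ range over the indicated sets.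
   Context: $q=e^{2\pi i\tau}$ and $q^{\alpha}=e^{2\pi i\alpha\tau}$ for real $\alpha$. $\triangle(q)=\sum_{n\ge0}q^{n(n+1)/2}$ and $\theta_\triangle(\tau)=q^{1/16}\triangle(q^{1/2})=\frac12\sum_{n\in\frac12+\mathbb{Z}}q^{n^2/4}$. $\vec{\bm x}=(x_1,\dots,x_m,y_1,\dots,y_m)$, $Q_m(\vec{\bm x})=\sum_{j=1}^m x_jy_j$. $\operatorname{sgn}(x)=1$ if $x>0$ and $\operatorname{sgn}(x)=-1$ if $x\le 0$. The polynomials are $f_1(\vec{\bm x})=\prod_{j=1}^m x_j\prod_{1\le i<j\le m}(x_i^2-x_j^2)^2$, $f_2(\vec{\bm x})=\prod_{j=1}^m x_j^3\prod_{1\le i<j\le m}(x_i^2-x_j^2)^2$, $f_3(\vec{\bm x})=\prod_{j=1}^m(x_j+y_j)\prod_{1\le i<j\le m}\big((x_i-y_i)^2-(x_j-y_j)^2\big)\big((x_i+y_i)^2-(x_j+y_j)^2\big)$. *)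

theory Defs
  imports "HOL-Analysis.Analysis"
begin

definition qpow :: "complex \<Rightarrow> real \<Rightarrow> complex" where
  "qpow \<tau> \<alpha> = exp (2 * of_real pi * \<i> * of_real \<alpha> * \<tau>)"

definition triangle_series :: "complex \<Rightarrow> complex" where
  "triangle_series q = (\<Sum>n. q ^ (n * (n + 1) div 2))"

definition theta_triangle :: "complex \<Rightarrow> complex" where
  "theta_triangle \<tau> = qpow \<tau> (1 / 16) * triangle_series (qpow \<tau> (1 / 2))"

definition half_ints :: "real set" where
  "half_ints = {1 / 2 + of_int k | k :: int. True}"

text \<open>Unlike the library's \<^const>\<open>sgn\<close>, this sign function takes the value \<open>-1\<close> at \<open>0\<close>.\<close>

definition sgn_minus :: "real \<Rightarrow> real" where
  "sgn_minus x = (if x > 0 then 1 else - 1)"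

text \<open>
  A vector \<open>(x\<^sub>1, \<dots>, x\<^sub>m, y\<^sub>1, \<dots>, y\<^sub>m)\<close> is a pair of functions on the index set \<open>{1..m}\<close>.
  The summation domain uses extensional functions, so that each vector occurs exactly once.
\<close>

definition vecs :: "nat \<Rightarrow> real set \<Rightarrow> real set \<Rightarrow> ((nat \<Rightarrow> real) \<times> (nat \<Rightarrow> real)) set" where
  "vecs m X Y = ({1..m} \<rightarrow>\<^sub>E X) \<times> ({1..m} \<rightarrow>\<^sub>E Y)"

definition Qform :: "nat \<Rightarrow> (nat \<Rightarrow> real) \<times> (nat \<Rightarrow> real) \<Rightarrow> real" where
  "Qform m = (\<lambda>(x, y). \<Sum>j = 1..m. x j * y j)"

definition sgn_factor :: "nat \<Rightarrow> (nat \<Rightarrow> real) \<times> (nat \<Rightarrow> real) \<Rightarrow> real" where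
  "sgn_factor m = (\<lambda>(x, y). \<Prod>j = 1..m. sgn_minus (x j) + sgn_minus (y j))"

definition index_pairs :: "nat \<Rightarrow> (nat \<times> nat) set" where
  "index_pairs m = {(i, j). 1 \<le> i \<and> i < j \<and> j \<le> m}"

definition f1 :: "nat \<Rightarrow> (nat \<Rightarrow> real) \<times> (nat \<Rightarrow> real) \<Rightarrow> real" where
  "f1 m = (\<lambda>(x, y). (\<Prod>j = 1..m. x j) *
     (\<Prod>(i, j)\<in>index_pairs m. ((x i)\<^sup>2 - (x j)\<^sup>2)\<^sup>2))"

definition f2 :: "nat \<Rightarrow> (nat \<Rightarrow> real) \<times> (nat \<Rightarrow> real) \<Rightarrow> real" where
  "f2 m = (\<lambda>(x, y). (\<Prod>j = 1..m. x j ^ 3) *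
     (\<Prod>(i, j)\<in>index_pairs m. ((x i)\<^sup>2 - (x j)\<^sup>2)\<^sup>2))"

definition f3 :: "nat \<Rightarrow> (nat \<Rightarrow> real) \<times> (nat \<Rightarrow> real) \<Rightarrow> real" where
  "f3 m = (\<lambda>(x, y). (\<Prod>j = 1..m. x j + y j) *
     (\<Prod>(i, j)\<in>index_pairs m.
        ((x i - y i)\<^sup>2 - (x j - y j)\<^sup>2) * ((x i + y i)\<^sup>2 - (x j + y j)\<^sup>2)))"

definition theta_term ::
  "(nat \<Rightarrow> (nat \<Rightarrow> real) \<times> (nat \<Rightarrow> real) \<Rightarrow> real) \<Rightarrow> nat \<Rightarrow> complex
     \<Rightarrow> (nat \<Rightarrow> real) \<times> (nat \<Rightarrow> real) \<Rightarrow> complex" where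
  "theta_term f m \<tau> v = of_real (sgn_factor m v * f m v) * qpow \<tau> (Qform m v)"

lemma qpow_add: "qpow \<tau> (a + b) = qpow \<tau> a * qpow \<tau> b"
  by (simp add: qpow_def ring_distribs flip: exp_add)

lemma qpow_power: "qpow \<tau> a ^ n = qpow \<tau> (of_nat n * a)"
  by (simp add: qpow_def mult_ac flip: exp_of_nat_mult)

lemma norm_qpow: "norm (qpow \<tau> a) = exp (- 2 * pi * a * Im \<tau>)"
  by (simp add: qpow_def norm_exp_eq_Re)

text \<open>The second expression for the theta function, a sum over half-integers.\<close>

lemma theta_triangle_half_ints:
  assumes "Im \<tau> > 0"
  shows "((\<lambda>n. qpow \<tau> (n\<^sup>2 / 4)) has_sum (2 * theta_triangle \<tau>)) half_ints"
proof -
  define r where "r = qpow \<tau> (1 / 2)"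
  have r: "norm r < 1"
    using assms by (simp add: r_def norm_qpow)
  have le: "norm (norm (r ^ (n * (n + 1) div 2))) \<le> norm r ^ n" for n
  proof -
    have "n \<le> n * (n + 1) div 2"
      by (cases n) auto
    then have "norm r ^ (n * (n + 1) div 2) \<le> norm r ^ n"
      using r by (intro power_decreasing) auto
    then show ?thesis by (simp add: norm_power)
  qed
  have "summable (\<lambda>n. norm (r ^ (n * (n + 1) div 2)))"
    by (rule summable_comparison_test'[OF summable_geometric[of "norm r"], of 0]) (use r le in auto)
  then have "((\<lambda>n. r ^ (n * (n + 1) div 2)) has_sum triangle_series r) UNIV"
    unfolding triangle_series_def
    by (intro norm_summable_imp_has_sum) (auto intro: summable_sums summable_norm_cancel)
  then have hs: "((\<lambda>n. qpow \<tau> (1 / 16) * r ^ (n * (n + 1) div 2)) has_sum theta_triangle \<tau>) UNIV"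
    unfolding theta_triangle_def r_def[symmetric] by (rule has_sum_cmult_right)
  have eq: "qpow \<tau> (1 / 16) * r ^ (n * (n + 1) div 2) = qpow \<tau> ((1 / 2 + of_nat n)\<^sup>2 / 4)" for n :: nat
  proof -
    have "real (n * (n + 1) div 2) = real n * (real n + 1) / 2"
      by (subst real_of_nat_div) (auto simp: field_simps)
    then have "1 / 16 + real (n * (n + 1) div 2) * (1 / 2) = (1 / 2 + of_nat n)\<^sup>2 / 4"
      by (simp add: field_simps power2_eq_square)
    then show ?thesis
      by (simp only: r_def qpow_power flip: qpow_add)
  qed
  define A where "A = range (\<lambda>n::nat. 1 / 2 + real n)"
  define B where "B = range (\<lambda>n::nat. - (1 / 2 + real n))"
  have "((\<lambda>n. qpow \<tau> (n\<^sup>2 / 4)) has_sum theta_triangle \<tau>) A"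
    unfolding A_def using hs[unfolded eq] by (subst has_sum_reindex) (auto simp: inj_def o_def)
  moreover have "((\<lambda>n. qpow \<tau> (n\<^sup>2 / 4)) has_sum theta_triangle \<tau>) B"
    unfolding B_def using hs[unfolded eq]
    by (subst has_sum_reindex) (auto simp: inj_def o_def simp del: minus_add_distrib)
  moreover have "A \<inter> B = {}"
    by (auto simp: A_def B_def)
  ultimately have "((\<lambda>n. qpow \<tau> (n\<^sup>2 / 4)) has_sum (theta_triangle \<tau> + theta_triangle \<tau>)) (A \<union> B)"
    by (rule has_sum_Un_disjoint)
  moreover have "A \<union> B = half_ints"
  proof (intro subset_antisym subsetI)
    fix z assume "z \<in> A \<union> B"
    then consider n :: nat where "z = 1 / 2 + real n" | n :: nat where "z = - (1 / 2 + real n)"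
      by (auto simp: A_def B_def)
    then show "z \<in> half_ints"
    proof cases
      case (1 n)
      then show ?thesis by (auto simp: half_ints_def intro!: exI[of _ "int n"])
    next
      case (2 n)
      then show ?thesis by (auto simp: half_ints_def intro!: exI[of _ "- int n - 1"])
    qed
  next
    fix z assume "z \<in> half_ints"
    then obtain k :: int where k: "z = 1 / 2 + of_int k"
      by (auto simp: half_ints_def)
    show "z \<in> A \<union> B"
    proof (cases "k \<ge> 0")
      case True
      then show ?thesis using k by (auto simp: A_def intro!: image_eqI[of _ _ "nat k"])
    next
      case False
      then show ?thesis using k by (auto simp: B_def intro!: image_eqI[of _ _ "nat (- k - 1)"])
    qed
  qed
  ultimately show ?thesis by simp
qed

end

theory Submission
  imports Defs "Jordan_Normal_Form.Determinant"
begin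

text \<open>
  By Andreief's identity and the Vandermonde determinant, each sum over vectors is \<open>m!\<close> times a
  determinant of Lambert series \<open>\<Sum> (sgn x + sgn y) \<dots> q\<^sup>x\<^sup>y\<close>, whose entries are Taylor coefficients
  of a kernel in two variables: \<open>K(u + v, 0) + K(u - v, 0)\<close> for the first identity,
  \<open>L(u + v) + L(u - v) - 2 L(u)\<close> for the second and \<open>K(u + v, v - u)\<close> for the third. Here
  \<open>K(a, b) = \<Sum> \<plusminus> q\<^sup>x\<^sup>y exp (x a + y b)\<close> equals
  \<open>\<theta>\<^sub>1'(0) \<theta>\<^sub>1(a + b) / (\<theta>\<^sub>4(a) \<theta>\<^sub>4(b))\<close>, and \<open>L = - \<theta>\<^sub>4' / \<theta>\<^sub>4\<close>. The addition theorems for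
  theta functions give every kernel the shape \<open>a(u) b(v) / (1 - \<sigma>(u)\<^sup>2 \<sigma>(v)\<^sup>2)\<close> with
  \<open>\<sigma> = \<theta>\<^sub>1 / \<theta>\<^sub>4\<close>. Expanding the geometric series factors the matrix of Taylor coefficients into
  triangular matrices, so that its determinant is an explicit constant times a power of
  \<open>\<sigma>'(0)\<close>. Finally \<open>\<sigma>'(0) = theta_triangle\<^sup>2\<close> by Jacobi's derivative formula: the quotient
  \<open>\<theta>\<^sub>1' / (\<theta>\<^sub>2 \<theta>\<^sub>3 \<theta>\<^sub>4)\<close> of the values at \<open>0\<close> is invariant under \<open>\<tau> \<mapsto> 2 \<tau>\<close> and
  tends to \<open>1/2\<close> at \<open>\<i>\<infinity>\<close>.
\<close>

section \<open>Sums of exponentials and their power series\<close>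

text \<open>The form \<open>Qform\<close> is indefinite; the sums converge only because every
  nonzero term has all products \<open>x j * y j\<close> positive. The polynomials
  \<open>f1\<close>, \<open>f2\<close>, \<open>f3\<close> suit Andreief's identity since each is a
  product of one-point weights and two Vandermonde products, in the squares of the
  \<open>x j\<close>, or in the squares of \<open>x j - y j\<close> and of \<open>x j + y j\<close>.
  These squares let only Taylor coefficients of one parity into the matrix; combining the arguments
  u + v and u - v selects that parity in v, and the term - 2 L(u) removes the part constant in v.
  The formulas for K and L are proved without zeros and poles. After multiplication by
  \<open>theta4\<close> factors, coefficients of exponentials are compared. These are signed sums of
  Gaussians, governed by index shifts that change the sign only along lines on which the full
  Gaussian sum is a multiple of \<open>theta1\<close> at 0, hence zero. Two-variable expansions are
  handled throughout as power series in one variable whose coefficients are functions of the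
  other.\<close>

lemma abs_summable_on_times:
  fixes f :: "'a \<Rightarrow> 'c :: real_normed_field" and g :: "'b \<Rightarrow> 'c"
  assumes "(\<lambda>x. norm (f x)) summable_on A" and "(\<lambda>y. norm (g y)) summable_on B"
  shows "(\<lambda>p. norm (case p of (x, y) \<Rightarrow> f x * g y)) summable_on A \<times> B"
proof -
  have "(\<lambda>p. norm (case p of (x, y) \<Rightarrow> f x * g y)) summable_on Sigma A (\<lambda>_. B)"
  proof (rule summable_on_SigmaI[where g = "\<lambda>x. norm (f x) * (\<Sum>\<^sub>\<infinity>y\<in>B. norm (g y))"])
    show "((\<lambda>y. norm (case (x, y) of (x, y) \<Rightarrow> f x * g y)) has_sum
            norm (f x) * (\<Sum>\<^sub>\<infinity>y\<in>B. norm (g y))) B" for x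
      using assms(2) by (auto simp: norm_mult intro!: has_sum_cmult_right)
  qed (use assms(1) in \<open>auto intro!: summable_on_cmult_left\<close>)
  then show ?thesis .
qed

lemma has_sum_times:
  fixes f :: "'a \<Rightarrow> complex" and g :: "'b \<Rightarrow> complex"
  assumes "(\<lambda>x. norm (f x)) summable_on A" and "(\<lambda>y. norm (g y)) summable_on B"
    and "(f has_sum a) A" and "(g has_sum b) B"
  shows "((\<lambda>(x, y). f x * g y) has_sum a * b) (A \<times> B)"
proof (rule has_sum_SigmaI[where g = "\<lambda>x. f x * b"])
  show "(\<lambda>(x, y). f x * g y) summable_on A \<times> B"
    using abs_summable_on_times[OF assms(1,2)] by (rule abs_summable_summable)
qed (use assms(3,4) in \<open>auto intro: has_sum_cmult_right has_sum_cmult_left\<close>)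

lemma summable_on_exp_abs_int:
  fixes c :: real and A :: "int set"
  assumes "c > 0"
  shows "(\<lambda>k. exp (- c * \<bar>real_of_int k\<bar>)) summable_on A"
proof -
  have nat: "(\<lambda>n. exp (- c * real n)) summable_on UNIV"
  proof -
    have "(\<lambda>n. exp (- c) ^ n) summable_on UNIV"
      using assms by (intro norm_summable_imp_summable_on) (auto simp: norm_power intro!: summable_geometric)
    then show ?thesis by (simp add: mult.commute flip: exp_of_nat_mult)
  qed
  have 1: "(\<lambda>k. exp (- c * \<bar>real_of_int k\<bar>)) summable_on range int"
    using nat by (subst summable_on_reindex) (auto simp: o_def inj_def)
  have 2: "(\<lambda>k. exp (- c * \<bar>real_of_int k\<bar>)) summable_on range (\<lambda>n. - int n)"
    using nat by (subst summable_on_reindex) (auto simp: o_def inj_def)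
  have "A \<subseteq> range int \<union> range (\<lambda>n. - int n)"
  proof
    fix k show "k \<in> range int \<union> range (\<lambda>n. - int n)"
      by (cases k rule: int_cases2) auto
  qed
  then show ?thesis
    using summable_on_union[OF 1 2] by (rule summable_on_subset[rotated])
qed

text \<open>One term of the exponential series bounds the power. Thus an exponential weight of
  arbitrarily small rate r absorbs polynomial factors.\<close>

lemma power_le_fact_exp:
  fixes x r :: real
  assumes "x \<ge> 0" and "r > 0"
  shows "x ^ n \<le> fact n / r ^ n * exp (r * x)"
proof -
  define y where "y = r * x"
  have y: "y \<ge> 0" using assms by (simp add: y_def)
  have "y ^ n / fact n = (\<Sum>k\<in>{n}. y ^ k /\<^sub>R fact k)"
    by (simp add: field_simps)
  also have "\<dots> \<le> (\<Sum>k. y ^ k /\<^sub>R fact k)"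
    by (rule sum_le_suminf) (use y summable_exp_generic[of y] in auto)
  finally have "(r * x) ^ n / fact n \<le> exp (r * x)"
    by (simp add: exp_def y_def)
  then show ?thesis using assms by (simp add: field_simps power_mult_distrib)
qed

lemma mult_Re_le: "a * Re z \<le> \<bar>a\<bar> * norm z"
proof -
  have "a * Re z \<le> \<bar>a\<bar> * \<bar>Re z\<bar>"
    by (metis abs_ge_self abs_mult)
  also have "\<dots> \<le> \<bar>a\<bar> * norm z"
    by (intro mult_left_mono abs_Re_le_cmod) auto
  finally show ?thesis .
qed

text \<open>The weight \<open>exp (r * \<bar>\<alpha> p\<bar>)\<close> dominates all the exponential
  series at once for \<open>norm z < r\<close>, so the sum over P and the sum over powers of z may
  be interchanged.\<close>

lemma has_fps_expansion_exp_sum: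
  fixes w :: "'p \<Rightarrow> complex" and \<alpha> :: "'p \<Rightarrow> real"
  assumes r: "r > 0" and sm: "(\<lambda>p. norm (w p) * exp (r * \<bar>\<alpha> p\<bar>)) summable_on P"
  shows "(\<lambda>z. \<Sum>\<^sub>\<infinity>p\<in>P. w p * exp (of_real (\<alpha> p) * z)) has_fps_expansion
           Abs_fps (\<lambda>n. (\<Sum>\<^sub>\<infinity>p\<in>P. w p * of_real (\<alpha> p) ^ n) / fact n)"
proof (rule has_fps_expansionI)
  have ev: "eventually (\<lambda>z::complex. norm z < r) (nhds 0)"
    using eventually_nhds_in_open[of "ball 0 r" "0::complex"] r by (simp add: dist_norm)
  then show "\<forall>\<^sub>F z in nhds 0. (\<lambda>n. fps_nth (Abs_fps (\<lambda>n. (\<Sum>\<^sub>\<infinity>p\<in>P. w p * of_real (\<alpha> p) ^ n) / fact n)) n * z ^ n)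
      sums (\<Sum>\<^sub>\<infinity>p\<in>P. w p * exp (of_real (\<alpha> p) * z))"
  proof eventually_elim
    case (elim z)
    define h where "h = (\<lambda>(p, n::nat). w p * ((of_real (\<alpha> p) * z) ^ n /\<^sub>R fact n))"
    have le: "norm (w p * exp (of_real (\<alpha> p) * z)) \<le> norm (w p) * exp (\<bar>\<alpha> p\<bar> * norm z)"
      "norm (w p) * exp (\<bar>\<alpha> p\<bar> * norm z) \<le> norm (w p) * exp (r * \<bar>\<alpha> p\<bar>)" for p
    proof -
      have "\<alpha> p * Re z \<le> \<bar>\<alpha> p\<bar> * norm z"
        by (rule mult_Re_le)
      then show "norm (w p * exp (of_real (\<alpha> p) * z)) \<le> norm (w p) * exp (\<bar>\<alpha> p\<bar> * norm z)"
        by (simp add: norm_mult norm_exp_eq_Re mult_left_mono)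
      have "\<bar>\<alpha> p\<bar> * norm z \<le> r * \<bar>\<alpha> p\<bar>"
        using elim mult_right_mono[of "norm z" r "\<bar>\<alpha> p\<bar>"] by (simp add: mult.commute)
      then show "norm (w p) * exp (\<bar>\<alpha> p\<bar> * norm z) \<le> norm (w p) * exp (r * \<bar>\<alpha> p\<bar>)"
        by (simp add: mult_left_mono)
    qed
    have s1: "(\<lambda>p. norm (w p) * exp (\<bar>\<alpha> p\<bar> * norm z)) summable_on P"
      by (rule summable_on_comparison_test[OF sm]) (use le in auto)
    have s2: "(\<lambda>p. w p * exp (of_real (\<alpha> p) * z)) summable_on P"
      by (rule abs_summable_summable, rule Infinite_Sum.abs_summable_on_comparison_test'[OF s1]) (use le in auto)
    have exps: "((\<lambda>n. x ^ n /\<^sub>R fact n) has_sum exp x) UNIV" for x :: complex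
      by (rule norm_summable_imp_has_sum[OF summable_norm_exp exp_converges])
    have expsr: "((\<lambda>n. x ^ n / fact n) has_sum exp x) UNIV" if "x \<ge> 0" for x :: real
      using exp_converges[of x] that
      by (intro sums_nonneg_imp_has_sum) (auto simp: field_simps scaleR_conv_of_real)
    have abs: "(\<lambda>pn. norm (h pn)) summable_on P \<times> UNIV"
    proof (rule summable_on_SigmaI[OF _ s1])
      fix p assume "p \<in> P"
      show "((\<lambda>n. norm (h (p, n))) has_sum norm (w p) * exp (\<bar>\<alpha> p\<bar> * norm z)) UNIV"
        using has_sum_cmult_right[OF expsr[of "\<bar>\<alpha> p\<bar> * norm z"], of "norm (w p)"]
        by (simp add: h_def norm_mult norm_power field_simps norm_divide)
    qed auto
    have hs: "(h has_sum (\<Sum>\<^sub>\<infinity>p\<in>P. w p * exp (of_real (\<alpha> p) * z))) (P \<times> UNIV)"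
      by (rule has_sum_SigmaI[OF _ has_sum_infsum[OF s2] abs_summable_summable[OF abs]])
         (auto simp: h_def simp del: mult_scaleR_right intro!: has_sum_cmult_right exps)
    have abs': "(\<lambda>(n, p). h (p, n)) summable_on UNIV \<times> P"
      using abs_summable_summable[OF abs] by (subst summable_on_swap) (simp add: case_prod_unfold)
    have "((\<lambda>n. infsum (\<lambda>p. h (p, n)) P) has_sum (\<Sum>\<^sub>\<infinity>p\<in>P. w p * exp (of_real (\<alpha> p) * z))) UNIV"
    proof (rule has_sum_SigmaD[where f = "\<lambda>(n, p). h (p, n)" and B = "\<lambda>_. P"])
      show "((\<lambda>(n, p). h (p, n)) has_sum (\<Sum>\<^sub>\<infinity>p\<in>P. w p * exp (of_real (\<alpha> p) * z))) (UNIV \<times> P)"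
        using hs by (subst has_sum_swap) (simp add: case_prod_unfold)
      show "((\<lambda>p. case (n, p) of (n, p) \<Rightarrow> h (p, n)) has_sum (\<Sum>\<^sub>\<infinity>p\<in>P. h (p, n))) P" for n
        using summable_on_SigmaD1[OF abs', of n] by simp
    qed
    then have "(\<lambda>n. infsum (\<lambda>p. h (p, n)) P) sums (\<Sum>\<^sub>\<infinity>p\<in>P. w p * exp (of_real (\<alpha> p) * z))"
      by (rule has_sum_imp_sums)
    moreover have "infsum (\<lambda>p. h (p, n)) P = (\<Sum>\<^sub>\<infinity>p\<in>P. w p * of_real (\<alpha> p) ^ n) / fact n * z ^ n" for n
    proof -
      have "infsum (\<lambda>p. h (p, n)) P = (\<Sum>\<^sub>\<infinity>p\<in>P. (w p * of_real (\<alpha> p) ^ n) * (z ^ n / fact n))"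
        by (rule infsum_cong) (simp add: h_def power_mult_distrib scaleR_conv_of_real field_simps)
      also have "\<dots> = (\<Sum>\<^sub>\<infinity>p\<in>P. w p * of_real (\<alpha> p) ^ n) * (z ^ n / fact n)"
        by (rule infsum_cmult_left')
      finally show ?thesis by simp
    qed
    ultimately show ?case by simp
  qed
qed

text \<open>A two-variable Taylor expansion in iterated form: first in v at fixed u, then each
  coefficient as a function of u. In the second part the power of \<gamma> is paid for by the
  \<gamma>-part of the weight.\<close>

lemma has_fps_expansion_exp_sum2:
  fixes w :: "'p \<Rightarrow> complex" and \<alpha> \<gamma> :: "'p \<Rightarrow> real"
  assumes r: "r > 0" and sm: "(\<lambda>p. norm (w p) * exp (r * (\<bar>\<alpha> p\<bar> + \<bar>\<gamma> p\<bar>))) summable_on P"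
  shows "norm u \<le> r \<Longrightarrow>
          (\<lambda>v. \<Sum>\<^sub>\<infinity>p\<in>P. w p * exp (of_real (\<alpha> p) * u) * exp (of_real (\<gamma> p) * v)) has_fps_expansion
           Abs_fps (\<lambda>n. (\<Sum>\<^sub>\<infinity>p\<in>P. w p * exp (of_real (\<alpha> p) * u) * of_real (\<gamma> p) ^ n) / fact n)" (is "_ \<Longrightarrow> ?th1")
    and "(\<lambda>u. (\<Sum>\<^sub>\<infinity>p\<in>P. w p * exp (of_real (\<alpha> p) * u) * of_real (\<gamma> p) ^ j) / fact j) has_fps_expansion
           Abs_fps (\<lambda>i. (\<Sum>\<^sub>\<infinity>p\<in>P. w p * of_real (\<alpha> p) ^ i * of_real (\<gamma> p) ^ j) / (fact i * fact j))" (is ?th2)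
proof -
  assume u: "norm u \<le> r"
  have "\<alpha> p * Re u \<le> r * \<bar>\<alpha> p\<bar>" for p
    using mult_Re_le[of "\<alpha> p" u] mult_right_mono[OF u, of "\<bar>\<alpha> p\<bar>"] by (simp add: mult.commute)
  then have "norm (w p * exp (of_real (\<alpha> p) * u)) * exp (r * \<bar>\<gamma> p\<bar>) \<le> norm (w p) * exp (r * (\<bar>\<alpha> p\<bar> + \<bar>\<gamma> p\<bar>))" for p
    by (simp add: norm_mult norm_exp_eq_Re ring_distribs exp_add mult.assoc mult_left_mono mult_right_mono)
  then have "(\<lambda>p. norm (w p * exp (of_real (\<alpha> p) * u)) * exp (r * \<bar>\<gamma> p\<bar>)) summable_on P"
    by (intro summable_on_comparison_test[OF sm]) auto
  from has_fps_expansion_exp_sum[OF r this] show ?th1 .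
next
  have "norm (w p * of_real (\<gamma> p) ^ j) * exp (r * \<bar>\<alpha> p\<bar>)
      \<le> fact j / r ^ j * (norm (w p) * exp (r * (\<bar>\<alpha> p\<bar> + \<bar>\<gamma> p\<bar>)))" for p
  proof -
    have "\<bar>\<gamma> p\<bar> ^ j * (norm (w p) * exp (r * \<bar>\<alpha> p\<bar>))
        \<le> (fact j / r ^ j * exp (r * \<bar>\<gamma> p\<bar>)) * (norm (w p) * exp (r * \<bar>\<alpha> p\<bar>))"
      using power_le_fact_exp[of "\<bar>\<gamma> p\<bar>" r j] r by (intro mult_right_mono) auto
    then show ?thesis by (simp add: norm_mult norm_power ring_distribs exp_add mult_ac)
  qed
  then have "(\<lambda>p. norm (w p * of_real (\<gamma> p) ^ j) * exp (r * \<bar>\<alpha> p\<bar>)) summable_on P"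
    by (intro summable_on_comparison_test[OF summable_on_cmult_right[OF sm, of "fact j / r ^ j"]]) auto
  from has_fps_expansion_exp_sum[OF r this]
  have "(\<lambda>u. (1 / fact j) * (\<Sum>\<^sub>\<infinity>p\<in>P. w p * of_real (\<gamma> p) ^ j * exp (of_real (\<alpha> p) * u))) has_fps_expansion
      fps_const (1 / fact j) * Abs_fps (\<lambda>n. (\<Sum>\<^sub>\<infinity>p\<in>P. w p * of_real (\<gamma> p) ^ j * of_real (\<alpha> p) ^ n) / fact n)"
    by (rule has_fps_expansion_cmult_left)
  also have "fps_const (1 / fact j) * Abs_fps (\<lambda>n. (\<Sum>\<^sub>\<infinity>p\<in>P. w p * of_real (\<gamma> p) ^ j * of_real (\<alpha> p) ^ n) / fact n)
     = Abs_fps (\<lambda>i. (\<Sum>\<^sub>\<infinity>p\<in>P. w p * of_real (\<alpha> p) ^ i * of_real (\<gamma> p) ^ j) / (fact i * fact j))"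
    by (rule fps_ext) (simp add: mult_ac)
  finally show ?th2 by (simp add: mult_ac)
qed

text \<open>The coefficients are derivatives at 0 and depend only on the germ. This turns theta
  identities that hold near 0 into identities of formal power series.\<close>

lemma has_fps_expansion_unique:
  fixes f g :: "complex \<Rightarrow> complex"
  assumes "f has_fps_expansion F" and "g has_fps_expansion G" and "\<forall>\<^sub>F z in nhds 0. f z = g z"
  shows "F = G"
proof (rule fps_ext)
  fix n
  show "fps_nth F n = fps_nth G n"
    unfolding fps_nth_fps_expansion[OF assms(1)] fps_nth_fps_expansion[OF assms(2)]
    by (subst higher_deriv_cong_ev[OF assms(3) refl]) simp
qed

section \<open>Theta functions\<close>

text \<open>
  Indices are doubled: even \<open>k\<close> stand for the integers \<open>k / 2\<close>, odd \<open>k\<close> for the half-integers.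
\<close>

definition jterm :: "complex \<Rightarrow> complex \<Rightarrow> int \<Rightarrow> complex" where
  "jterm \<tau> z k = qpow \<tau> ((of_int k)\<^sup>2 / 8) * exp (of_int k / 2 * z)"

definition theta2 :: "complex \<Rightarrow> complex \<Rightarrow> complex" where
  "theta2 \<tau> z = (\<Sum>\<^sub>\<infinity>k\<in>{k. odd k}. jterm \<tau> z k)"

definition theta3 :: "complex \<Rightarrow> complex \<Rightarrow> complex" where
  "theta3 \<tau> z = (\<Sum>\<^sub>\<infinity>k\<in>{k. even k}. jterm \<tau> z k)"

text \<open>The variable z is 2 i times the classical one. The factor \<open>- \<i>\<close> makes
  the leading term 2 q^(1/8) sinh(z/2), so the derivative at 0 begins with q^(1/8).\<close>

definition theta1 :: "complex \<Rightarrow> complex \<Rightarrow> complex" where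
  "theta1 \<tau> z = - \<i> * theta2 \<tau> (z + of_real pi * \<i>)"

definition theta4 :: "complex \<Rightarrow> complex \<Rightarrow> complex" where
  "theta4 \<tau> z = theta3 \<tau> (z + of_real pi * \<i>)"

lemma jterm_exp: "jterm \<tau> z k = exp (of_real pi * \<i> * (of_int k)\<^sup>2 / 4 * \<tau> + of_int k / 2 * z)"
  by (simp add: jterm_def qpow_def exp_add mult_ac)

lemma jterm_shift: "jterm \<tau> (z + c) k = jterm \<tau> c k * exp (of_int k / 2 * z)"
  by (simp add: jterm_def ring_distribs exp_add)

lemma jterm_uminus: "jterm \<tau> z (- k) = jterm \<tau> (- z) k"
  by (simp add: jterm_def)

lemma norm_jterm: "norm (jterm \<tau> z k) = exp (- (pi / 4 * Im \<tau>) * (of_int k)\<^sup>2 + of_int k / 2 * Re z)"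
proof -
  have "Re (of_int k / 2 * z) = of_int k / 2 * Re z"
    using scaleR_complex.simps(1)[of "of_int k / 2" z] by (simp add: scaleR_conv_of_real)
  then show ?thesis
    by (simp add: jterm_def norm_mult norm_qpow norm_exp_eq_Re mult_ac flip: exp_add)
qed

text \<open>A Gaussian beats every linear exponent: s x - c x^2 is at most s^2 / (4 c). The summand
  1 in s leaves a factor \<open>exp (- 1 * \<bar>real_of_int k\<bar>)\<close> with which to
  sum.\<close>

lemma jterm_summable_exp:
  assumes "Im \<tau> > 0"
  shows "(\<lambda>k. norm (jterm \<tau> z k) * exp (r * \<bar>real_of_int k\<bar>)) summable_on A"
proof -
  define c where "c = pi / 4 * Im \<tau>"
  define s where "s = \<bar>Re z\<bar> / 2 + r + 1"
  have c: "c > 0" using assms by (simp add: c_def)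
  have *: "norm (jterm \<tau> z k) * exp (r * \<bar>real_of_int k\<bar>) \<le> exp (s\<^sup>2 / (4 * c)) * exp (- 1 * \<bar>real_of_int k\<bar>)" for k
  proof -
    define x where "x = \<bar>real_of_int k\<bar>"
    have "of_int k / 2 * Re z \<le> x * (\<bar>Re z\<bar> / 2)"
      using abs_ge_self[of "of_int k * Re z"] by (simp add: x_def abs_mult)
    moreover have "s * x - c * x\<^sup>2 \<le> s\<^sup>2 / (4 * c)"
    proof -
      have "0 \<le> (s - 2 * c * x)\<^sup>2" by simp
      then have "4 * c * (s * x - c * x\<^sup>2) \<le> s\<^sup>2"
        by (simp add: power2_eq_square algebra_simps)
      then show ?thesis using c by (simp add: field_simps)
    qed
    moreover have "(of_int k)\<^sup>2 = x\<^sup>2" by (simp add: x_def)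
    ultimately have "- c * (of_int k)\<^sup>2 + of_int k / 2 * Re z + r * x \<le> s\<^sup>2 / (4 * c) + - 1 * x"
      by (simp add: s_def algebra_simps)
    then have "exp (- c * (of_int k)\<^sup>2 + of_int k / 2 * Re z + r * x) \<le> exp (s\<^sup>2 / (4 * c) + - 1 * x)"
      by simp
    then show ?thesis
      unfolding norm_jterm exp_add c_def[symmetric] x_def .
  qed
  show ?thesis
    by (rule summable_on_comparison_test[OF summable_on_cmult_right[OF summable_on_exp_abs_int[of 1]]])
       (use * in auto)
qed

lemma jterm_abs_summable: "Im \<tau> > 0 \<Longrightarrow> (\<lambda>k. norm (jterm \<tau> z k)) summable_on A"
  using jterm_summable_exp[of \<tau> z 0 A] by simp

lemma jterm_summable: "Im \<tau> > 0 \<Longrightarrow> jterm \<tau> z summable_on A"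
  by (rule abs_summable_summable) (rule jterm_abs_summable)

lemma has_sum_theta2: "Im \<tau> > 0 \<Longrightarrow> (jterm \<tau> z has_sum theta2 \<tau> z) {k. odd k}"
  by (simp add: theta2_def jterm_summable)

lemma has_sum_theta3: "Im \<tau> > 0 \<Longrightarrow> (jterm \<tau> z has_sum theta3 \<tau> z) {k. even k}"
  by (simp add: theta3_def jterm_summable)

lemma has_sum_theta_times:
  assumes "Im \<tau> > 0" and "(jterm \<tau> u has_sum a) A" and "(jterm \<tau> v has_sum b) B"
  shows "((\<lambda>(k, l). jterm \<tau> u k * jterm \<tau> v l) has_sum a * b) (A \<times> B)"
  using assms by (intro has_sum_times jterm_abs_summable)

section \<open>Products of two theta functions by rotating the index lattice\<close>

lemma Im_half_double: "Im \<tau> > 0 \<Longrightarrow> Im (2 * \<tau>) > 0" "Im \<tau> > 0 \<Longrightarrow> Im (\<tau> / 2) > 0"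
  by simp_all

text \<open>This is (s + t)^2 + (s - t)^2 = 2 s^2 + 2 t^2 together with its bilinear companion (s +
  t)(u + v) + (s - t)(u - v) = 2 s u + 2 t v.\<close>

lemma jterm_rotate:
  "jterm \<tau> (u + v) (s + t) * jterm \<tau> (u - v) (s - t) = jterm (2 * \<tau>) (2 * u) s * jterm (2 * \<tau>) (2 * v) t"
  unfolding jterm_exp exp_add[symmetric]
  by (rule arg_cong[of _ _ exp]) (simp add: field_simps power2_eq_square)

lemma jterm_rotate_div:
  assumes "even (k + l)"
  shows "jterm (2 * \<tau>) (2 * u) ((k + l) div 2) * jterm (2 * \<tau>) (2 * v) ((k - l) div 2) =
    jterm \<tau> (u + v) k * jterm \<tau> (u - v) l"
proof -
  have "(k + l) div 2 + (k - l) div 2 = k" "(k + l) div 2 - (k - l) div 2 = l"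
    using assms by presburger+
  then show ?thesis using jterm_rotate[of \<tau> u v "(k + l) div 2" "(k - l) div 2"] by simp
qed

text \<open>The same rotation with k + l and k - l as the new indices, which also serves pairs of
  opposite parity, where (k + l) / 2 is not an integer.\<close>

lemma jterm_rotate_half:
  "jterm \<tau> (u + v) k * jterm \<tau> (u - v) l = jterm (\<tau> / 2) u (k + l) * jterm (\<tau> / 2) v (k - l)"
  unfolding jterm_exp exp_add[symmetric]
  by (rule arg_cong[of _ _ exp]) (simp add: field_simps power2_eq_square)

text \<open>The indices s + t and s - t are both even exactly when s and t have the same parity,
  which gives the two products on the right. In \<open>theta2_add_diff\<close> they are both odd,
  and s and t have opposite parity.\<close>

lemma theta3_add_diff:
  assumes "Im \<tau> > 0"
  shows "theta3 \<tau> (u + v) * theta3 \<tau> (u - v) =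
    theta3 (2 * \<tau>) (2 * u) * theta3 (2 * \<tau>) (2 * v) + theta2 (2 * \<tau>) (2 * u) * theta2 (2 * \<tau>) (2 * v)"
proof -
  have "((\<lambda>(k, l). jterm \<tau> (u + v) k * jterm \<tau> (u - v) l) has_sum theta3 \<tau> (u + v) * theta3 \<tau> (u - v))
     ({k. even k} \<times> {l. even l})"
    by (intro has_sum_theta_times has_sum_theta3 assms)
  also have "?this \<longleftrightarrow> ((\<lambda>(s, t). jterm (2 * \<tau>) (2 * u) s * jterm (2 * \<tau>) (2 * v) t) has_sum theta3 \<tau> (u + v) * theta3 \<tau> (u - v))
     ({s. even s} \<times> {t. even t} \<union> {s. odd s} \<times> {t. odd t})"
  proof (rule has_sum_reindex_bij_witness[of _ "\<lambda>(s, t). (s + t, s - t)" "\<lambda>(k, l). ((k + l) div 2, (k - l) div 2)"], goal_cases)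
    case (5 a)
    then show ?case
      using jterm_rotate_div[of "fst a" "snd a" \<tau> u v] by (simp add: case_prod_unfold mem_Times_iff)
  qed (auto; presburger)+
  finally have "((\<lambda>(s, t). jterm (2 * \<tau>) (2 * u) s * jterm (2 * \<tau>) (2 * v) t) has_sum theta3 \<tau> (u + v) * theta3 \<tau> (u - v))
     ({s. even s} \<times> {t. even t} \<union> {s. odd s} \<times> {t. odd t})" .
  moreover have "((\<lambda>(s, t). jterm (2 * \<tau>) (2 * u) s * jterm (2 * \<tau>) (2 * v) t) has_sum
     theta3 (2 * \<tau>) (2 * u) * theta3 (2 * \<tau>) (2 * v) + theta2 (2 * \<tau>) (2 * u) * theta2 (2 * \<tau>) (2 * v))
     ({s. even s} \<times> {t. even t} \<union> {s. odd s} \<times> {t. odd t})"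
    using assms by (intro has_sum_Un_disjoint has_sum_theta_times has_sum_theta3 has_sum_theta2) auto
  ultimately show ?thesis by (rule has_sum_unique)
qed

lemma theta2_add_diff:
  assumes "Im \<tau> > 0"
  shows "theta2 \<tau> (u + v) * theta2 \<tau> (u - v) =
    theta2 (2 * \<tau>) (2 * u) * theta3 (2 * \<tau>) (2 * v) + theta3 (2 * \<tau>) (2 * u) * theta2 (2 * \<tau>) (2 * v)"
proof -
  have "((\<lambda>(k, l). jterm \<tau> (u + v) k * jterm \<tau> (u - v) l) has_sum theta2 \<tau> (u + v) * theta2 \<tau> (u - v))
     ({k. odd k} \<times> {l. odd l})"
    by (intro has_sum_theta_times has_sum_theta2 assms)
  also have "?this \<longleftrightarrow> ((\<lambda>(s, t). jterm (2 * \<tau>) (2 * u) s * jterm (2 * \<tau>) (2 * v) t) has_sum theta2 \<tau> (u + v) * theta2 \<tau> (u - v))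
     ({s. odd s} \<times> {t. even t} \<union> {s. even s} \<times> {t. odd t})"
  proof (rule has_sum_reindex_bij_witness[of _ "\<lambda>(s, t). (s + t, s - t)" "\<lambda>(k, l). ((k + l) div 2, (k - l) div 2)"], goal_cases)
    case (5 a)
    then show ?case
      using jterm_rotate_div[of "fst a" "snd a" \<tau> u v] by (simp add: case_prod_unfold mem_Times_iff)
  qed (auto; presburger)+
  finally have "((\<lambda>(s, t). jterm (2 * \<tau>) (2 * u) s * jterm (2 * \<tau>) (2 * v) t) has_sum theta2 \<tau> (u + v) * theta2 \<tau> (u - v))
     ({s. odd s} \<times> {t. even t} \<union> {s. even s} \<times> {t. odd t})" .
  moreover have "((\<lambda>(s, t). jterm (2 * \<tau>) (2 * u) s * jterm (2 * \<tau>) (2 * v) t) has_sum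
     theta2 (2 * \<tau>) (2 * u) * theta3 (2 * \<tau>) (2 * v) + theta3 (2 * \<tau>) (2 * u) * theta2 (2 * \<tau>) (2 * v))
     ({s. odd s} \<times> {t. even t} \<union> {s. even s} \<times> {t. odd t})"
    using assms by (intro has_sum_Un_disjoint has_sum_theta_times has_sum_theta3 has_sum_theta2) auto
  ultimately show ?thesis by (rule has_sum_unique)
qed

text \<open>For odd s and t exactly one of s - t and s + t is divisible by 4. The two products on
  the left yield these two classes; only together do they fill the lattice of all pairs of odd
  indices.\<close>

lemma theta2_theta3_add_diff:
  assumes "Im \<tau> > 0"
  shows "theta2 \<tau> (u + v) * theta3 \<tau> (u - v) + theta2 \<tau> (u - v) * theta3 \<tau> (u + v) =
    theta2 (\<tau> / 2) u * theta2 (\<tau> / 2) v"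
proof -
  let ?g = "\<lambda>(s, t). jterm (\<tau> / 2) u s * jterm (\<tau> / 2) v t"
  let ?A = "{(s, t::int). odd s \<and> odd t \<and> 4 dvd (s - t)}"
  let ?B = "{(s, t::int). odd s \<and> odd t \<and> 4 dvd (s + t)}"
  have "((\<lambda>(k, l). jterm \<tau> (u + v) k * jterm \<tau> (u - v) l) has_sum theta2 \<tau> (u + v) * theta3 \<tau> (u - v))
     ({k. odd k} \<times> {l. even l})"
    by (intro has_sum_theta_times has_sum_theta2 has_sum_theta3 assms)
  also have "?this \<longleftrightarrow> (?g has_sum theta2 \<tau> (u + v) * theta3 \<tau> (u - v)) ?A"
    by (rule has_sum_reindex_bij_witness[of _ "\<lambda>(s, t). ((s + t) div 2, (s - t) div 2)" "\<lambda>(k, l). (k + l, k - l)"])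
       (auto simp: jterm_rotate_half; presburger)+
  finally have 1: "(?g has_sum theta2 \<tau> (u + v) * theta3 \<tau> (u - v)) ?A" .
  have "((\<lambda>(k, l). jterm \<tau> (u - v) k * jterm \<tau> (u + v) l) has_sum theta2 \<tau> (u - v) * theta3 \<tau> (u + v))
     ({k. odd k} \<times> {l. even l})"
    by (intro has_sum_theta_times has_sum_theta2 has_sum_theta3 assms)
  also have "?this \<longleftrightarrow> (?g has_sum theta2 \<tau> (u - v) * theta3 \<tau> (u + v)) ?B"
  proof (rule has_sum_reindex_bij_witness[of _ "\<lambda>(s, t). ((s - t) div 2, (s + t) div 2)" "\<lambda>(k, l). (k + l, l - k)"])
    fix a :: "int \<times> int"
    show "?g (case a of (k, l) \<Rightarrow> (k + l, l - k)) = (case a of (k, l) \<Rightarrow> jterm \<tau> (u - v) k * jterm \<tau> (u + v) l)"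
      using jterm_rotate_half[of \<tau> u v "snd a" "fst a"] by (simp add: case_prod_unfold mult.commute add.commute)
  qed (auto; presburger)+
  finally have 2: "(?g has_sum theta2 \<tau> (u - v) * theta3 \<tau> (u + v)) ?B" .
  have "?A \<inter> ?B = {}" by auto presburger
  from has_sum_Un_disjoint[OF 1 2 this]
  have "(?g has_sum theta2 \<tau> (u + v) * theta3 \<tau> (u - v) + theta2 \<tau> (u - v) * theta3 \<tau> (u + v)) (?A \<union> ?B)" .
  also have "?A \<union> ?B = {s. odd s} \<times> {t. odd t}" by auto presburger
  finally show ?thesis
    by (rule has_sum_unique[OF _ has_sum_theta_times[OF _ has_sum_theta2 has_sum_theta2]]) (use assms in auto)
qed

section \<open>Periods, parity, addition theorems and null values\<close>

lemma exp_int_pi_i: "exp (of_int k * (of_real pi * \<i>)) = (if even k then 1 else - 1)"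
proof -
  have "exp (of_int k * (of_real pi * \<i>)) = cis (pi * of_int k)"
    by (simp add: cis_conv_exp mult_ac)
  then show ?thesis by (auto simp: complex_eq_iff)
qed

lemma jterm_2pi: "jterm \<tau> (z + 2 * (of_real pi * \<i>)) k = (if even k then 1 else - 1) * jterm \<tau> z k"
proof -
  have "exp (of_int k / 2 * (z + 2 * (of_real pi * \<i>))) = exp (of_int k / 2 * z) * exp (of_int k * (of_real pi * \<i>))"
    by (simp add: ring_distribs exp_add)
  then show ?thesis unfolding jterm_def exp_int_pi_i by simp
qed

lemma theta3_2pi: "theta3 \<tau> (z + 2 * (of_real pi * \<i>)) = theta3 \<tau> z"
  unfolding theta3_def by (rule infsum_cong) (simp add: jterm_2pi)

lemma theta2_2pi: "theta2 \<tau> (z + 2 * (of_real pi * \<i>)) = - theta2 \<tau> z"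
  unfolding theta2_def infsum_uminus[symmetric] by (rule infsum_cong) (simp add: jterm_2pi)

lemma theta2_uminus: "theta2 \<tau> (- z) = theta2 \<tau> z"
  unfolding theta2_def
  by (rule infsum_reindex_bij_witness[of _ uminus uminus]) (auto simp: jterm_uminus)

lemma theta3_uminus: "theta3 \<tau> (- z) = theta3 \<tau> z"
  unfolding theta3_def
  by (rule infsum_reindex_bij_witness[of _ uminus uminus]) (auto simp: jterm_uminus)

lemma theta1_uminus: "theta1 \<tau> (- z) = - theta1 \<tau> z"
  using theta2_uminus[of \<tau> "z - of_real pi * \<i>"] theta2_2pi[of \<tau> "z - of_real pi * \<i>"]
  by (simp add: theta1_def algebra_simps)

lemma theta4_uminus: "theta4 \<tau> (- z) = theta4 \<tau> z"
  using theta3_uminus[of \<tau> "z - of_real pi * \<i>"] theta3_2pi[of \<tau> "z - of_real pi * \<i>"]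
  by (simp add: theta4_def algebra_simps)

lemma theta1_0 [simp]: "theta1 \<tau> 0 = 0"
  using theta1_uminus[of \<tau> 0] by simp

text \<open>The rotation formulas make all products at \<tau> bilinear in \<open>E\<close> and
  \<open>O'\<close>, which live at 2 \<tau>, and the shift by \<pi> i fixes \<open>E\<close> and
  negates \<open>O'\<close>. What remains is a polynomial identity in the values of \<open>E\<close>
  and \<open>O'\<close> at u, v and 0.\<close>

lemma theta4_add_diff:
  assumes "Im \<tau> > 0"
  shows "theta4 \<tau> (u + v) * theta4 \<tau> (u - v) * (theta4 \<tau> 0)\<^sup>2 =
    (theta4 \<tau> u)\<^sup>2 * (theta4 \<tau> v)\<^sup>2 - (theta1 \<tau> u)\<^sup>2 * (theta1 \<tau> v)\<^sup>2"
proof -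
  define E where "E x = theta3 (2 * \<tau>) (2 * x)" for x
  define O' where "O' x = theta2 (2 * \<tau>) (2 * x)" for x
  let ?p = "of_real pi * \<i> :: complex"
  have E: "E (x + ?p) = E x" and O: "O' (x + ?p) = - O' x" for x
    using theta3_2pi[of "2 * \<tau>" "2 * x"] theta2_2pi[of "2 * \<tau>" "2 * x"]
    by (simp_all add: E_def O'_def ring_distribs)
  have prod: "theta4 \<tau> (x + y) * theta4 \<tau> (x - y) = E x * E y - O' x * O' y" for x y
    using theta3_add_diff[OF assms, of "x + ?p" y] E[of x] O[of x]
    by (simp add: theta4_def E_def O'_def algebra_simps)
  have sq4: "(theta4 \<tau> x)\<^sup>2 = E x * E 0 - O' x * O' 0" for x
    using prod[of x 0] by (simp add: power2_eq_square)
  have sq1: "(theta1 \<tau> x)\<^sup>2 = O' x * E 0 - E x * O' 0" for x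
    using theta2_add_diff[OF assms, of "x + ?p" 0] E[of x] O[of x]
    by (simp add: theta1_def E_def O'_def algebra_simps power2_eq_square)
  show ?thesis
    unfolding prod sq4 sq1 by (simp add: algebra_simps)
qed

text \<open>A Landen transformation, the case v = 0 of the mixed product. Its linear coefficient
  tells how the derivative of \<open>theta1\<close> at 0 behaves under doubling of \<tau>.\<close>

lemma theta1_half:
  assumes "Im \<tau> > 0"
  shows "2 * theta1 \<tau> u * theta4 \<tau> u = theta1 (\<tau> / 2) u * theta2 (\<tau> / 2) 0"
  using theta2_theta3_add_diff[OF assms, of "u + of_real pi * \<i>" 0]
  by (simp add: theta1_def theta4_def)

text \<open>The left side is the numerator of K(u + v, 0) + K(u - v, 0) over a common denominator.
  It separates into a function of u and a function of v, as the first kernel requires;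
  \<open>theta1_half\<close> brings the u-part back from \<tau> / 2 to \<tau>.\<close>

lemma theta1_theta4_add_diff:
  assumes "Im \<tau> > 0"
  shows "(theta1 \<tau> (u + v) * theta4 \<tau> (u - v) + theta1 \<tau> (u - v) * theta4 \<tau> (u + v)) * theta2 (\<tau> / 2) 0 =
    2 * theta1 \<tau> u * theta4 \<tau> u * theta2 (\<tau> / 2) v"
proof -
  have "theta1 \<tau> (u + v) * theta4 \<tau> (u - v) + theta1 \<tau> (u - v) * theta4 \<tau> (u + v) = theta1 (\<tau> / 2) u * theta2 (\<tau> / 2) v"
    using arg_cong[OF theta2_theta3_add_diff[OF assms, of "u + of_real pi * \<i>" v], of "\<lambda>x. - \<i> * x"]
    by (simp add: theta1_def theta4_def algebra_simps)
  then show ?thesis using theta1_half[OF assms, of u] by simp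
qed

text \<open>With u = v = \<pi> i / 2 the arguments on the left are \<pi> i and 0, and the
  \<open>theta2\<close> term on the right is a multiple of the square of \<open>theta1\<close> at
  0.\<close>

lemma theta3_theta4_null:
  assumes "Im \<tau> > 0"
  shows "theta3 \<tau> 0 * theta4 \<tau> 0 = (theta4 (2 * \<tau>) 0)\<^sup>2"
  using theta3_add_diff[OF assms, of "of_real pi * \<i> / 2" "of_real pi * \<i> / 2"] theta1_0[of "2 * \<tau>"]
  by (simp add: theta4_def theta1_def power2_eq_square mult.commute)

lemma theta2_null_sq:
  assumes "Im \<tau> > 0"
  shows "(theta2 \<tau> 0)\<^sup>2 = 2 * theta2 (2 * \<tau>) 0 * theta3 (2 * \<tau>) 0"
  using theta2_add_diff[OF assms, of 0 0] by (simp add: power2_eq_square)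

text \<open>At \<tau> / 2 the exponent is k^2 / 16, and with k = 2 n this is the exponent n^2 / 4 in
  the half-integer form of \<open>theta_triangle\<close>.\<close>

lemma theta2_half_null:
  assumes "Im \<tau> > 0"
  shows "theta2 (\<tau> / 2) 0 = 2 * theta_triangle \<tau>"
proof -
  have "((\<lambda>n. qpow \<tau> (n\<^sup>2 / 4)) has_sum 2 * theta_triangle \<tau>) half_ints"
    using assms by (rule theta_triangle_half_ints)
  also have "?this \<longleftrightarrow> (jterm (\<tau> / 2) 0 has_sum 2 * theta_triangle \<tau>) {k. odd k}"
  proof (rule has_sum_reindex_bij_witness[of _ "\<lambda>k. real_of_int k / 2" "\<lambda>x. \<lfloor>2 * x\<rfloor>"])
    fix x assume "x \<in> half_ints"
    then obtain j :: int where j: "x = 1 / 2 + of_int j" by (auto simp: half_ints_def)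
    then have *: "2 * x = real_of_int (2 * j + 1)" by simp
    show "real_of_int \<lfloor>2 * x\<rfloor> / 2 = x" "\<lfloor>2 * x\<rfloor> \<in> {k. odd k}"
      unfolding * floor_of_int using * by simp_all
    have floor: "real_of_int \<lfloor>2 * x\<rfloor> = 2 * x" unfolding * floor_of_int ..
    show "jterm (\<tau> / 2) 0 \<lfloor>2 * x\<rfloor> = qpow \<tau> (x\<^sup>2 / 4)"
      unfolding jterm_def floor by (simp add: qpow_def power2_eq_square mult_ac)
  next
    fix k :: int assume "k \<in> {k. odd k}"
    then show "real_of_int k / 2 \<in> half_ints"
      by (auto simp: half_ints_def elim!: oddE)
  qed auto
  finally show ?thesis
    using assms by (intro has_sum_unique[OF has_sum_theta2]) auto
qed

section \<open>Taylor series of the theta functions\<close>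

definition theta1_fps :: "complex \<Rightarrow> complex fps" where
  "theta1_fps \<tau> = Abs_fps (\<lambda>n. - \<i> * (\<Sum>\<^sub>\<infinity>k\<in>{k. odd k}. jterm \<tau> (of_real pi * \<i>) k * (of_int k / 2) ^ n) / fact n)"

text \<open>The centre c is a parameter because the second kernel expands \<open>theta4\<close>
  around v, - v and 0.\<close>

definition theta4_fps :: "complex \<Rightarrow> complex \<Rightarrow> complex fps" where
  "theta4_fps \<tau> c = Abs_fps (\<lambda>n. (\<Sum>\<^sub>\<infinity>k\<in>{k. even k}. jterm \<tau> (c + of_real pi * \<i>) k * (of_int k / 2) ^ n) / fact n)"

lemma has_fps_expansion_jterm_sum:
  assumes "Im \<tau> > 0"
  shows "(\<lambda>z. \<Sum>\<^sub>\<infinity>k\<in>A. jterm \<tau> (z + c) k) has_fps_expansion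
     Abs_fps (\<lambda>n. (\<Sum>\<^sub>\<infinity>k\<in>A. jterm \<tau> c k * (of_int k / 2) ^ n) / fact n)"
proof -
  have "(\<lambda>k. norm (jterm \<tau> c k) * exp (1 * \<bar>real_of_int k / 2\<bar>)) summable_on A"
    using jterm_summable_exp[OF assms, of c "1 / 2" A] by simp
  from has_fps_expansion_exp_sum[OF _ this] show ?thesis
    by (simp add: jterm_shift)
qed

lemma has_fps_expansion_theta1:
  assumes "Im \<tau> > 0"
  shows "theta1 \<tau> has_fps_expansion theta1_fps \<tau>"
proof -
  have "(\<lambda>z. - \<i> * (\<Sum>\<^sub>\<infinity>k\<in>{k. odd k}. jterm \<tau> (z + of_real pi * \<i>) k)) has_fps_expansion
     fps_const (- \<i>) * Abs_fps (\<lambda>n. (\<Sum>\<^sub>\<infinity>k\<in>{k. odd k}. jterm \<tau> (of_real pi * \<i>) k * (of_int k / 2) ^ n) / fact n)"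
    by (intro has_fps_expansion_cmult_left has_fps_expansion_jterm_sum assms)
  also have "fps_const (- \<i>) * Abs_fps (\<lambda>n. (\<Sum>\<^sub>\<infinity>k\<in>{k. odd k}. jterm \<tau> (of_real pi * \<i>) k * (of_int k / 2) ^ n) / fact n) = theta1_fps \<tau>"
    by (rule fps_ext) (simp add: theta1_fps_def)
  also have "(\<lambda>z. - \<i> * (\<Sum>\<^sub>\<infinity>k\<in>{k. odd k}. jterm \<tau> (z + of_real pi * \<i>) k)) = theta1 \<tau>"
    by (simp add: theta1_def theta2_def fun_eq_iff)
  finally show ?thesis .
qed

lemma has_fps_expansion_theta4_shift:
  assumes "Im \<tau> > 0"
  shows "(\<lambda>z. theta4 \<tau> (z + c)) has_fps_expansion theta4_fps \<tau> c"
  using has_fps_expansion_jterm_sum[OF assms, of "c + of_real pi * \<i>" "{k. even k}"]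
  by (simp add: theta4_def theta3_def theta4_fps_def add.assoc)

lemma has_fps_expansion_theta4:
  assumes "Im \<tau> > 0"
  shows "theta4 \<tau> has_fps_expansion theta4_fps \<tau> 0"
  using has_fps_expansion_theta4_shift[OF assms, of 0] by simp

lemma theta1_fps_0 [simp]: "fps_nth (theta1_fps \<tau>) 0 = 0"
  using theta1_0[of \<tau>] by (simp add: theta1_fps_def theta1_def theta2_def)

lemma theta4_fps_0 [simp]: "fps_nth (theta4_fps \<tau> c) 0 = theta4 \<tau> c"
  by (simp add: theta4_fps_def theta4_def theta3_def)

lemma theta1_deriv_half:
  assumes "Im \<tau> > 0"
  shows "2 * fps_nth (theta1_fps \<tau>) 1 * theta4 \<tau> 0 = fps_nth (theta1_fps (\<tau> / 2)) 1 * theta2 (\<tau> / 2) 0"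
proof -
  have "fps_const 2 * (theta1_fps \<tau> * theta4_fps \<tau> 0) = theta1_fps (\<tau> / 2) * fps_const (theta2 (\<tau> / 2) 0)"
    by (rule has_fps_expansion_unique[OF has_fps_expansion_cmult_left[OF has_fps_expansion_mult[OF
          has_fps_expansion_theta1 has_fps_expansion_theta4]] has_fps_expansion_cmult_right[OF has_fps_expansion_theta1]])
       (use assms theta1_half[OF assms] in \<open>auto simp: mult_ac\<close>)
  from arg_cong[OF this, of "\<lambda>F. fps_nth F 1"] show ?thesis
    by (simp add: fps_mult_nth mult.assoc)
qed

section \<open>Limits under doubling and Jacobi's derivative formula\<close>

lemma Im_power2_mult: "Im (2 ^ n * \<tau>) = 2 ^ n * Im \<tau>"
  using scaleR_complex.simps(2)[of "2 ^ n" \<tau>] by (simp add: scaleR_conv_of_real)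

text \<open>Doubling \<tau> squares each \<open>qpow \<tau> (e k)\<close>. Terms of exponent 0 stay
  put, and the gap \<delta> makes all others shrink at a common rate. The limit follows the points
  \<open>2 ^ n * \<tau>\<close> because it will be applied to a quotient that is invariant under
  doubling.\<close>

lemma tendsto_qpow_sum:
  fixes c :: "int \<Rightarrow> complex" and e :: "int \<Rightarrow> real"
  assumes "Im \<tau> > 0" and fin: "finite F" and FA: "F \<subseteq> A" and e0: "\<And>k. k \<in> F \<Longrightarrow> e k = 0"
    and d: "\<delta> > 0" "\<And>k. k \<in> A - F \<Longrightarrow> e k \<ge> \<delta>"
    and sm: "(\<lambda>k. norm (c k * qpow \<tau> (e k))) summable_on A"
  shows "(\<lambda>n. \<Sum>\<^sub>\<infinity>k\<in>A. c k * qpow (2 ^ n * \<tau>) (e k)) \<longlonglongrightarrow> (\<Sum>k\<in>F. c k)"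
proof -
  define \<rho> where "\<rho> = exp (- 2 * pi * \<delta> * Im \<tau>)"
  have \<rho>: "0 < \<rho>" "\<rho> < 1" using assms(1) d by (simp_all add: \<rho>_def)
  define C where "C = (\<Sum>\<^sub>\<infinity>k\<in>A - F. norm (c k * qpow \<tau> (e k)))"
  have sm': "(\<lambda>k. norm (c k * qpow \<tau> (e k))) summable_on A - F"
    using sm by (rule summable_on_subset) auto
  have bound: "norm (c k * qpow (2 ^ n * \<tau>) (e k)) \<le> \<rho> ^ (2 ^ n - 1) * norm (c k * qpow \<tau> (e k))" if "k \<in> A - F" for n k
  proof -
    have "norm (qpow (2 ^ n * \<tau>) (e k)) = exp (- 2 * pi * e k * Im \<tau>) ^ (2 ^ n)"
      by (simp add: norm_qpow Im_power2_mult flip: exp_of_nat_mult)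
    \<comment> \<open>One of the \<open>2 ^ n\<close> factors is set aside: it rebuilds the summable
      term at \<tau> itself, and the other ones are bounded by powers of \<rho>.\<close>
    also have "\<dots> = exp (- 2 * pi * e k * Im \<tau>) ^ (2 ^ n - 1) * exp (- 2 * pi * e k * Im \<tau>)"
      by (subst power_Suc2[symmetric]) simp
    also have "\<dots> \<le> \<rho> ^ (2 ^ n - 1) * exp (- 2 * pi * e k * Im \<tau>)"
      using d(2)[OF that] assms(1) unfolding \<rho>_def by (intro mult_right_mono power_mono) auto
    finally have "norm (qpow (2 ^ n * \<tau>) (e k)) \<le> \<rho> ^ (2 ^ n - 1) * norm (qpow \<tau> (e k))"
      by (simp add: norm_qpow)
    from mult_left_mono[OF this, of "norm (c k)"] show ?thesis by (simp add: norm_mult mult_ac)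
  qed
  have smn: "(\<lambda>k. norm (c k * qpow (2 ^ n * \<tau>) (e k))) summable_on A - F" for n
    by (rule summable_on_comparison_test[OF summable_on_cmult_right[OF sm', of "\<rho> ^ (2 ^ n - 1)"]]) (use bound in auto)
  have eq: "(\<Sum>\<^sub>\<infinity>k\<in>A. c k * qpow (2 ^ n * \<tau>) (e k)) = (\<Sum>k\<in>F. c k) + (\<Sum>\<^sub>\<infinity>k\<in>A - F. c k * qpow (2 ^ n * \<tau>) (e k))" for n
  proof -
    have "(\<Sum>\<^sub>\<infinity>k\<in>F \<union> (A - F). c k * qpow (2 ^ n * \<tau>) (e k)) =
      (\<Sum>\<^sub>\<infinity>k\<in>F. c k * qpow (2 ^ n * \<tau>) (e k)) + (\<Sum>\<^sub>\<infinity>k\<in>A - F. c k * qpow (2 ^ n * \<tau>) (e k))"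
      by (rule infsum_Un_disjoint) (use fin abs_summable_summable[OF smn] in auto)
    moreover have "F \<union> (A - F) = A" using FA by auto
    moreover have "(\<Sum>k\<in>F. c k * qpow (2 ^ n * \<tau>) (e k)) = (\<Sum>k\<in>F. c k)"
      by (rule sum.cong) (auto simp: e0 qpow_def)
    ultimately show ?thesis using fin by simp
  qed
  have "(\<lambda>n. \<Sum>\<^sub>\<infinity>k\<in>A - F. c k * qpow (2 ^ n * \<tau>) (e k)) \<longlonglongrightarrow> 0"
  proof (rule tendsto_norm_zero_cancel, rule tendsto_sandwich[OF _ _ tendsto_const])
    have "norm (\<Sum>\<^sub>\<infinity>k\<in>A - F. c k * qpow (2 ^ n * \<tau>) (e k)) \<le> \<rho> ^ n * C" for n
    proof -
      have "norm (\<Sum>\<^sub>\<infinity>k\<in>A - F. c k * qpow (2 ^ n * \<tau>) (e k)) \<le> (\<Sum>\<^sub>\<infinity>k\<in>A - F. norm (c k * qpow (2 ^ n * \<tau>) (e k)))"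
        by (rule norm_infsum_bound[OF smn])
      also have "\<dots> \<le> (\<Sum>\<^sub>\<infinity>k\<in>A - F. \<rho> ^ (2 ^ n - 1) * norm (c k * qpow \<tau> (e k)))"
        by (rule infsum_mono[OF smn summable_on_cmult_right[OF sm']]) (use bound in auto)
      also have "\<dots> = \<rho> ^ (2 ^ n - 1) * C"
        unfolding C_def by (rule infsum_cmult_right')
      also have "\<dots> \<le> \<rho> ^ n * C"
      proof (intro mult_right_mono power_decreasing)
        show "n \<le> 2 ^ n - 1"
          using less_exp[of n] by linarith
        show "0 \<le> C" unfolding C_def by (rule infsum_nonneg) auto
      qed (use \<rho> in auto)
      finally show ?thesis .
    qed
    then show "\<forall>\<^sub>F n in sequentially. norm (\<Sum>\<^sub>\<infinity>k\<in>A - F. c k * qpow (2 ^ n * \<tau>) (e k)) \<le> \<rho> ^ n * C"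
      by simp
    show "(\<lambda>n. \<rho> ^ n * C) \<longlonglongrightarrow> 0"
      using \<rho> by (intro tendsto_mult_left_zero LIMSEQ_realpow_zero) auto
  qed auto
  then have "(\<lambda>n. (\<Sum>k\<in>F. c k) + (\<Sum>\<^sub>\<infinity>k\<in>A - F. c k * qpow (2 ^ n * \<tau>) (e k))) \<longlonglongrightarrow> (\<Sum>k\<in>F. c k) + 0"
    by (intro tendsto_add tendsto_const)
  then show ?thesis by (simp add: eq)
qed

text \<open>Here a is the least squared index and F the set of indices attaining it; q^(-a/8)
  normalises the leading term. A gap of 4 between squares is a gap of 1/2 between exponents.\<close>

lemma tendsto_jterm_sum:
  fixes c :: "int \<Rightarrow> complex" and a :: real
  assumes "Im \<tau> > 0" and "finite F" and "F \<subseteq> A" and F: "\<And>k. k \<in> F \<Longrightarrow> (of_int k)\<^sup>2 = a"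
    and AF: "\<And>k. k \<in> A - F \<Longrightarrow> (of_int k)\<^sup>2 \<ge> a + 4"
    and sm: "(\<lambda>k. norm (c k * jterm \<tau> z k)) summable_on A"
  shows "(\<lambda>n. qpow (2 ^ n * \<tau>) (- a / 8) * (\<Sum>\<^sub>\<infinity>k\<in>A. c k * jterm (2 ^ n * \<tau>) z k))
           \<longlonglongrightarrow> (\<Sum>k\<in>F. c k * exp (of_int k / 2 * z))"
proof -
  have eq: "qpow \<tau>' (- a / 8) * (c k * jterm \<tau>' z k) = c k * exp (of_int k / 2 * z) * qpow \<tau>' (((of_int k)\<^sup>2 - a) / 8)" for \<tau>' k
  proof -
    have "qpow \<tau>' (((of_int k)\<^sup>2 - a) / 8) = qpow \<tau>' (- a / 8) * qpow \<tau>' ((of_int k)\<^sup>2 / 8)"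
      unfolding qpow_add[symmetric] by (rule arg_cong[of _ _ "qpow \<tau>'"]) (simp add: field_simps)
    then show ?thesis by (simp add: jterm_def mult_ac)
  qed
  have "(\<lambda>n. \<Sum>\<^sub>\<infinity>k\<in>A. c k * exp (of_int k / 2 * z) * qpow (2 ^ n * \<tau>) (((of_int k)\<^sup>2 - a) / 8))
           \<longlonglongrightarrow> (\<Sum>k\<in>F. c k * exp (of_int k / 2 * z))"
  proof (rule tendsto_qpow_sum[where \<delta> = "1 / 2"])
    show "(\<lambda>k. norm (c k * exp (of_int k / 2 * z) * qpow \<tau> (((of_int k)\<^sup>2 - a) / 8))) summable_on A"
      using summable_on_cmult_right[OF sm, of "norm (qpow \<tau> (- a / 8))"]
      unfolding norm_mult[symmetric] eq .
    show "(1 / 2 :: real) \<le> ((of_int k)\<^sup>2 - a) / 8" if "k \<in> A - F" for k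
      using AF[OF that] by simp
  qed (use assms in auto)
  then show ?thesis
    unfolding eq[symmetric] infsum_cmult_right' .
qed

lemma even_int_square_ge: "even k \<Longrightarrow> k \<noteq> 0 \<Longrightarrow> (real_of_int k)\<^sup>2 \<ge> 4"
proof -
  assume "even k" "k \<noteq> 0"
  then have "\<bar>real_of_int k\<bar> \<ge> 2" by (auto elim!: evenE)
  then have "\<bar>real_of_int k\<bar>\<^sup>2 \<ge> 2\<^sup>2" by (intro power_mono) auto
  then show ?thesis by simp
qed

lemma odd_int_square_ge: "odd k \<Longrightarrow> k \<noteq> 1 \<Longrightarrow> k \<noteq> - 1 \<Longrightarrow> (real_of_int k)\<^sup>2 \<ge> 5"
proof -
  assume "odd k" "k \<noteq> 1" "k \<noteq> - 1"
  then have "\<bar>k\<bar> \<ge> 3" by presburger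
  then have "\<bar>real_of_int k\<bar> \<ge> 3" by linarith
  then have "\<bar>real_of_int k\<bar>\<^sup>2 \<ge> 3\<^sup>2" by (intro power_mono) auto
  then show ?thesis by simp
qed

lemma theta3_null_tendsto:
  assumes "Im \<tau> > 0"
  shows "(\<lambda>n. theta3 (2 ^ n * \<tau>) 0) \<longlonglongrightarrow> 1"
  using tendsto_jterm_sum[OF assms, of "{0}" "{k. even k}" 0 "\<lambda>_. 1" 0] jterm_abs_summable[OF assms]
  by (simp add: even_int_square_ge theta3_def qpow_def)

lemma theta4_null_tendsto:
  assumes "Im \<tau> > 0"
  shows "(\<lambda>n. theta4 (2 ^ n * \<tau>) 0) \<longlonglongrightarrow> 1"
  using tendsto_jterm_sum[OF assms, of "{0}" "{k. even k}" 0 "\<lambda>_. 1" "of_real pi * \<i>"] jterm_abs_summable[OF assms]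
  by (simp add: even_int_square_ge theta4_def theta3_def qpow_def)

lemma theta2_null_tendsto:
  assumes "Im \<tau> > 0"
  shows "(\<lambda>n. qpow (2 ^ n * \<tau>) (- 1 / 8) * theta2 (2 ^ n * \<tau>) 0) \<longlonglongrightarrow> 2"
  using tendsto_jterm_sum[OF assms, of "{1, - 1}" "{k. odd k}" 1 "\<lambda>_. 1" 0] jterm_abs_summable[OF assms]
  by (force simp: odd_int_square_ge theta2_def)

lemma jterm_linear_abs_summable:
  assumes "Im \<tau> > 0"
  shows "(\<lambda>k. norm (of_int k * jterm \<tau> z k)) summable_on A"
proof (rule summable_on_comparison_test[OF jterm_summable_exp[OF assms, of z 1 A]])
  fix k :: int
  have "\<bar>real_of_int k\<bar> \<le> exp (1 * \<bar>real_of_int k\<bar>)"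
    using exp_ge_add_one_self[of "\<bar>real_of_int k\<bar>"] by (simp only: mult_1)
  from mult_right_mono[OF this, of "norm (jterm \<tau> z k)"]
  show "norm (of_int k * jterm \<tau> z k) \<le> norm (jterm \<tau> z k) * exp (1 * \<bar>real_of_int k\<bar>)"
    by (simp add: norm_mult mult.commute)
qed auto

lemma theta1_deriv_tendsto:
  assumes "Im \<tau> > 0"
  shows "(\<lambda>n. qpow (2 ^ n * \<tau>) (- 1 / 8) * fps_nth (theta1_fps (2 ^ n * \<tau>)) 1) \<longlonglongrightarrow> 1"
proof -
  have "(\<lambda>k. norm (- \<i> / 2 * of_int k * jterm \<tau> (of_real pi * \<i>) k)) summable_on {k. odd k}"
    using summable_on_cmult_right[OF jterm_linear_abs_summable[OF assms, of "of_real pi * \<i>" "{k. odd k}"], of "1 / 2"]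
    by (simp add: norm_mult)
  then
  have "(\<lambda>n. qpow (2 ^ n * \<tau>) (- 1 / 8) * (\<Sum>\<^sub>\<infinity>k\<in>{k. odd k}. - \<i> / 2 * of_int k * jterm (2 ^ n * \<tau>) (of_real pi * \<i>) k))
    \<longlonglongrightarrow> (\<Sum>k\<in>{1, - 1}. - \<i> / 2 * of_int k * exp (of_int k / 2 * (of_real pi * \<i>)))"
    by (intro tendsto_jterm_sum[OF assms, where a = 1]) (auto simp: odd_int_square_ge)
  moreover have "(\<Sum>k\<in>{1, - 1 :: int}. - \<i> / 2 * of_int k * exp (of_int k / 2 * (of_real pi * \<i>))) = 1"
  proof -
    have "exp (of_real pi * \<i> / 2) = \<i>" "exp (- (of_real pi * \<i> / 2)) = - \<i>"
      using cis_pi_half cis_minus_pi_half by (simp_all add: cis_conv_exp mult_ac)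
    then show ?thesis by simp
  qed
  moreover have "(\<Sum>\<^sub>\<infinity>k\<in>{k. odd k}. - \<i> / 2 * of_int k * jterm \<tau>' (of_real pi * \<i>) k) = fps_nth (theta1_fps \<tau>') 1" for \<tau>'
  proof -
    have "(\<Sum>\<^sub>\<infinity>k\<in>{k. odd k}. - \<i> / 2 * of_int k * jterm \<tau>' (of_real pi * \<i>) k) =
        (\<Sum>\<^sub>\<infinity>k\<in>{k. odd k}. - \<i> * (jterm \<tau>' (of_real pi * \<i>) k * (of_int k / 2) ^ 1))"
      by (rule infsum_cong) simp
    also have "\<dots> = - \<i> * (\<Sum>\<^sub>\<infinity>k\<in>{k. odd k}. jterm \<tau>' (of_real pi * \<i>) k * (of_int k / 2) ^ 1)"
      by (rule infsum_cmult_right')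
    finally show ?thesis by (simp add: theta1_fps_def)
  qed
  ultimately show ?thesis by simp
qed

text \<open>High in the half-plane the limits give nonvanishing. It descends from 2 \<tau> to \<tau>
  because \<open>theta3 * theta4\<close> and the square of \<open>theta2\<close> at \<tau> are, up
  to a factor 2, products of null values at 2 \<tau>.\<close>

lemma theta_nulls_nonzero:
  assumes "Im \<tau> > 0"
  shows "theta2 \<tau> 0 \<noteq> 0 \<and> theta3 \<tau> 0 \<noteq> 0 \<and> theta4 \<tau> 0 \<noteq> 0"
proof -
  have "\<forall>\<^sub>F n in sequentially. theta2 (2 ^ n * \<tau>) 0 \<noteq> 0 \<and> theta3 (2 ^ n * \<tau>) 0 \<noteq> 0 \<and> theta4 (2 ^ n * \<tau>) 0 \<noteq> 0"
  proof (intro eventually_conj)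
    show "\<forall>\<^sub>F n in sequentially. theta2 (2 ^ n * \<tau>) 0 \<noteq> 0"
      using tendsto_imp_eventually_ne[OF theta2_null_tendsto[OF assms], of 0] by (rule eventually_mono) auto
    show "\<forall>\<^sub>F n in sequentially. theta3 (2 ^ n * \<tau>) 0 \<noteq> 0"
      using tendsto_imp_eventually_ne[OF theta3_null_tendsto[OF assms], of 0] by simp
    show "\<forall>\<^sub>F n in sequentially. theta4 (2 ^ n * \<tau>) 0 \<noteq> 0"
      using tendsto_imp_eventually_ne[OF theta4_null_tendsto[OF assms], of 0] by simp
  qed
  then obtain n where "theta2 (2 ^ n * \<tau>) 0 \<noteq> 0 \<and> theta3 (2 ^ n * \<tau>) 0 \<noteq> 0 \<and> theta4 (2 ^ n * \<tau>) 0 \<noteq> 0"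
    by (auto simp: eventually_sequentially)
  then show ?thesis using assms
  proof (induction n arbitrary: \<tau>)
    case (Suc n)
    have *: "2 ^ Suc n * \<tau> = 2 ^ n * (2 * \<tau>)" by simp
    have "theta2 (2 * \<tau>) 0 \<noteq> 0 \<and> theta3 (2 * \<tau>) 0 \<noteq> 0 \<and> theta4 (2 * \<tau>) 0 \<noteq> 0"
      by (rule Suc.IH[OF Suc.prems(1)[unfolded *] Im_half_double(1)[OF Suc.prems(2)]])
    then show ?case
      using theta3_theta4_null[OF Suc.prems(2)] theta2_null_sq[OF Suc.prems(2)] by auto
  qed simp
qed

lemma theta1_deriv_eq:
  assumes "Im \<tau> > 0"
  shows "fps_nth (theta1_fps \<tau>) 1 = theta2 \<tau> 0 * theta3 \<tau> 0 * theta4 \<tau> 0 / 2"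
proof -
  define g where "g \<tau> = fps_nth (theta1_fps \<tau>) 1 / (theta2 \<tau> 0 * theta3 \<tau> 0 * theta4 \<tau> 0)" for \<tau>
  have step: "g (2 * \<tau>) = g \<tau>" if \<tau>: "Im \<tau> > 0" for \<tau>
  proof -
    have nz: "theta2 \<tau> 0 \<noteq> 0" "theta3 \<tau> 0 \<noteq> 0" "theta4 \<tau> 0 \<noteq> 0"
      "theta2 (2 * \<tau>) 0 \<noteq> 0" "theta3 (2 * \<tau>) 0 \<noteq> 0" "theta4 (2 * \<tau>) 0 \<noteq> 0"
      using theta_nulls_nonzero[of \<tau>] theta_nulls_nonzero[of "2 * \<tau>"] \<tau> by simp_all
    have "2 * fps_nth (theta1_fps (2 * \<tau>)) 1 * theta4 (2 * \<tau>) 0 = fps_nth (theta1_fps \<tau>) 1 * theta2 \<tau> 0"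
      using theta1_deriv_half[of "2 * \<tau>"] \<tau> by simp
    then have "fps_nth (theta1_fps (2 * \<tau>)) 1 = fps_nth (theta1_fps \<tau>) 1 * theta2 \<tau> 0 / (2 * theta4 (2 * \<tau>) 0)"
      using nz by (simp add: field_simps)
    then have "g (2 * \<tau>) = fps_nth (theta1_fps \<tau>) 1 * theta2 \<tau> 0 /
        ((2 * theta2 (2 * \<tau>) 0 * theta3 (2 * \<tau>) 0) * (theta4 (2 * \<tau>) 0)\<^sup>2)"
      by (simp add: g_def power2_eq_square)
    also have "\<dots> = fps_nth (theta1_fps \<tau>) 1 * theta2 \<tau> 0 / ((theta2 \<tau> 0)\<^sup>2 * (theta3 \<tau> 0 * theta4 \<tau> 0))"
      by (simp only: theta2_null_sq[OF \<tau>] theta3_theta4_null[OF \<tau>])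
    also have "\<dots> = g \<tau>"
      using nz by (simp add: g_def power2_eq_square)
    finally show ?thesis .
  qed
  have const: "g (2 ^ n * \<tau>) = g \<tau>" for n
  proof (induction n)
    case (Suc n)
    then show ?case
      using step[of "2 ^ n * \<tau>"] assms by (simp add: Im_power2_mult mult.assoc)
  qed simp
  have q: "qpow \<tau>' a \<noteq> 0" for \<tau>' a by (simp add: qpow_def)
  \<comment> \<open>Numerator and denominator of g both tend to 0 like q^(1/8), so both are
    multiplied by q^(-1/8) before passing to the limit.\<close>
  have "(\<lambda>n. (qpow (2 ^ n * \<tau>) (- 1 / 8) * fps_nth (theta1_fps (2 ^ n * \<tau>)) 1) /
      (qpow (2 ^ n * \<tau>) (- 1 / 8) * theta2 (2 ^ n * \<tau>) 0 * theta3 (2 ^ n * \<tau>) 0 * theta4 (2 ^ n * \<tau>) 0))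
    \<longlonglongrightarrow> 1 / (2 * 1 * 1)"
    by (intro tendsto_divide tendsto_mult theta1_deriv_tendsto theta2_null_tendsto theta3_null_tendsto
          theta4_null_tendsto assms) simp
  moreover have "(qpow (2 ^ n * \<tau>) (- 1 / 8) * fps_nth (theta1_fps (2 ^ n * \<tau>)) 1) /
      (qpow (2 ^ n * \<tau>) (- 1 / 8) * theta2 (2 ^ n * \<tau>) 0 * theta3 (2 ^ n * \<tau>) 0 * theta4 (2 ^ n * \<tau>) 0) = g \<tau>" for n
    using q[of "2 ^ n * \<tau>" "- 1 / 8"] const[of n] by (simp add: g_def mult.assoc)
  ultimately have "g \<tau> = 1 / 2"
    by (simp add: LIMSEQ_const_iff)
  then show ?thesis
    using theta_nulls_nonzero[OF assms] by (simp add: g_def field_simps)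
qed

text \<open>The square of \<open>theta2 (\<tau> / 2) 0\<close>, which is twice
  \<open>theta_triangle\<close>, is 2 \<open>theta2\<close> \<open>theta3\<close> at \<tau>. This
  trades two of the three null values in the derivative formula for
  \<open>theta_triangle\<close>.\<close>

lemma theta1_deriv_theta_triangle:
  assumes "Im \<tau> > 0"
  shows "fps_nth (theta1_fps \<tau>) 1 = (theta_triangle \<tau>)\<^sup>2 * theta4 \<tau> 0"
proof -
  have "(theta2 (\<tau> / 2) 0)\<^sup>2 = 2 * theta2 \<tau> 0 * theta3 \<tau> 0"
    using theta2_null_sq[of "\<tau> / 2"] assms by simp
  then have "(theta_triangle \<tau>)\<^sup>2 = theta2 \<tau> 0 * theta3 \<tau> 0 / 2"
    unfolding theta2_half_null[OF assms] by (simp add: power2_eq_square field_simps)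
  then show ?thesis unfolding theta1_deriv_eq[OF assms] by simp
qed

section \<open>The Kronecker double series\<close>

lemma has_sum_minus:
  fixes f g :: "'a \<Rightarrow> complex"
  assumes "(f has_sum a) A" and "(g has_sum b) A"
  shows "((\<lambda>x. f x - g x) has_sum a - b) A"
  using has_sum_add[OF assms(1), of "\<lambda>x. - g x" "- b"] assms(2) by (simp add: has_sum_uminus)

text \<open>Half of sgn k + sgn l for nonzero k and l, so the support consists of the two open
  quadrants on which q^(k l / 4) decays.\<close>

definition eps :: "int \<Rightarrow> int \<Rightarrow> complex" where
  "eps k l = (if k > 0 \<and> l > 0 then 1 else if k < 0 \<and> l < 0 then - 1 else 0)"

text \<open>The jump at l = - 1 equals 1 for either sign of k: the positive quadrant is entered with
  sign 1, or the negative one is left with sign - 1. Hence the boundary terms later form complete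
  lines.\<close>

lemma eps_add_2_right: "k \<noteq> 0 \<Longrightarrow> odd l \<Longrightarrow> eps k (l + 2) = eps k l + (if l = - 1 then 1 else 0)"
proof -
  assume "k \<noteq> 0" and "odd l"
  then have "l = - 1 \<or> l > 0 \<or> l < - 2" by presburger
  then show ?thesis
    using \<open>k \<noteq> 0\<close> by (elim disjE) (auto simp: eps_def)
qed

lemma eps_commute: "eps k l = eps l k"
  by (auto simp: eps_def)

lemma eps_add_2_left: "odd k \<Longrightarrow> l \<noteq> 0 \<Longrightarrow> eps (k + 2) l = eps k l + (if k = - 1 then 1 else 0)"
  using eps_add_2_right[of l k] unfolding eps_commute[of l k] eps_commute[of l "k + 2"] by simp

text \<open>On the support k l = |k| |l| is at least |k| + |l| - 1, because (|k| - 1)(|l| - 1) is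
  not negative. So the terms decay exponentially in |k| + |l| with rate
  \<open>pi / 2 * Im \<tau>\<close>, the bound imposed on r.\<close>

lemma eps_summable_exp:
  assumes "Im \<tau> > 0" and "r < pi / 2 * Im \<tau>" and "S \<subseteq> {(k, l). k \<noteq> 0 \<and> l \<noteq> 0}"
  shows "(\<lambda>(k, l). norm (eps k l * qpow \<tau> (of_int (k * l) / 4)) *
           exp (r * (\<bar>real_of_int k\<bar> + \<bar>real_of_int l\<bar>))) summable_on S"
proof -
  define c where "c = pi / 2 * Im \<tau>"
  define d where "d = c - r"
  have d: "d > 0" using assms by (simp add: d_def c_def)
  have "(\<lambda>k. norm (exp (- d * \<bar>real_of_int k\<bar>))) summable_on UNIV"
    using summable_on_exp_abs_int[OF d, of UNIV] by simp
  from abs_summable_on_times[OF this this]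
  have "(\<lambda>(k, l). exp (- d * \<bar>real_of_int k\<bar>) * exp (- d * \<bar>real_of_int l\<bar>)) summable_on UNIV \<times> UNIV"
    by (simp add: case_prod_unfold)
  then have "(\<lambda>(k, l). exp (- d * \<bar>real_of_int k\<bar>) * exp (- d * \<bar>real_of_int l\<bar>)) summable_on S"
    by (rule summable_on_subset) simp
  then have sm: "(\<lambda>(k, l). exp c * (exp (- d * \<bar>real_of_int k\<bar>) * exp (- d * \<bar>real_of_int l\<bar>))) summable_on S"
    unfolding case_prod_unfold by (rule summable_on_cmult_right)
  show ?thesis
  proof (rule summable_on_comparison_test[OF sm])
    fix p assume "p \<in> S"
    obtain k l where p: "p = (k, l)" by (cases p)
    have kl: "k \<noteq> 0" "l \<noteq> 0" using \<open>p \<in> S\<close> assms(3) by (auto simp: p)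
    define x y where "x = \<bar>real_of_int k\<bar>" and "y = \<bar>real_of_int l\<bar>"
    have xy: "x \<ge> 1" "y \<ge> 1" using kl unfolding x_def y_def by linarith+
    show "(case p of (k, l) \<Rightarrow> norm (eps k l * qpow \<tau> (of_int (k * l) / 4)) * exp (r * (\<bar>real_of_int k\<bar> + \<bar>real_of_int l\<bar>)))
      \<le> (case p of (k, l) \<Rightarrow> exp c * (exp (- d * \<bar>real_of_int k\<bar>) * exp (- d * \<bar>real_of_int l\<bar>)))"
    proof (cases "eps k l = 0")
      case False
      then have "k > 0 \<and> l > 0 \<or> k < 0 \<and> l < 0" and e: "norm (eps k l) = 1"
        by (auto simp: eps_def split: if_splits)
      then have "real_of_int (k * l) = x * y"
        by (auto simp: x_def y_def abs_if)
      then have "norm (qpow \<tau> (of_int (k * l) / 4)) = exp (- c * (x * y))"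
        by (simp add: norm_qpow c_def)
      moreover have "- c * (x * y) + r * (x + y) \<le> c + (- d * x + - d * y)"
      proof -
        have "0 \<le> (x - 1) * (y - 1)" using xy by simp
        then have "x * y \<ge> x + y - 1" by (simp add: algebra_simps)
        then have "c * (x + y - 1) \<le> c * (x * y)"
          using assms(1) by (intro mult_left_mono) (auto simp: c_def)
        then show ?thesis by (simp add: d_def algebra_simps)
      qed
      ultimately show ?thesis
        by (simp add: p norm_mult e x_def y_def flip: exp_add)
    qed (simp add: p)
  qed (auto simp: case_prod_unfold)
qed


definition kron :: "complex \<Rightarrow> complex \<Rightarrow> complex \<Rightarrow> complex" where
  "kron \<tau> a b = (\<Sum>\<^sub>\<infinity>(k, l)\<in>{k. odd k} \<times> {l. odd l}.
     eps k l * qpow \<tau> (of_int (k * l) / 4) * exp (of_int k / 2 * a + of_int l / 2 * b))"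

definition lser :: "complex \<Rightarrow> complex \<Rightarrow> complex" where
  "lser \<tau> z = (\<Sum>\<^sub>\<infinity>(k, l)\<in>{k. even k \<and> k \<noteq> 0} \<times> {l. odd l}.
     eps k l * qpow \<tau> (of_int (k * l) / 4) * exp (of_int k / 2 * z))"

lemma norm_exp_half_le:
  fixes a b :: complex
  shows "norm (exp (of_int k / 2 * a + of_int l / 2 * b)) \<le> exp (max (norm a) (norm b) / 2 * (\<bar>real_of_int k\<bar> + \<bar>real_of_int l\<bar>))"
proof -
  have "norm (exp (of_int k / 2 * a + of_int l / 2 * b)) \<le> exp (norm (of_int k / 2 * a + of_int l / 2 * b))"
    by (rule norm_exp)
  also have "norm (of_int k / 2 * a + of_int l / 2 * b) \<le> \<bar>real_of_int k\<bar> / 2 * norm a + \<bar>real_of_int l\<bar> / 2 * norm b"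
    by (rule norm_triangle_le) (simp add: norm_mult norm_divide)
  also have "\<dots> \<le> \<bar>real_of_int k\<bar> / 2 * max (norm a) (norm b) + \<bar>real_of_int l\<bar> / 2 * max (norm a) (norm b)"
    by (intro add_mono mult_left_mono) auto
  also have "\<dots> = max (norm a) (norm b) / 2 * (\<bar>real_of_int k\<bar> + \<bar>real_of_int l\<bar>)"
    by (simp add: algebra_simps add_divide_distrib)
  finally show ?thesis by simp
qed

lemma eps_abs_summable:
  assumes "Im \<tau> > 0" and "norm a < pi * Im \<tau>" and "norm b < pi * Im \<tau>"
    and "S \<subseteq> {(k, l). k \<noteq> 0 \<and> l \<noteq> 0}"
  shows "(\<lambda>p. norm (case p of (k, l) \<Rightarrow>
     eps k l * qpow \<tau> (of_int (k * l) / 4) * exp (of_int k / 2 * a + of_int l / 2 * b))) summable_on S"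
proof (rule summable_on_comparison_test[OF eps_summable_exp[OF assms(1) _ assms(4), of "max (norm a) (norm b) / 2"]])
  fix p :: "int \<times> int"
  obtain k l where p: "p = (k, l)" by (cases p)
  show "norm (case p of (k, l) \<Rightarrow> eps k l * qpow \<tau> (of_int (k * l) / 4) * exp (of_int k / 2 * a + of_int l / 2 * b))
    \<le> (case p of (k, l) \<Rightarrow> norm (eps k l * qpow \<tau> (of_int (k * l) / 4)) *
          exp (max (norm a) (norm b) / 2 * (\<bar>real_of_int k\<bar> + \<bar>real_of_int l\<bar>)))"
    unfolding p prod.case norm_mult[of "eps k l * qpow \<tau> (of_int (k * l) / 4)"]
    by (intro mult_left_mono norm_exp_half_le) auto
qed (use assms in auto)

lemma kron_summable:
  assumes "Im \<tau> > 0" and "norm a < pi * Im \<tau>" and "norm b < pi * Im \<tau>"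
  shows "(\<lambda>p. norm (case p of (k, l) \<Rightarrow>
     eps k l * qpow \<tau> (of_int (k * l) / 4) * exp (of_int k / 2 * a + of_int l / 2 * b))) summable_on {k. odd k} \<times> {l. odd l}"
  by (rule eps_abs_summable[OF assms]) auto

lemma has_sum_kron:
  assumes "Im \<tau> > 0" and "norm a < pi * Im \<tau>" and "norm b < pi * Im \<tau>"
  shows "((\<lambda>(k, l). eps k l * qpow \<tau> (of_int (k * l) / 4) * exp (of_int k / 2 * a + of_int l / 2 * b))
     has_sum kron \<tau> a b) ({k. odd k} \<times> {l. odd l})"
  unfolding kron_def by (rule has_sum_infsum[OF abs_summable_summable[OF kron_summable[OF assms]]])

text \<open>Up to the sign \<open>eps k l\<close>, what the index (k, l) of K contributes to the
  coefficient of \<open>exp (of_int x / 2 * a + of_int y / 2 * b)\<close> in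
  \<open>kron \<tau> a b * (theta4 \<tau> a * theta4 \<tau> b)\<close>.\<close>

definition kron_coeff :: "complex \<Rightarrow> int \<Rightarrow> int \<Rightarrow> int \<Rightarrow> int \<Rightarrow> complex" where
  "kron_coeff \<tau> x y k l = qpow \<tau> (of_int (k * l) / 4) *
     (jterm \<tau> (of_real pi * \<i>) (x - k) * jterm \<tau> (of_real pi * \<i>) (y - l))"

lemma has_sum_kron_theta4_theta4:
  assumes "Im \<tau> > 0" and "norm a < pi * Im \<tau>" and "norm b < pi * Im \<tau>"
  shows "((\<lambda>((x, y), (k, l)). exp (of_int x / 2 * a + of_int y / 2 * b) * (eps k l * kron_coeff \<tau> x y k l))
     has_sum kron \<tau> a b * (theta4 \<tau> a * theta4 \<tau> b))
     (({x. odd x} \<times> {y. odd y}) \<times> ({k. odd k} \<times> {l. odd l}))"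
proof -
  let ?p = "of_real pi * \<i> :: complex"
  have th: "((\<lambda>(e, f). jterm \<tau> (a + ?p) e * jterm \<tau> (b + ?p) f) has_sum theta4 \<tau> a * theta4 \<tau> b) ({e. even e} \<times> {f. even f})"
    unfolding theta4_def by (intro has_sum_theta_times has_sum_theta3 assms)
  have abs: "(\<lambda>q. norm (case q of (e, f) \<Rightarrow> jterm \<tau> (a + ?p) e * jterm \<tau> (b + ?p) f)) summable_on ({e. even e} \<times> {f. even f})"
    by (intro abs_summable_on_times jterm_abs_summable assms)
  have "((\<lambda>(q, r). (case q of (k, l) \<Rightarrow> eps k l * qpow \<tau> (of_int (k * l) / 4) * exp (of_int k / 2 * a + of_int l / 2 * b)) *
      (case r of (e, f) \<Rightarrow> jterm \<tau> (a + ?p) e * jterm \<tau> (b + ?p) f)) has_sum kron \<tau> a b * (theta4 \<tau> a * theta4 \<tau> b))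
      (({k. odd k} \<times> {l. odd l}) \<times> ({e. even e} \<times> {f. even f}))"
    by (intro has_sum_times kron_summable has_sum_kron assms th abs)
  also have "?this \<longleftrightarrow> ?thesis"
  proof (rule has_sum_reindex_bij_witness[of _ "\<lambda>((x, y), (k, l)). ((k, l), (x - k, y - l))"
        "\<lambda>((k, l), (e, f)). ((k + e, l + f), (k, l))"], goal_cases)
    case (5 q)
    obtain k l e f where q: "q = ((k, l), (e, f))" by (metis prod.exhaust)
    have "exp (of_int (k + e) / 2 * a + of_int (l + f) / 2 * b) =
       exp (of_int k / 2 * a + of_int l / 2 * b) * (exp (of_int e / 2 * a) * exp (of_int f / 2 * b))"
      unfolding exp_add[symmetric] by (rule arg_cong[of _ _ exp]) (simp add: field_simps)
    then show ?case
      by (simp add: q kron_coeff_def jterm_shift mult_ac)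
  qed auto
  finally show ?thesis .
qed

lemma kron_coeff_summable:
  assumes "Im \<tau> > 0" and "odd x" and "odd y"
  shows "(\<lambda>(k, l). eps k l * kron_coeff \<tau> x y k l) summable_on {k. odd k} \<times> {l. odd l}"
proof -
  have "(\<lambda>((x, y), (k, l)). eps k l * kron_coeff \<tau> x y k l) summable_on
     (({x. odd x} \<times> {y. odd y}) \<times> ({k. odd k} \<times> {l. odd l}))"
    using has_sum_imp_summable[OF has_sum_kron_theta4_theta4[of \<tau> 0 0]] assms by simp
  then have "(\<lambda>(q, r). (case q of (x, y) \<Rightarrow> \<lambda>(k, l). eps k l * kron_coeff \<tau> x y k l) r) summable_on
     (({x. odd x} \<times> {y. odd y}) \<times> ({k. odd k} \<times> {l. odd l}))"
    by (simp add: case_prod_unfold)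
  from summable_on_SigmaD1[OF this, of "(x, y)"] assms(2,3) show ?thesis by simp
qed

lemma theta2_pi_i [simp]: "theta2 \<tau> (of_real pi * \<i>) = 0"
  using theta1_0[of \<tau>] by (simp add: theta1_def)

text \<open>Completing the square: on the line k = - 1 the exponent linear in l is absorbed by
  moving the index by one. As y + 1 is even for odd y, the sum over odd l becomes the series of
  \<open>theta1\<close> at 0. The line l = 1 is treated likewise below.\<close>

lemma kron_coeff_first_line:
  "kron_coeff \<tau> x y (- 1) l = jterm \<tau> (of_real pi * \<i>) (x + 1) *
     (exp (- (of_real pi * \<i> / 2)) * qpow \<tau> (- of_int y / 4 - 1 / 8)) * jterm \<tau> (of_real pi * \<i>) (y + 1 - l)"
  unfolding kron_coeff_def jterm_def qpow_def mult_exp_exp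
  by (rule arg_cong[of _ _ exp])
     (simp add: power2_eq_square, simp add: algebra_simps add_divide_distrib diff_divide_distrib)

lemma kron_coeff_second_line:
  "kron_coeff \<tau> x y k 1 = jterm \<tau> (of_real pi * \<i>) (y - 1) *
     (exp (of_real pi * \<i> / 2) * qpow \<tau> (of_int x / 4 - 1 / 8)) * jterm \<tau> (of_real pi * \<i>) (x - 1 - k)"
  unfolding kron_coeff_def jterm_def qpow_def mult_exp_exp
  by (rule arg_cong[of _ _ exp])
     (simp add: power2_eq_square, simp add: algebra_simps add_divide_distrib diff_divide_distrib)

lemma kron_coeff_shift:
  "kron_coeff \<tau> x y (k + 2) (l - 2) = qpow \<tau> (of_int (y - x) / 2) * kron_coeff \<tau> x y k l"
proof -
  define X Y K L where "X = complex_of_int x" "Y = complex_of_int y" "K = complex_of_int k" "L = complex_of_int l"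
  have "2 * complex_of_real pi * \<i> * (((K + 2) * (L - 2)) / 4) * \<tau> +
    (2 * complex_of_real pi * \<i> * ((X - (K + 2))^2 / 8) * \<tau> + (X - (K + 2)) / 2 * (complex_of_real pi * \<i>) +
      (2 * complex_of_real pi * \<i> * ((Y - (L - 2))^2 / 8) * \<tau> + (Y - (L - 2)) / 2 * (complex_of_real pi * \<i>))) =
    2 * complex_of_real pi * \<i> * ((Y - X) / 2) * \<tau> + (2 * complex_of_real pi * \<i> * ((K * L) / 4) * \<tau> +
    (2 * complex_of_real pi * \<i> * ((X - K)^2 / 8) * \<tau> + (X - K) / 2 * (complex_of_real pi * \<i>) +
      (2 * complex_of_real pi * \<i> * ((Y - L)^2 / 8) * \<tau> + (Y - L) / 2 * (complex_of_real pi * \<i>))))"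
    by (simp add: field_simps power2_eq_square)
  then show ?thesis
    unfolding kron_coeff_def jterm_def qpow_def mult_exp_exp X_Y_K_L_def
    by (intro arg_cong[of _ _ exp]) simp
qed

text \<open>Since 2 k l + (x - k)^2 + (x - l)^2 = x^2 + (x - k - l)^2, only k + l matters on the
  diagonal, and the signs can be summed along antidiagonals.\<close>

lemma kron_coeff_diag:
  "kron_coeff \<tau> x x k l = jterm \<tau> (of_real pi * \<i>) x * jterm \<tau> (of_real pi * \<i>) (x - (k + l))"
  unfolding kron_coeff_def jterm_def qpow_def mult_exp_exp
  by (rule arg_cong[of _ _ exp])
     (simp add: power2_eq_square, simp add: algebra_simps add_divide_distrib diff_divide_distrib)

lemma has_sum_jterm_pi_reflect:
  assumes "Im \<tau> > 0" and "odd (c + d)"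
  shows "((\<lambda>k. jterm \<tau> (of_real pi * \<i>) (c - k)) has_sum 0) {k. odd k = odd d}"
proof -
  have "(jterm \<tau> (of_real pi * \<i>) has_sum 0) {k. odd k}"
    using has_sum_theta2[OF assms(1), of "of_real pi * \<i>"] by simp
  also have "?this \<longleftrightarrow> ?thesis"
    by (rule has_sum_reindex_bij_witness[of _ "\<lambda>k. c - k" "\<lambda>k. c - k"]) (use assms(2) in auto)
  finally show ?thesis .
qed

text \<open>
  Moving \<open>(k, l)\<close> to \<open>(k + 2, l - 2)\<close> multiplies the coefficient by \<open>q\<close> to the power \<open>(y - x) / 2\<close> and
  changes the sign only on the lines \<open>k = - 1\<close> and \<open>l = 1\<close>, on which the terms add up to a
  multiple of \<open>\<theta>\<^sub>1(0) = 0\<close>.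
\<close>

lemma kron_coeff_off_diag:
  assumes "Im \<tau> > 0" and x: "odd x" and y: "odd y" and "x \<noteq> y"
  shows "((\<lambda>(k, l). eps k l * kron_coeff \<tau> x y k l) has_sum 0) ({k. odd k} \<times> {l. odd l})"
proof -
  let ?O = "{k::int. odd k}"
  let ?W = "kron_coeff \<tau> x y"
  define D where "D = (\<Sum>\<^sub>\<infinity>(k, l)\<in>?O \<times> ?O. eps k l * ?W k l)"
  have D: "((\<lambda>(k, l). eps k l * ?W k l) has_sum D) (?O \<times> ?O)"
    unfolding D_def by (intro has_sum_infsum kron_coeff_summable assms)
  also have "?this \<longleftrightarrow> ((\<lambda>(k, l). qpow \<tau> (of_int (y - x) / 2) * (eps (k + 2) (l - 2) * ?W k l)) has_sum D) (?O \<times> ?O)"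
  proof (rule has_sum_reindex_bij_witness[of _ "\<lambda>(k, l). (k + 2, l - 2)" "\<lambda>(k, l). (k - 2, l + 2)"], goal_cases)
    case (5 q)
    then show ?case
      using kron_coeff_shift[of \<tau> x y "fst q - 2" "snd q + 2"] by (simp add: case_prod_unfold)
  qed auto
  finally have "((\<lambda>(k, l). qpow \<tau> (of_int (x - y) / 2) * (qpow \<tau> (of_int (y - x) / 2) * (eps (k + 2) (l - 2) * ?W k l)))
       has_sum qpow \<tau> (of_int (x - y) / 2) * D) (?O \<times> ?O)"
    unfolding case_prod_unfold by (rule has_sum_cmult_right)
  moreover have canc: "qpow \<tau> (of_int (x - y) / 2) * (qpow \<tau> (of_int (y - x) / 2) * c) = c" for c
  proof -
    have "qpow \<tau> (of_int (x - y) / 2) * qpow \<tau> (of_int (y - x) / 2) = 1"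
      unfolding qpow_add[symmetric] by (simp add: qpow_def field_simps)
    then show ?thesis by (simp flip: mult.assoc)
  qed
  ultimately have "((\<lambda>(k, l). eps (k + 2) (l - 2) * ?W k l) has_sum qpow \<tau> (of_int (x - y) / 2) * D) (?O \<times> ?O)"
    by (simp only: canc)
  from has_sum_minus[OF this D]
  have 1: "((\<lambda>(k, l). (eps (k + 2) (l - 2) - eps k l) * ?W k l) has_sum (qpow \<tau> (of_int (x - y) / 2) * D - D)) (?O \<times> ?O)"
    by (simp add: case_prod_unfold left_diff_distrib)
  have "((\<lambda>l. ?W (- 1) l) has_sum 0) ?O"
    using has_sum_cmult_right[OF has_sum_jterm_pi_reflect[OF assms(1), of "y + 1" 1],
        of "jterm \<tau> (of_real pi * \<i>) (x + 1) * (exp (- (of_real pi * \<i> / 2)) * qpow \<tau> (- of_int y / 4 - 1 / 8))"] y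
    by (simp add: kron_coeff_first_line)
  also have "?this \<longleftrightarrow> ((\<lambda>(k, l). ?W k l) has_sum 0) ({- 1} \<times> ?O)"
    by (rule has_sum_reindex_bij_witness[of _ snd "Pair (- 1)"]) auto
  also have "\<dots> \<longleftrightarrow> ((\<lambda>(k, l). (if k = - 1 then 1 else 0) * ?W k l) has_sum 0) (?O \<times> ?O)"
    by (rule has_sum_cong_neutral) (auto split: if_splits)
  finally have 2: "((\<lambda>(k, l). (if k = - 1 then 1 else 0) * ?W k l) has_sum 0) (?O \<times> ?O)" .
  have "((\<lambda>k. ?W k 1) has_sum 0) ?O"
    using has_sum_cmult_right[OF has_sum_jterm_pi_reflect[OF assms(1), of "x - 1" 1],
        of "jterm \<tau> (of_real pi * \<i>) (y - 1) * (exp (of_real pi * \<i> / 2) * qpow \<tau> (of_int x / 4 - 1 / 8))"] x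
    by (simp add: kron_coeff_second_line)
  also have "?this \<longleftrightarrow> ((\<lambda>(k, l). ?W k l) has_sum 0) (?O \<times> {1})"
    by (rule has_sum_reindex_bij_witness[of _ fst "\<lambda>k. (k, 1)"]) auto
  also have "\<dots> \<longleftrightarrow> ((\<lambda>(k, l). (if l = 1 then 1 else 0) * ?W k l) has_sum 0) (?O \<times> ?O)"
    by (rule has_sum_cong_neutral) (auto split: if_splits)
  finally have 3: "((\<lambda>(k, l). (if l = 1 then 1 else 0) * ?W k l) has_sum 0) (?O \<times> ?O)" .
  have eps: "eps (k + 2) (l - 2) - eps k l = (if k = - 1 then 1 else 0) - (if l = 1 then 1 else 0)" if "odd k" "odd l" for k l
    using eps_add_2_left[of k "l - 2"] eps_add_2_right[of k "l - 2"] that by force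
  have "((\<lambda>(k, l). (eps (k + 2) (l - 2) - eps k l) * ?W k l) has_sum 0 - 0) (?O \<times> ?O) \<longleftrightarrow>
      ((\<lambda>q. (case q of (k, l) \<Rightarrow> (if k = - 1 then 1 else 0) * ?W k l) - (case q of (k, l) \<Rightarrow> (if l = 1 then 1 else 0) * ?W k l))
         has_sum 0 - 0) (?O \<times> ?O)"
  proof (rule has_sum_cong)
    fix q assume "q \<in> ?O \<times> ?O"
    then have q: "odd (fst q)" "odd (snd q)" by auto
    show "(case q of (k, l) \<Rightarrow> (eps (k + 2) (l - 2) - eps k l) * ?W k l) =
      (case q of (k, l) \<Rightarrow> (if k = - 1 then 1 else 0) * ?W k l) - (case q of (k, l) \<Rightarrow> (if l = 1 then 1 else 0) * ?W k l)"
      unfolding case_prod_unfold eps[OF q] by (rule left_diff_distrib)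
  qed
  then have "((\<lambda>(k, l). (eps (k + 2) (l - 2) - eps k l) * ?W k l) has_sum 0 - 0) (?O \<times> ?O)"
    using has_sum_minus[OF 2 3] by simp
  from has_sum_unique[OF 1 this] have "qpow \<tau> (of_int (x - y) / 2) * D - D = 0" by simp
  then have "(qpow \<tau> (of_int (x - y) / 2) - 1) * D = 0" by (simp add: algebra_simps)
  \<comment> \<open>As x and y differ and \<open>Im \<tau> > 0\<close>, the multiplier is not 1,
    which forces D to vanish.\<close>
  moreover have "norm (qpow \<tau> (of_int (x - y) / 2)) \<noteq> 1"
    using assms by (simp add: norm_qpow)
  ultimately have "D = 0" by auto
  with D show ?thesis by simp
qed

text \<open>For N > 0 the sum counts the odd k strictly between 0 and N, and there are N / 2 of
  them. For N < 0 it counts those between N and 0 with sign - 1.\<close>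

lemma has_sum_eps_antidiagonal:
  assumes "even N"
  shows "((\<lambda>k. eps k (N - k)) has_sum of_int N / 2) {k. odd k}"
proof -
  obtain M where M: "N = 2 * M" using assms by blast
  show ?thesis
  proof (cases "M \<ge> 0")
    case True
    show ?thesis
    proof (rule has_sum_finite_neutralI[of "(\<lambda>j. 2 * j + 1) ` {0..<M}"])
      have "(\<Sum>k\<in>(\<lambda>j. 2 * j + 1) ` {0..<M}. eps k (N - k)) = (\<Sum>j\<in>{0..<M}. 1)"
        by (subst sum.reindex) (auto simp: inj_on_def M eps_def intro!: sum.cong)
      then show "of_int N / 2 = (\<Sum>k\<in>(\<lambda>j. 2 * j + 1) ` {0..<M}. eps k (N - k))"
        using True by (simp add: M)
      fix k assume "k \<in> {k. odd k} - (\<lambda>j. 2 * j + 1) ` {0..<M}"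
      then have "odd k" and k: "k \<notin> (\<lambda>j. 2 * j + 1) ` {0..<M}" by auto
      then obtain j where j: "k = 2 * j + 1" by (auto elim: oddE)
      with k have "j \<notin> {0..<M}" by blast
      then show "eps k (N - k) = 0" using True j by (auto simp: eps_def M)
    qed auto
  next
    case False
    show ?thesis
    proof (rule has_sum_finite_neutralI[of "(\<lambda>j. 2 * j + 1) ` {M..<0}"])
      have "(\<Sum>k\<in>(\<lambda>j. 2 * j + 1) ` {M..<0}. eps k (N - k)) = (\<Sum>j\<in>{M..<0}. - 1)"
        by (subst sum.reindex) (auto simp: inj_on_def M eps_def intro!: sum.cong)
      then show "of_int N / 2 = (\<Sum>k\<in>(\<lambda>j. 2 * j + 1) ` {M..<0}. eps k (N - k))"
        using False by (simp add: M)
      fix k assume "k \<in> {k. odd k} - (\<lambda>j. 2 * j + 1) ` {M..<0}"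
      then have "odd k" and k: "k \<notin> (\<lambda>j. 2 * j + 1) ` {M..<0}" by auto
      then obtain j where j: "k = 2 * j + 1" by (auto elim: oddE)
      with k have "j \<notin> {M..<0}" by blast
      then show "eps k (N - k) = 0" using False j by (auto simp: eps_def M)
    qed auto
  qed
qed

lemma has_sum_theta1_deriv:
  assumes "Im \<tau> > 0"
  shows "((\<lambda>k. of_int k / 2 * jterm \<tau> (of_real pi * \<i>) k) has_sum \<i> * fps_nth (theta1_fps \<tau>) 1) {k. odd k}"
proof -
  have "(\<lambda>k. (1 / 2) * (of_int k * jterm \<tau> (of_real pi * \<i>) k)) summable_on {k. odd k}"
    by (intro summable_on_cmult_right abs_summable_summable[OF jterm_linear_abs_summable] assms)
  then have "(\<lambda>k. jterm \<tau> (of_real pi * \<i>) k * (of_int k / 2) ^ 1) summable_on {k. odd k}"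
    by (simp add: mult_ac)
  then have "((\<lambda>k. jterm \<tau> (of_real pi * \<i>) k * (of_int k / 2) ^ 1) has_sum
    (\<Sum>\<^sub>\<infinity>k\<in>{k. odd k}. jterm \<tau> (of_real pi * \<i>) k * (of_int k / 2) ^ 1)) {k. odd k}"
    by (rule has_sum_infsum)
  then show ?thesis by (simp add: theta1_fps_def mult.commute flip: mult.assoc)
qed

lemma kron_coeff_on_diag:
  assumes "Im \<tau> > 0" and x: "odd x"
  shows "((\<lambda>(k, l). eps k l * kron_coeff \<tau> x x k l) has_sum
     - \<i> * fps_nth (theta1_fps \<tau>) 1 * jterm \<tau> (of_real pi * \<i>) x) ({k. odd k} \<times> {l. odd l})"
proof -
  let ?O = "{k::int. odd k}" and ?p = "of_real pi * \<i> :: complex"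
  define D where "D = (\<Sum>\<^sub>\<infinity>(k, l)\<in>?O \<times> ?O. eps k l * kron_coeff \<tau> x x k l)"
  have D: "((\<lambda>(k, l). eps k l * kron_coeff \<tau> x x k l) has_sum D) (?O \<times> ?O)"
    unfolding D_def by (intro has_sum_infsum kron_coeff_summable assms)
  also have "?this \<longleftrightarrow> ((\<lambda>(N, k). eps k (N - k) * (jterm \<tau> ?p x * jterm \<tau> ?p (x - N))) has_sum D) ({N. even N} \<times> ?O)"
    by (rule has_sum_reindex_bij_witness[of _ "\<lambda>(N, k). (k, N - k)" "\<lambda>(k, l). (k + l, k)"])
       (auto simp: kron_coeff_diag)
  finally have *: "((\<lambda>(N, k). eps k (N - k) * (jterm \<tau> ?p x * jterm \<tau> ?p (x - N))) has_sum D) ({N. even N} \<times> ?O)" .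
  have 1: "((\<lambda>N. of_int N / 2 * (jterm \<tau> ?p x * jterm \<tau> ?p (x - N))) has_sum D) {N. even N}"
  proof (rule has_sum_SigmaD[OF *])
    fix N :: int assume "N \<in> {N. even N}"
    then show "((\<lambda>k. case (N, k) of (N, k) \<Rightarrow> eps k (N - k) * (jterm \<tau> ?p x * jterm \<tau> ?p (x - N))) has_sum
        of_int N / 2 * (jterm \<tau> ?p x * jterm \<tau> ?p (x - N))) ?O"
      unfolding prod.case by (intro has_sum_cmult_left has_sum_eps_antidiagonal) simp
  qed
  \<comment> \<open>With N = x - k the weight N / 2 splits into x / 2, whose sum is a multiple of
    \<open>theta1\<close> at 0, and - k / 2, whose sum is the derivative of \<open>theta1\<close> up
    to the factor - i.\<close>
  have "((\<lambda>k. jterm \<tau> ?p x * (of_int x / 2 * jterm \<tau> ?p k - of_int k / 2 * jterm \<tau> ?p k)) has_sum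
     jterm \<tau> ?p x * (of_int x / 2 * theta2 \<tau> ?p - \<i> * fps_nth (theta1_fps \<tau>) 1)) ?O"
    by (intro has_sum_cmult_right has_sum_minus has_sum_theta1_deriv has_sum_theta2 assms)
  also have "?this \<longleftrightarrow> ((\<lambda>N. of_int N / 2 * (jterm \<tau> ?p x * jterm \<tau> ?p (x - N))) has_sum
       - \<i> * fps_nth (theta1_fps \<tau>) 1 * jterm \<tau> ?p x) {N. even N}"
  proof (rule has_sum_reindex_bij_witness[of _ "\<lambda>N. x - N" "\<lambda>k. x - k"], goal_cases)
    case (5 k)
    show ?case by (simp add: algebra_simps diff_divide_distrib)
  qed (use x in auto)
  finally have "D = - \<i> * fps_nth (theta1_fps \<tau>) 1 * jterm \<tau> ?p x"
    using 1 by (intro has_sum_unique[OF 1])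
  with D show ?thesis by simp
qed

text \<open>Only the coefficients with x = y survive, so the double series in a and b collapses to a
  single one in a + b, which is the series of \<open>theta1\<close>.\<close>

lemma kron_eq:
  assumes "Im \<tau> > 0" and "norm a < pi * Im \<tau>" and "norm b < pi * Im \<tau>"
  shows "kron \<tau> a b * (theta4 \<tau> a * theta4 \<tau> b) = fps_nth (theta1_fps \<tau>) 1 * theta1 \<tau> (a + b)"
proof -
  let ?O = "{k::int. odd k}" and ?p = "of_real pi * \<i> :: complex"
  let ?d = "- \<i> * fps_nth (theta1_fps \<tau>) 1"
  have *: "((\<lambda>(x, y). exp (of_int x / 2 * a + of_int y / 2 * b) * (if x = y then ?d * jterm \<tau> ?p x else 0))
      has_sum kron \<tau> a b * (theta4 \<tau> a * theta4 \<tau> b)) (?O \<times> ?O)"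
    unfolding case_prod_unfold
  proof (rule has_sum_SigmaD[OF has_sum_kron_theta4_theta4[OF assms]], goal_cases)
    case (1 q)
    have "((\<lambda>(k, l). eps k l * kron_coeff \<tau> (fst q) (snd q) k l) has_sum
        (if fst q = snd q then ?d * jterm \<tau> ?p (fst q) else 0)) (?O \<times> ?O)"
      using 1 kron_coeff_on_diag[OF assms(1), of "fst q"] kron_coeff_off_diag[OF assms(1), of "fst q" "snd q"]
      by auto
    from has_sum_cmult_right[OF this, of "exp (of_int (fst q) / 2 * a + of_int (snd q) / 2 * b)"]
    show ?case by (simp add: case_prod_unfold)
  qed
  have "((\<lambda>x. ?d * jterm \<tau> (a + b + ?p) x) has_sum ?d * theta2 \<tau> (a + b + ?p)) ?O"
    by (intro has_sum_cmult_right has_sum_theta2 assms)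
  also have "?this \<longleftrightarrow> ((\<lambda>(x, y). exp (of_int x / 2 * a + of_int y / 2 * b) * (if x = y then ?d * jterm \<tau> ?p x else 0))
      has_sum ?d * theta2 \<tau> (a + b + ?p)) ((\<lambda>x. (x, x)) ` ?O)"
    by (rule has_sum_reindex_bij_witness[of _ fst "\<lambda>x. (x, x)"])
       (auto simp: jterm_shift[of \<tau> "a + b"] ring_distribs)
  also have "\<dots> \<longleftrightarrow> ((\<lambda>(x, y). exp (of_int x / 2 * a + of_int y / 2 * b) * (if x = y then ?d * jterm \<tau> ?p x else 0))
      has_sum ?d * theta2 \<tau> (a + b + ?p)) (?O \<times> ?O)"
    by (rule has_sum_cong_neutral) auto
  finally have "kron \<tau> a b * (theta4 \<tau> a * theta4 \<tau> b) = ?d * theta2 \<tau> (a + b + ?p)"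
    using * by (intro has_sum_unique[OF *])
  then show ?thesis by (simp add: theta1_def)
qed

section \<open>The logarithmic derivative of the fourth theta function\<close>

text \<open>The counterpart of \<open>kron_coeff\<close> for L times \<open>theta4\<close>, written
  with h = l - n. After this substitution the output index n occurs only in a common factor and in
  the sign \<open>eps k (h + n)\<close>.\<close>

definition lser_coeff :: "complex \<Rightarrow> int \<Rightarrow> int \<Rightarrow> complex" where
  "lser_coeff \<tau> k h = qpow \<tau> (of_int (k * h) / 4) * jterm \<tau> (of_real pi * \<i>) k"

lemma lser_coeff_uminus:
  assumes "even k"
  shows "lser_coeff \<tau> (- k) (- h) = lser_coeff \<tau> k h"
proof -
  have "jterm \<tau> (of_real pi * \<i>) (- k) = jterm \<tau> (of_real pi * \<i>) k"
    using jterm_2pi[of \<tau> "- (of_real pi * \<i>)" k] assms by (simp add: jterm_uminus mult.commute)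
  then show ?thesis by (simp add: lser_coeff_def)
qed

text \<open>Completing the square again: for fixed odd h the sum over all even k is a multiple of
  \<open>theta1\<close> at 0.\<close>

lemma lser_coeff_eq_jterm:
  "lser_coeff \<tau> k h = qpow \<tau> (- (of_int h)\<^sup>2 / 8) * exp (- (of_int h / 2 * (of_real pi * \<i>))) *
     jterm \<tau> (of_real pi * \<i>) (k + h)"
  unfolding lser_coeff_def jterm_def qpow_def mult_exp_exp
  by (rule arg_cong[of _ _ exp])
     (simp add: power2_eq_square, simp add: algebra_simps add_divide_distrib diff_divide_distrib)

lemma jterm_lser_coeff:
  assumes "even k"
  shows "qpow \<tau> (of_int (k * l) / 4) * jterm \<tau> (of_real pi * \<i>) (n - k) =
     jterm \<tau> (of_real pi * \<i>) n * lser_coeff \<tau> k (l - n)"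
proof -
  have "qpow \<tau> (of_int (k * l) / 4) * jterm \<tau> (of_real pi * \<i>) (n - k) =
     jterm \<tau> (of_real pi * \<i>) n * (qpow \<tau> (of_int (k * (l - n)) / 4) * jterm \<tau> (- (of_real pi * \<i>)) k)"
    unfolding jterm_def qpow_def mult_exp_exp
    by (rule arg_cong[of _ _ exp]) (simp add: field_simps power2_eq_square)
  moreover have "jterm \<tau> (- (of_real pi * \<i>)) k = jterm \<tau> (of_real pi * \<i>) k"
    using jterm_2pi[of \<tau> "- (of_real pi * \<i>)" k] assms by (simp add: mult.commute)
  ultimately show ?thesis by (simp add: lser_coeff_def)
qed

lemma lser_summable:
  assumes "Im \<tau> > 0" and "norm z < pi * Im \<tau>"
  shows "(\<lambda>p. norm (case p of (k, l) \<Rightarrow>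
     eps k l * qpow \<tau> (of_int (k * l) / 4) * exp (of_int k / 2 * z))) summable_on {k. even k \<and> k \<noteq> 0} \<times> {l. odd l}"
proof -
  have "norm (0 :: complex) < pi * Im \<tau>" using assms by simp
  from eps_abs_summable[OF assms this, of "{k. even k \<and> k \<noteq> 0} \<times> {l. odd l}"]
  have "(\<lambda>p. norm (case p of (k, l) \<Rightarrow>
     eps k l * qpow \<tau> (of_int (k * l) / 4) * exp (of_int k / 2 * z + of_int l / 2 * 0))) summable_on {k. even k \<and> k \<noteq> 0} \<times> {l. odd l}"
    by auto
  then show ?thesis by (simp only: mult_zero_right add_0_right)
qed

lemma has_sum_lser:
  assumes "Im \<tau> > 0" and "norm z < pi * Im \<tau>"
  shows "((\<lambda>(k, l). eps k l * qpow \<tau> (of_int (k * l) / 4) * exp (of_int k / 2 * z)) has_sum lser \<tau> z)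
     ({k. even k \<and> k \<noteq> 0} \<times> {l. odd l})"
  unfolding lser_def by (rule has_sum_infsum[OF abs_summable_summable[OF lser_summable[OF assms]]])

lemma has_sum_lser_theta4:
  assumes "Im \<tau> > 0" and "norm z < pi * Im \<tau>"
  shows "((\<lambda>(n, (k, l)). exp (of_int n / 2 * z) * (eps k l * (jterm \<tau> (of_real pi * \<i>) n * lser_coeff \<tau> k (l - n))))
     has_sum lser \<tau> z * theta4 \<tau> z)
     ({n. even n} \<times> ({k. even k \<and> k \<noteq> 0} \<times> {l. odd l}))"
proof -
  let ?p = "of_real pi * \<i> :: complex"
  have "((\<lambda>(q, e). (case q of (k, l) \<Rightarrow> eps k l * qpow \<tau> (of_int (k * l) / 4) * exp (of_int k / 2 * z)) *
      jterm \<tau> (z + ?p) e) has_sum lser \<tau> z * theta4 \<tau> z)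
      (({k. even k \<and> k \<noteq> 0} \<times> {l. odd l}) \<times> {e. even e})"
    unfolding theta4_def by (intro has_sum_times lser_summable has_sum_lser has_sum_theta3 jterm_abs_summable assms)
  also have "?this \<longleftrightarrow> ?thesis"
  proof (rule has_sum_reindex_bij_witness[of _ "\<lambda>(n, (k, l)). ((k, l), n - k)" "\<lambda>((k, l), e). (k + e, (k, l))"], goal_cases)
    case (5 q)
    obtain k l e where q: "q = ((k, l), e)" by (metis prod.exhaust)
    have k: "even k" using 5 by (simp add: q)
    have e1: "exp (of_int (k + e) / 2 * z) = exp (of_int k / 2 * z) * exp (of_int e / 2 * z)"
      unfolding mult_exp_exp by (rule arg_cong[of _ _ exp]) (simp add: field_simps)
    have e2: "jterm \<tau> ?p (k + e) * lser_coeff \<tau> k (l - (k + e)) = qpow \<tau> (of_int (k * l) / 4) * jterm \<tau> ?p e"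
      using jterm_lser_coeff[OF k, of \<tau> l "k + e"] by simp
    show ?case
      unfolding q prod.case e1 e2 jterm_shift[of \<tau> z] by (simp add: mult_ac)
  qed auto
  finally show ?thesis .
qed

text \<open>
  The two sides agree at \<open>n = 0\<close>, where the left one is odd under \<open>(k, h) \<mapsto> (- k, - h)\<close>. Passing from
  \<open>n\<close> to \<open>n + 2\<close> changes the sign only for \<open>h + n = - 1\<close>.
\<close>

lemma lser_coeff_sum:
  assumes \<tau>: "Im \<tau> > 0" and "even n"
  shows "((\<lambda>(k, h). eps k (h + n) * lser_coeff \<tau> k h) has_sum - of_int n / 2)
     ({k. even k \<and> k \<noteq> 0} \<times> {h. odd h})"
proof -
  let ?E = "{k::int. even k \<and> k \<noteq> 0}" and ?O = "{k::int. odd k}" and ?p = "of_real pi * \<i> :: complex"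
  have sm: "(\<lambda>(k, h). eps k (h + n) * lser_coeff \<tau> k h) summable_on ?E \<times> ?O" if "even n" for n
  proof -
    have z: "norm (0 :: complex) < pi * Im \<tau>" using \<tau> by simp
    from has_sum_imp_summable[OF has_sum_lser_theta4[OF \<tau> z]]
    have "(\<lambda>(n, q). (case q of (k, l) \<Rightarrow> eps k l * (jterm \<tau> ?p n * lser_coeff \<tau> k (l - n)))) summable_on
      {n. even n} \<times> (?E \<times> ?O)"
      by (simp only: mult_zero_right exp_zero mult_1)
    from summable_on_SigmaD1[OF this, of n] that
    have "(\<lambda>(k, l). eps k l * (jterm \<tau> ?p n * lser_coeff \<tau> k (l - n))) summable_on ?E \<times> ?O"
      by (simp only: mem_Collect_eq)
    from summable_on_cmult_right[OF this, of "inverse (jterm \<tau> ?p n)"]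
    have "(\<lambda>q. inverse (jterm \<tau> ?p n) * (case q of (k, l) \<Rightarrow> eps k l * (jterm \<tau> ?p n * lser_coeff \<tau> k (l - n)))) summable_on ?E \<times> ?O" .
    moreover have "inverse (jterm \<tau> ?p n) * (c * (jterm \<tau> ?p n * d)) = c * d" for c d
      using jterm_exp[of \<tau> ?p n] by (simp add: field_simps)
    ultimately have "(\<lambda>(k, l). eps k l * lser_coeff \<tau> k (l - n)) summable_on ?E \<times> ?O"
      unfolding case_prod_unfold by (simp only:)
    also have "?this \<longleftrightarrow> (\<lambda>(k, h). eps k (h + n) * lser_coeff \<tau> k h) summable_on ?E \<times> ?O"
      by (rule summable_on_reindex_bij_witness[of _ "\<lambda>(k, h). (k, h + n)" "\<lambda>(k, l). (k, l - n)"]) (use that in auto)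
    finally show ?thesis .
  qed
  define f where "f n = (\<Sum>\<^sub>\<infinity>(k, h)\<in>?E \<times> ?O. eps k (h + n) * lser_coeff \<tau> k h)" for n
  have f: "((\<lambda>(k, h). eps k (h + n) * lser_coeff \<tau> k h) has_sum f n) (?E \<times> ?O)" if "even n" for n
    unfolding f_def using sm[OF that] by (rule has_sum_infsum)
  have f0: "f 0 = 0"
  proof -
    have *: "((\<lambda>(k, h). eps k h * lser_coeff \<tau> k h) has_sum f 0) (?E \<times> ?O)"
      using f[of 0] by simp
    also have "?this \<longleftrightarrow> ((\<lambda>q. - (case q of (k, h) \<Rightarrow> eps k h * lser_coeff \<tau> k h)) has_sum f 0) (?E \<times> ?O)"
      by (rule has_sum_reindex_bij_witness[of _ "\<lambda>(k, h). (- k, - h)" "\<lambda>(k, h). (- k, - h)"])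
         (auto simp: lser_coeff_uminus eps_def)
    finally have "((\<lambda>q. (case q of (k, h) \<Rightarrow> eps k h * lser_coeff \<tau> k h)) has_sum - f 0) (?E \<times> ?O)"
      unfolding has_sum_uminus .
    from has_sum_unique[OF this *] have "- f 0 = f 0" .
    then show ?thesis by simp
  qed
  have step: "f (n + 2) = f n - 1" if n: "even n" for n
  proof -
    have "((\<lambda>k. jterm \<tau> ?p (k + (- 1 - n))) has_sum 0) {k. even k}"
    proof -
      have "(jterm \<tau> ?p has_sum 0) {k. odd k}"
        using has_sum_theta2[OF \<tau>, of ?p] by simp
      also have "?this \<longleftrightarrow> ?thesis"
        by (rule has_sum_reindex_bij_witness[of _ "\<lambda>k. k + (- 1 - n)" "\<lambda>k. k - (- 1 - n)"]) (use n in auto)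
      finally show ?thesis .
    qed
    from has_sum_cmult_right[OF this, of "qpow \<tau> (- (of_int (- 1 - n))\<^sup>2 / 8) * exp (- (of_int (- 1 - n) / 2 * ?p))"]
    have "((\<lambda>k. lser_coeff \<tau> k (- 1 - n)) has_sum 0) {k. even k}"
      unfolding lser_coeff_eq_jterm[symmetric] by simp
    \<comment> \<open>The whole line sums to 0, but \<open>lser\<close> has no index k = 0. Removing
      that term, which is 1, leaves - 1, the decrement of f.\<close>
    moreover have "((\<lambda>k. lser_coeff \<tau> k (- 1 - n)) has_sum 1) {0}"
      by (rule has_sum_finiteI) (auto simp: lser_coeff_def jterm_def qpow_def)
    ultimately have "((\<lambda>k. lser_coeff \<tau> k (- 1 - n)) has_sum 0 - 1) ({k. even k} - {0})"
      by (intro has_sum_Diff) auto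
    moreover have "{k. even k} - {0} = ?E" by auto
    ultimately have "((\<lambda>k. lser_coeff \<tau> k (- 1 - n)) has_sum - 1) ?E" by simp
    also have "?this \<longleftrightarrow> ((\<lambda>(k, h). lser_coeff \<tau> k h) has_sum - 1) (?E \<times> {- 1 - n})"
      by (rule has_sum_reindex_bij_witness[of _ fst "\<lambda>k. (k, - 1 - n)"]) auto
    also have "\<dots> \<longleftrightarrow> ((\<lambda>(k, h). (if h + n = - 1 then 1 else 0) * lser_coeff \<tau> k h) has_sum - 1) (?E \<times> ?O)"
      by (rule has_sum_cong_neutral) (use n in \<open>auto split: if_splits\<close>)
    finally have "((\<lambda>q. (case q of (k, h) \<Rightarrow> eps k (h + n) * lser_coeff \<tau> k h) +
        (case q of (k, h) \<Rightarrow> (if h + n = - 1 then 1 else 0) * lser_coeff \<tau> k h)) has_sum f n + - 1) (?E \<times> ?O)"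
      by (intro has_sum_add f n)
    also have "?this \<longleftrightarrow> ((\<lambda>(k, h). eps k (h + (n + 2)) * lser_coeff \<tau> k h) has_sum f n + - 1) (?E \<times> ?O)"
    proof (rule has_sum_cong)
      fix q assume "q \<in> ?E \<times> ?O"
      then have q: "fst q \<noteq> 0" "odd (snd q + n)" using n by auto
      show "(case q of (k, h) \<Rightarrow> eps k (h + n) * lser_coeff \<tau> k h) +
        (case q of (k, h) \<Rightarrow> (if h + n = - 1 then 1 else 0) * lser_coeff \<tau> k h) =
        (case q of (k, h) \<Rightarrow> eps k (h + (n + 2)) * lser_coeff \<tau> k h)"
        unfolding case_prod_unfold using eps_add_2_right[OF q] by (simp add: add.assoc ring_distribs)
    qed
    finally have "((\<lambda>(k, h). eps k (h + (n + 2)) * lser_coeff \<tau> k h) has_sum f n + - 1) (?E \<times> ?O)" .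
    from has_sum_unique[OF f this] n show ?thesis by simp
  qed
  have "f (2 * j) = - of_int j" for j :: int
  proof (induction j rule: int_induct[where k = 0])
    case (step1 i)
    then show ?case using step[of "2 * i"] by (simp add: ring_distribs)
  next
    case (step2 i)
    then show ?case using step[of "2 * (i - 1)"] by (simp add: algebra_simps)
  qed (simp add: f0)
  moreover obtain j where "n = 2 * j" using assms(2) by blast
  ultimately have "f n = - of_int n / 2" by simp
  with f[OF assms(2)] show ?thesis by simp
qed

lemma lser_theta4:
  assumes "Im \<tau> > 0" and "norm z < pi * Im \<tau>"
  shows "lser \<tau> z * theta4 \<tau> z = - (\<Sum>\<^sub>\<infinity>n\<in>{n. even n}. of_int n / 2 * jterm \<tau> (z + of_real pi * \<i>) n)"
proof -
  let ?E = "{k::int. even k \<and> k \<noteq> 0}" and ?O = "{k::int. odd k}" and ?p = "of_real pi * \<i> :: complex"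
  have "((\<lambda>n. exp (of_int n / 2 * z) * (jterm \<tau> ?p n * (- of_int n / 2))) has_sum lser \<tau> z * theta4 \<tau> z) {n. even n}"
  proof (rule has_sum_SigmaD[OF has_sum_lser_theta4[OF assms]])
    fix n :: int assume "n \<in> {n. even n}"
    then have n: "even n" by simp
    have "((\<lambda>(k, h). eps k (h + n) * lser_coeff \<tau> k h) has_sum - of_int n / 2) (?E \<times> ?O)"
      by (rule lser_coeff_sum[OF assms(1) n])
    also have "?this \<longleftrightarrow> ((\<lambda>(k, l). eps k l * lser_coeff \<tau> k (l - n)) has_sum - of_int n / 2) (?E \<times> ?O)"
      by (rule has_sum_reindex_bij_witness[of _ "\<lambda>(k, l). (k, l - n)" "\<lambda>(k, h). (k, h + n)"]) (use n in auto)
    finally have "((\<lambda>q. exp (of_int n / 2 * z) * (jterm \<tau> ?p n * (case q of (k, l) \<Rightarrow> eps k l * lser_coeff \<tau> k (l - n)))) has_sum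
      exp (of_int n / 2 * z) * (jterm \<tau> ?p n * (- of_int n / 2))) (?E \<times> ?O)"
      by (intro has_sum_cmult_right)
    then show "((\<lambda>y. case (n, y) of (n, k, l) \<Rightarrow> exp (of_int n / 2 * z) * (eps k l * (jterm \<tau> ?p n * lser_coeff \<tau> k (l - n)))) has_sum
      exp (of_int n / 2 * z) * (jterm \<tau> ?p n * (- of_int n / 2))) (?E \<times> ?O)"
      by (simp add: case_prod_unfold mult_ac)
  qed
  also have "(\<lambda>n. exp (of_int n / 2 * z) * (jterm \<tau> ?p n * (- of_int n / 2))) = (\<lambda>n. - (of_int n / 2 * jterm \<tau> (z + ?p) n))"
    by (simp add: fun_eq_iff jterm_shift mult_ac)
  finally show ?thesis
    by (simp add: infsumI infsum_uminus[symmetric])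
qed

section \<open>Kernels with triangular Taylor coefficients\<close>

lemma fps_power_lowest:
  fixes A S :: "complex fps"
  assumes A: "\<And>i. i < r \<Longrightarrow> fps_nth A i = 0" and S: "fps_nth S 0 = 0"
  shows "i < k + r \<Longrightarrow> fps_nth (A * S ^ k) i = 0"
    and "fps_nth (A * S ^ k) (k + r) = fps_nth A r * fps_nth S 1 ^ k"
proof -
  have z: "fps_nth A a * fps_nth (S ^ k) b = 0" if "a < r \<or> b < k" for a b
    using that A startsby_zero_power_prefix[OF S, of k] by auto
  show "fps_nth (A * S ^ k) i = 0" if "i < k + r"
    unfolding fps_mult_nth
  proof (intro sum.neutral ballI)
    fix x assume "x \<in> {0..i}"
    with that show "fps_nth A x * fps_nth (S ^ k) (i - x) = 0" by (intro z) auto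
  qed
  have "fps_nth (A * S ^ k) (k + r) = (\<Sum>i = 0..k + r. if i = r then fps_nth A i * fps_nth (S ^ k) (k + r - i) else 0)"
    unfolding fps_mult_nth
  proof (intro sum.cong refl)
    fix x assume "x \<in> {0..k + r}"
    then show "fps_nth A x * fps_nth (S ^ k) (k + r - x) = (if x = r then fps_nth A x * fps_nth (S ^ k) (k + r - x) else 0)"
      using z[of x "k + r - x"] by (cases "x = r"; cases "x < r") auto
  qed
  also have "\<dots> = fps_nth A r * fps_nth S 1 ^ k"
    using startsby_zero_power_nth_same[OF S, of k] by (simp add: sum.delta)
  finally show "fps_nth (A * S ^ k) (k + r) = fps_nth A r * fps_nth S 1 ^ k" .
qed

lemma has_fps_expansion_power:
  fixes f :: "complex \<Rightarrow> complex"
  assumes "f has_fps_expansion F"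
  shows "(\<lambda>z. f z ^ n) has_fps_expansion F ^ n"
proof (induction n)
  case (Suc n)
  then show ?case using has_fps_expansion_mult[OF assms Suc] by simp
qed simp

text \<open>\<open>G u\<close> is the series in the second variable at fixed u. The geometric series
  is cut after m terms: the remainder carries \<open>S ^ (2 * m)\<close>, which starts at order 2 m
  and cannot reach coefficient j. The result is an exact finite sum.\<close>

lemma kernel_expansion:
  fixes G :: "complex \<Rightarrow> complex fps"
  assumes ev: "\<forall>\<^sub>F u in nhds 0. G u * (1 - fps_const ((\<sigma> u)\<^sup>2) * S\<^sup>2) = fps_const (a u) * B"
    and \<sigma>: "\<sigma> has_fps_expansion S" and a: "a has_fps_expansion A" and S0: "fps_nth S 0 = 0"
    and M: "(\<lambda>u. fps_nth (G u) j) has_fps_expansion M" and j: "j < 2 * m"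
  shows "M = (\<Sum>n<m. A * S ^ (2 * n) * fps_const (fps_nth (B * S ^ (2 * n)) j))"
proof (rule has_fps_expansion_unique[OF M])
  show "(\<lambda>u. \<Sum>n<m. a u * \<sigma> u ^ (2 * n) * fps_nth (B * S ^ (2 * n)) j) has_fps_expansion
     (\<Sum>n<m. A * S ^ (2 * n) * fps_const (fps_nth (B * S ^ (2 * n)) j))"
    by (intro has_fps_expansion_sum has_fps_expansion_cmult_right has_fps_expansion_mult has_fps_expansion_power a \<sigma>)
  from ev show "\<forall>\<^sub>F u in nhds 0. fps_nth (G u) j = (\<Sum>n<m. a u * \<sigma> u ^ (2 * n) * fps_nth (B * S ^ (2 * n)) j)"
  proof eventually_elim
    case (elim u)
    let ?c = "fps_const ((\<sigma> u)\<^sup>2)"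
    have cS: "(?c * S\<^sup>2) ^ n = fps_const (\<sigma> u ^ (2 * n)) * S ^ (2 * n)" for n
      by (simp add: power_mult_distrib power_mult)
    have G: "G u = fps_const (a u) * B + ?c * S\<^sup>2 * G u"
      using elim by (simp add: algebra_simps)
    have "G u = (\<Sum>n<m. fps_const (a u) * B * (?c * S\<^sup>2) ^ n) + (?c * S\<^sup>2) ^ m * G u" for m
    proof (induction m)
      case (Suc m)
      have "(?c * S\<^sup>2) ^ m * G u = fps_const (a u) * B * (?c * S\<^sup>2) ^ m + (?c * S\<^sup>2) ^ Suc m * G u"
        by (subst G) (simp add: algebra_simps)
      with Suc show ?case by (simp add: add.assoc)
    qed simp
    then have "fps_nth (G u) j = (\<Sum>n<m. fps_nth (fps_const (a u) * B * (?c * S\<^sup>2) ^ n) j) + fps_nth ((?c * S\<^sup>2) ^ m * G u) j"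
      by (metis fps_add_nth fps_sum_nth)
    moreover have "fps_nth ((?c * S\<^sup>2) ^ m * G u) j = 0"
    proof -
      have "(?c * S\<^sup>2) ^ m * G u = fps_const (\<sigma> u ^ (2 * m)) * (G u * S ^ (2 * m))"
        unfolding cS by (simp only: mult_ac)
      then show ?thesis
        using fps_power_lowest(1)[of 0 "G u" S j "2 * m"] S0 j by (simp only: fps_mult_left_const_nth) simp
    qed
    moreover have "fps_nth (fps_const (a u) * B * (?c * S\<^sup>2) ^ n) j = a u * \<sigma> u ^ (2 * n) * fps_nth (B * S ^ (2 * n)) j" for n
    proof -
      have "fps_const (a u) * B * (?c * S\<^sup>2) ^ n = fps_const (a u * \<sigma> u ^ (2 * n)) * (B * S ^ (2 * n))"
        unfolding cS fps_const_mult[symmetric] by (simp only: mult_ac)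
      then show ?thesis by (simp only: fps_mult_left_const_nth)
    qed
    ultimately show ?case by simp
  qed
qed

text \<open>The sum over n is a product of a lower and an upper triangular matrix. Both the kernel
  determinants and the Vandermonde determinant are evaluated this way.\<close>

lemma det_triangular_product:
  fixes f g :: "nat \<Rightarrow> nat \<Rightarrow> complex"
  assumes f: "\<And>n i. i < n \<Longrightarrow> f n i = 0" and g: "\<And>n j. j < n \<Longrightarrow> g n j = 0"
  shows "Determinant.det (Matrix.mat m m (\<lambda>(i, j). \<Sum>n<m. f n i * g n j)) = (\<Prod>n<m. f n n * g n n)"
proof -
  define L where "L = Matrix.mat m m (\<lambda>(i, n). f n i)"
  define U where "U = Matrix.mat m m (\<lambda>(n, j). g n j)"
  have LU: "L \<in> carrier_mat m m" "U \<in> carrier_mat m m" by (auto simp: L_def U_def)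
  have "Matrix.mat m m (\<lambda>(i, j). \<Sum>n<m. f n i * g n j) = L * U"
    by (rule eq_matI) (auto simp: L_def U_def scalar_prod_def lessThan_atLeast0)
  moreover have "Determinant.det L = (\<Prod>n<m. f n n)"
    by (subst det_lower_triangular[OF _ LU(1)])
       (auto simp: L_def f prod_list_diag_prod lessThan_atLeast0 intro!: prod.cong)
  moreover have "Determinant.det U = (\<Prod>n<m. g n n)"
    by (subst det_upper_triangular[OF _ LU(2)])
       (auto simp: U_def g prod_list_diag_prod lessThan_atLeast0 upper_triangular_def intro!: prod.cong)
  ultimately show ?thesis
    using det_mult[OF LU] by (simp add: prod.distrib)
qed

text \<open>The terms \<open>A * S ^ (2 * n)\<close> and \<open>B * S ^ (2 * n)\<close> start at
  order 2 n + r or later and 2 n + 1 or later. Taking every second coefficient, from r in the rows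
  and from 1 in the columns, makes both factors triangular; each contributes 2 n to the exponent 4
  n.\<close>

lemma det_kernel:
  fixes G :: "complex \<Rightarrow> complex fps"
  assumes "\<forall>\<^sub>F u in nhds 0. G u * (1 - fps_const ((\<sigma> u)\<^sup>2) * S\<^sup>2) = fps_const (a u) * B"
    and "\<sigma> has_fps_expansion S" and "a has_fps_expansion A" and S0: "fps_nth S 0 = 0"
    and "\<And>j. (\<lambda>u. fps_nth (G u) j) has_fps_expansion M j"
    and A: "\<And>i. i < r \<Longrightarrow> fps_nth A i = 0" and B: "fps_nth B 0 = 0"
  shows "Determinant.det (Matrix.mat m m (\<lambda>(i, j). fps_nth (M (2 * j + 1)) (2 * i + r))) =
    (\<Prod>n<m. fps_nth A r * fps_nth B 1 * fps_nth S 1 ^ (4 * n))"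
proof -
  define f where "f n i = fps_nth (A * S ^ (2 * n)) (2 * i + r)" for n i
  define g where "g n j = fps_nth (B * S ^ (2 * n)) (2 * j + 1)" for n j
  have M: "fps_nth (M (2 * j + 1)) (2 * i + r) = (\<Sum>n<m. f n i * g n j)" if "j < m" for i j
    using kernel_expansion[OF assms(1-3) S0 assms(5), of "2 * j + 1" m] that
    by (simp add: f_def g_def fps_sum_nth)
  have f: "f n i = 0" if "i < n" for n i
    unfolding f_def by (rule fps_power_lowest(1)[OF A S0]) (use that in auto)
  have g: "g n j = 0" if "j < n" for n j
    unfolding g_def by (rule fps_power_lowest(1)[of 1 _ _ _ "2 * n", OF _ S0]) (use that B in auto)
  have "Matrix.mat m m (\<lambda>(i, j). fps_nth (M (2 * j + 1)) (2 * i + r)) = Matrix.mat m m (\<lambda>(i, j). \<Sum>n<m. f n i * g n j)"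
    by (rule eq_matI) (auto simp: M[simplified])
  then have "Determinant.det (Matrix.mat m m (\<lambda>(i, j). fps_nth (M (2 * j + 1)) (2 * i + r))) = (\<Prod>n<m. f n n * g n n)"
    using det_triangular_product[of f g m] f g by simp
  moreover have "f n n * g n n = fps_nth A r * fps_nth B 1 * fps_nth S 1 ^ (4 * n)" for n
  proof -
    have "f n n = fps_nth A r * fps_nth S 1 ^ (2 * n)"
      unfolding f_def by (rule fps_power_lowest(2)[OF A S0])
    moreover have "g n n = fps_nth B 1 * fps_nth S 1 ^ (2 * n)"
      unfolding g_def by (rule fps_power_lowest(2)[OF _ S0]) (use B in auto)
    ultimately show ?thesis by (simp add: mult_ac flip: power_add)
  qed
  ultimately show ?thesis by simp
qed

text \<open>Dividing by x^2 and \<Phi>^2 brings the right side of \<open>theta4_add_diff\<close> to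
  the form 1 - \<sigma>^2 S^2 with quotients of \<open>theta1\<close> by
  \<open>theta4\<close>.\<close>

lemma kernel_normalize:
  fixes \<Theta> \<Phi> G C :: "complex fps"
  assumes "G * (fps_const (x\<^sup>2) * \<Phi>\<^sup>2 - fps_const (y\<^sup>2) * \<Theta>\<^sup>2) = C"
    and x: "x \<noteq> 0" and \<Phi>: "fps_nth \<Phi> 0 \<noteq> 0"
  shows "G * (1 - fps_const ((y * inverse x)\<^sup>2) * (\<Theta> * inverse \<Phi>)\<^sup>2) = fps_const ((inverse x)\<^sup>2) * (C * (inverse \<Phi>)\<^sup>2)"
proof -
  have 1: "inverse \<Phi> * \<Phi> = 1" using \<Phi> by (rule inverse_mult_eq_1)
  have 2: "(inverse \<Phi>)\<^sup>2 * \<Phi>\<^sup>2 = 1" unfolding power_mult_distrib[symmetric] 1 by simp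
  have 3: "fps_const ((inverse x)\<^sup>2) * fps_const (x\<^sup>2) = (1 :: complex fps)"
    using x by (simp flip: power_mult_distrib)
  have "fps_const ((inverse x)\<^sup>2) * (inverse \<Phi>)\<^sup>2 * (fps_const (x\<^sup>2) * \<Phi>\<^sup>2 - fps_const (y\<^sup>2) * \<Theta>\<^sup>2) =
     (fps_const ((inverse x)\<^sup>2) * fps_const (x\<^sup>2)) * ((inverse \<Phi>)\<^sup>2 * \<Phi>\<^sup>2) -
     (fps_const (y\<^sup>2) * fps_const ((inverse x)\<^sup>2)) * (\<Theta>\<^sup>2 * (inverse \<Phi>)\<^sup>2)"
    unfolding right_diff_distrib by (simp only: mult_ac)
  also have "\<dots> = 1 - fps_const ((y * inverse x)\<^sup>2) * (\<Theta> * inverse \<Phi>)\<^sup>2"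
    unfolding 2 3 by (simp only: power_mult_distrib fps_const_mult mult_1)
  finally have "1 - fps_const ((y * inverse x)\<^sup>2) * (\<Theta> * inverse \<Phi>)\<^sup>2 =
      fps_const ((inverse x)\<^sup>2) * (inverse \<Phi>)\<^sup>2 * (fps_const (x\<^sup>2) * \<Phi>\<^sup>2 - fps_const (y\<^sup>2) * \<Theta>\<^sup>2)" ..
  then show ?thesis unfolding assms(1)[symmetric] by (simp only: mult_ac)
qed

section \<open>The three kernels\<close>

text \<open>Up to constants and a scaling of the variable, the series of Jacobi's elliptic function
  sn.\<close>

definition sn_fps :: "complex \<Rightarrow> complex fps" where
  "sn_fps \<tau> = theta1_fps \<tau> * inverse (theta4_fps \<tau> 0)"

lemma has_fps_expansion_inverse_theta4:
  assumes "Im \<tau> > 0"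
  shows "(\<lambda>z. inverse (theta4 \<tau> z)) has_fps_expansion inverse (theta4_fps \<tau> 0)"
  using theta_nulls_nonzero[OF assms] by (intro has_fps_expansion_inverse has_fps_expansion_theta4 assms) simp

lemma has_fps_expansion_sn:
  assumes "Im \<tau> > 0"
  shows "(\<lambda>z. theta1 \<tau> z * inverse (theta4 \<tau> z)) has_fps_expansion sn_fps \<tau>"
  unfolding sn_fps_def
  by (intro has_fps_expansion_mult has_fps_expansion_theta1 has_fps_expansion_inverse_theta4 assms)

lemma sn_fps_0 [simp]: "fps_nth (sn_fps \<tau>) 0 = 0"
  by (simp add: sn_fps_def)

lemma sn_fps_1:
  assumes "Im \<tau> > 0"
  shows "fps_nth (sn_fps \<tau>) 1 = (theta_triangle \<tau>)\<^sup>2"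
  using theta1_deriv_theta_triangle[OF assms] theta_nulls_nonzero[OF assms]
  by (simp add: sn_fps_def fps_mult_nth)

lemma eventually_theta4_nonzero:
  assumes "Im \<tau> > 0"
  shows "\<forall>\<^sub>F z in nhds 0. theta4 \<tau> z \<noteq> 0"
proof -
  have "isCont (theta4 \<tau>) 0"
    using has_fps_expansion_imp_continuous[OF has_fps_expansion_theta4[OF assms]] .
  then have "\<forall>\<^sub>F z in at 0. theta4 \<tau> z \<noteq> 0"
    using theta_nulls_nonzero[OF assms] by (intro tendsto_imp_eventually_ne) (auto simp: isCont_def)
  then show ?thesis
    using theta_nulls_nonzero[OF assms] by (simp add: eventually_nhds_conv_at)
qed

lemma eventually_norm_less:
  assumes "(r::real) > 0"
  shows "\<forall>\<^sub>F z in nhds (0::complex). norm z < r"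
  using eventually_nhds_in_open[of "ball 0 r" "0::complex"] assms by (simp add: dist_norm)

definition lambert :: "complex \<Rightarrow> int \<times> int \<Rightarrow> complex" where
  "lambert \<tau> p = eps (fst p) (snd p) * qpow \<tau> (of_int (fst p * snd p) / 4)"

lemma lambert_summable_exp:
  fixes \<alpha> \<gamma> :: "int \<times> int \<Rightarrow> real"
  assumes \<tau>: "Im \<tau> > 0" and S: "S \<subseteq> {(k, l). k \<noteq> 0 \<and> l \<noteq> 0}"
    and le: "\<And>p. p \<in> S \<Longrightarrow> \<bar>\<alpha> p\<bar> + \<bar>\<gamma> p\<bar> \<le> \<bar>real_of_int (fst p)\<bar> + \<bar>real_of_int (snd p)\<bar>"
  shows "(\<lambda>p. norm (lambert \<tau> p) * exp (pi / 4 * Im \<tau> * (\<bar>\<alpha> p\<bar> + \<bar>\<gamma> p\<bar>))) summable_on S"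
proof (rule summable_on_comparison_test[OF eps_summable_exp[OF \<tau> _ S, of "pi / 4 * Im \<tau>"]])
  fix p assume "p \<in> S"
  from le[OF this] have "pi / 4 * Im \<tau> * (\<bar>\<alpha> p\<bar> + \<bar>\<gamma> p\<bar>) \<le> pi / 4 * Im \<tau> * (\<bar>real_of_int (fst p)\<bar> + \<bar>real_of_int (snd p)\<bar>)"
    using \<tau> by (intro mult_left_mono) auto
  then show "norm (lambert \<tau> p) * exp (pi / 4 * Im \<tau> * (\<bar>\<alpha> p\<bar> + \<bar>\<gamma> p\<bar>)) \<le>
    (case p of (k, l) \<Rightarrow> norm (eps k l * qpow \<tau> (of_int (k * l) / 4)) *
           exp (pi / 4 * Im \<tau> * (\<bar>real_of_int k\<bar> + \<bar>real_of_int l\<bar>)))"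
    unfolding lambert_def case_prod_unfold by (intro mult_left_mono) auto
qed (use \<tau> in auto)

text \<open>Meant for the third kernel, whose two arguments add up to 2 v.\<close>

lemma has_fps_expansion_theta1_double:
  assumes "Im \<tau> > 0"
  shows "(\<lambda>z. theta1 \<tau> (2 * z)) has_fps_expansion Abs_fps (\<lambda>n. 2 ^ n * fps_nth (theta1_fps \<tau>) n)"
proof -
  let ?p = "of_real pi * \<i> :: complex"
  have "(\<lambda>k. norm (jterm \<tau> ?p k) * exp (1 * \<bar>real_of_int k\<bar>)) summable_on {k. odd k}"
    by (rule jterm_summable_exp[OF assms])
  from has_fps_expansion_cmult_left[OF has_fps_expansion_exp_sum[OF _ this], of "- \<i>"]
  have "(\<lambda>z. - \<i> * (\<Sum>\<^sub>\<infinity>k\<in>{k. odd k}. jterm \<tau> ?p k * exp (of_int k * z))) has_fps_expansion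
      fps_const (- \<i>) * Abs_fps (\<lambda>n. (\<Sum>\<^sub>\<infinity>k\<in>{k. odd k}. jterm \<tau> ?p k * of_int k ^ n) / fact n)"
    by simp
  moreover have "fps_const (- \<i>) * Abs_fps (\<lambda>n. (\<Sum>\<^sub>\<infinity>k\<in>{k. odd k}. jterm \<tau> ?p k * of_int k ^ n) / fact n) =
      Abs_fps (\<lambda>n. 2 ^ n * fps_nth (theta1_fps \<tau>) n)"
  proof (rule fps_ext)
    fix n
    have "(\<Sum>\<^sub>\<infinity>k\<in>{k. odd k}. jterm \<tau> ?p k * of_int k ^ n) = (\<Sum>\<^sub>\<infinity>k\<in>{k. odd k}. 2 ^ n * (jterm \<tau> ?p k * (of_int k / 2) ^ n))"
      by (rule infsum_cong) (simp add: power_divide)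
    also have "\<dots> = 2 ^ n * (\<Sum>\<^sub>\<infinity>k\<in>{k. odd k}. jterm \<tau> ?p k * (of_int k / 2) ^ n)"
      by (rule infsum_cmult_right')
    finally show "fps_nth (fps_const (- \<i>) * Abs_fps (\<lambda>n. (\<Sum>\<^sub>\<infinity>k\<in>{k. odd k}. jterm \<tau> ?p k * of_int k ^ n) / fact n)) n =
      fps_nth (Abs_fps (\<lambda>n. 2 ^ n * fps_nth (theta1_fps \<tau>) n)) n"
      by (simp add: theta1_fps_def)
  qed
  moreover have "(\<lambda>z. - \<i> * (\<Sum>\<^sub>\<infinity>k\<in>{k. odd k}. jterm \<tau> ?p k * exp (of_int k * z))) = (\<lambda>z. theta1 \<tau> (2 * z))"
    by (simp add: theta1_def theta2_def jterm_shift[of _ "2 * _"] fun_eq_iff)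
  ultimately show ?thesis by simp
qed

text \<open>The arguments u + v and v - u have sum 2 v, so the numerator in \<open>kron_eq\<close>
  depends on v alone, while the denominator is the product in
  \<open>theta4_add_diff\<close>.\<close>

lemma det_kernel_f3:
  assumes \<tau>: "Im \<tau> > 0"
  shows "Determinant.det (Matrix.mat m m (\<lambda>(i, j). (\<Sum>\<^sub>\<infinity>p\<in>{k. odd k} \<times> {l. odd l}. lambert \<tau> p *
      of_real (of_int (fst p - snd p) / 2) ^ (2 * i) * of_real (of_int (fst p + snd p) / 2) ^ (2 * j + 1)) /
      (fact (2 * i) * fact (2 * j + 1)))) = (\<Prod>n<m. 2 * theta_triangle \<tau> ^ (8 * n + 4))"
proof -
  let ?O = "{k::int. odd k}"
  define \<alpha> \<gamma> where "\<alpha> p = real_of_int (fst p - snd p) / 2" and "\<gamma> p = real_of_int (fst p + snd p) / 2"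
    for p :: "int \<times> int"
  define r where "r = pi / 4 * Im \<tau>"
  have r: "r > 0" using \<tau> by (simp add: r_def)
  have sm: "(\<lambda>p. norm (lambert \<tau> p) * exp (r * (\<bar>\<alpha> p\<bar> + \<bar>\<gamma> p\<bar>))) summable_on ?O \<times> ?O"
    unfolding r_def
  proof (rule lambert_summable_exp[OF \<tau>])
    fix p :: "int \<times> int"
    have "\<bar>x - y\<bar> / 2 + \<bar>x + y\<bar> / 2 \<le> \<bar>x\<bar> + \<bar>y\<bar>" for x y :: real
      using abs_triangle_ineq[of x y] abs_triangle_ineq4[of x y] by simp
    then show "\<bar>\<alpha> p\<bar> + \<bar>\<gamma> p\<bar> \<le> \<bar>real_of_int (fst p)\<bar> + \<bar>real_of_int (snd p)\<bar>"
      by (simp add: \<alpha>_def \<gamma>_def)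
  qed auto
  define G where "G u = Abs_fps (\<lambda>n. (\<Sum>\<^sub>\<infinity>p\<in>?O \<times> ?O. lambert \<tau> p * exp (of_real (\<alpha> p) * u) * of_real (\<gamma> p) ^ n) / fact n)" for u
  define M where "M j = Abs_fps (\<lambda>i. (\<Sum>\<^sub>\<infinity>p\<in>?O \<times> ?O. lambert \<tau> p * of_real (\<alpha> p) ^ i * of_real (\<gamma> p) ^ j) / (fact i * fact j))" for j
  define \<Phi> where "\<Phi> = theta4_fps \<tau> 0"
  define d where "d = fps_nth (theta1_fps \<tau>) 1"
  define \<Theta>2 where "\<Theta>2 = Abs_fps (\<lambda>n. 2 ^ n * fps_nth (theta1_fps \<tau>) n)"
  have \<Phi>0: "fps_nth \<Phi> 0 = theta4 \<tau> 0" "theta4 \<tau> 0 \<noteq> 0"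
    using theta_nulls_nonzero[OF \<tau>] by (simp_all add: \<Phi>_def)
  have M: "(\<lambda>u. fps_nth (G u) j) has_fps_expansion M j" for j
    unfolding G_def M_def using has_fps_expansion_exp_sum2(2)[OF r sm] by simp
  have kron: "kron \<tau> (u + v) (v - u) = (\<Sum>\<^sub>\<infinity>p\<in>?O \<times> ?O. lambert \<tau> p * exp (of_real (\<alpha> p) * u) * exp (of_real (\<gamma> p) * v))" for u v
    unfolding kron_def
  proof (rule infsum_cong)
    fix p :: "int \<times> int"
    have "exp (of_int (fst p) / 2 * (u + v) + of_int (snd p) / 2 * (v - u)) = exp (of_real (\<alpha> p) * u) * exp (of_real (\<gamma> p) * v)"
      unfolding mult_exp_exp by (rule arg_cong[of _ _ exp]) (simp add: \<alpha>_def \<gamma>_def field_simps)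
    then show "(case p of (k, l) \<Rightarrow> eps k l * qpow \<tau> (of_int (k * l) / 4) * exp (of_int k / 2 * (u + v) + of_int l / 2 * (v - u))) =
      lambert \<tau> p * exp (of_real (\<alpha> p) * u) * exp (of_real (\<gamma> p) * v)"
      by (simp add: lambert_def case_prod_unfold mult.assoc)
  qed
  have ker: "G u * (fps_const ((theta4 \<tau> u)\<^sup>2) * \<Phi>\<^sup>2 - fps_const ((theta1 \<tau> u)\<^sup>2) * (theta1_fps \<tau>)\<^sup>2) =
      fps_const (d * (theta4 \<tau> 0)\<^sup>2) * \<Theta>2" if u: "norm u < r" for u
  proof (rule has_fps_expansion_unique)
    have "(\<lambda>v. kron \<tau> (u + v) (v - u)) has_fps_expansion G u"
      unfolding kron G_def using has_fps_expansion_exp_sum2(1)[OF r sm, of u] u by simp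
    then show "(\<lambda>v. kron \<tau> (u + v) (v - u) * ((theta4 \<tau> u)\<^sup>2 * (theta4 \<tau> v)\<^sup>2 - (theta1 \<tau> u)\<^sup>2 * (theta1 \<tau> v)\<^sup>2)) has_fps_expansion
       G u * (fps_const ((theta4 \<tau> u)\<^sup>2) * \<Phi>\<^sup>2 - fps_const ((theta1 \<tau> u)\<^sup>2) * (theta1_fps \<tau>)\<^sup>2)"
      unfolding \<Phi>_def by (intro has_fps_expansion_mult has_fps_expansion_diff has_fps_expansion_cmult_left
          has_fps_expansion_power has_fps_expansion_theta4 has_fps_expansion_theta1 \<tau>)
    show "(\<lambda>v. d * (theta4 \<tau> 0)\<^sup>2 * theta1 \<tau> (2 * v)) has_fps_expansion fps_const (d * (theta4 \<tau> 0)\<^sup>2) * \<Theta>2"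
      unfolding \<Theta>2_def by (intro has_fps_expansion_cmult_left has_fps_expansion_theta1_double \<tau>)
    from eventually_norm_less[OF r]
    show "\<forall>\<^sub>F v in nhds 0. kron \<tau> (u + v) (v - u) * ((theta4 \<tau> u)\<^sup>2 * (theta4 \<tau> v)\<^sup>2 - (theta1 \<tau> u)\<^sup>2 * (theta1 \<tau> v)\<^sup>2) =
        d * (theta4 \<tau> 0)\<^sup>2 * theta1 \<tau> (2 * v)"
    proof eventually_elim
      case (elim v)
      have "norm (u + v) < pi * Im \<tau>" "norm (v - u) < pi * Im \<tau>"
        using norm_triangle_ineq[of u v] norm_triangle_ineq4[of v u] u elim r by (simp_all add: r_def)
      from kron_eq[OF \<tau> this] have "kron \<tau> (u + v) (v - u) * (theta4 \<tau> (u + v) * theta4 \<tau> (u - v)) = d * theta1 \<tau> (2 * v)"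
        using theta4_uminus[of \<tau> "u - v"] by (simp add: d_def)
      then show ?case
        unfolding theta4_add_diff[OF \<tau>, symmetric] by (simp add: mult_ac)
    qed
  qed
  have ev: "\<forall>\<^sub>F u in nhds 0. G u * (1 - fps_const ((theta1 \<tau> u * inverse (theta4 \<tau> u))\<^sup>2) * (sn_fps \<tau>)\<^sup>2) =
      fps_const ((inverse (theta4 \<tau> u))\<^sup>2) * (fps_const (d * (theta4 \<tau> 0)\<^sup>2) * \<Theta>2 * (inverse \<Phi>)\<^sup>2)"
    using eventually_norm_less[OF r] eventually_theta4_nonzero[OF \<tau>]
  proof eventually_elim
    case (elim u)
    then show ?case
      using kernel_normalize[OF ker[of u]] \<Phi>0 by (simp add: sn_fps_def \<Phi>_def)
  qed
  have a: "(\<lambda>u. (inverse (theta4 \<tau> u))\<^sup>2) has_fps_expansion (inverse \<Phi>)\<^sup>2"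
    unfolding \<Phi>_def by (intro has_fps_expansion_power has_fps_expansion_inverse_theta4 \<tau>)
  have D: "Determinant.det (Matrix.mat m m (\<lambda>(i, j). fps_nth (M (2 * j + 1)) (2 * i + 0))) =
     (\<Prod>n<m. fps_nth ((inverse \<Phi>)\<^sup>2) 0 * fps_nth (fps_const (d * (theta4 \<tau> 0)\<^sup>2) * \<Theta>2 * (inverse \<Phi>)\<^sup>2) 1 * fps_nth (sn_fps \<tau>) 1 ^ (4 * n))"
    by (rule det_kernel[OF ev has_fps_expansion_sn[OF \<tau>] a sn_fps_0 M]) (auto simp: \<Theta>2_def)
  \<comment> \<open>The 2 is the inner derivative of \<open>theta1 \<tau> (2 * v)\<close>; it is
    responsible for the power of 2 in the third identity.\<close>
  have AB: "fps_nth ((inverse \<Phi>)\<^sup>2) 0 * fps_nth (fps_const (d * (theta4 \<tau> 0)\<^sup>2) * \<Theta>2 * (inverse \<Phi>)\<^sup>2) 1 = 2 * theta_triangle \<tau> ^ 4"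
  proof -
    have "fps_nth \<Theta>2 0 = 0" "fps_nth \<Theta>2 1 = 2 * d" by (simp_all add: \<Theta>2_def d_def)
    then have "fps_nth (fps_const (d * (theta4 \<tau> 0)\<^sup>2) * \<Theta>2 * (inverse \<Phi>)\<^sup>2) 1 = d * (theta4 \<tau> 0)\<^sup>2 * (2 * d) * (inverse (theta4 \<tau> 0))\<^sup>2"
      using \<Phi>0 by (simp add: fps_mult_nth power2_eq_square)
    moreover have "d = (theta_triangle \<tau>)\<^sup>2 * theta4 \<tau> 0"
      unfolding d_def by (rule theta1_deriv_theta_triangle[OF \<tau>])
    ultimately show ?thesis
      using \<Phi>0 by (simp add: power2_eq_square power4_eq_xxxx field_simps)
  qed
  have pw: "2 * theta_triangle \<tau> ^ 4 * (theta_triangle \<tau>)\<^sup>2 ^ (4 * n) = 2 * theta_triangle \<tau> ^ (8 * n + 4)" for n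
    by (simp add: power_add flip: power_mult)
  have Mn: "fps_nth (M (2 * j + 1)) (2 * i + 0) = (\<Sum>\<^sub>\<infinity>p\<in>?O \<times> ?O. lambert \<tau> p *
      of_real (of_int (fst p - snd p) / 2) ^ (2 * i) * of_real (of_int (fst p + snd p) / 2) ^ (2 * j + 1)) /
      (fact (2 * i) * fact (2 * j + 1))" for i j
    by (simp only: M_def \<alpha>_def \<gamma>_def fps_nth_Abs_fps add_0_right)
  show ?thesis
    using D unfolding Mn AB sn_fps_1[OF \<tau>] pw .
qed

text \<open>Here v is the row variable, u the column variable, and s the sign in u + s v. Averaging
  over s = 1 and s = - 1 keeps the even powers of v, so the entries in even rows are the plain
  Lambert coefficients.\<close>

lemma det_kernel_f1:
  assumes \<tau>: "Im \<tau> > 0"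
  shows "Determinant.det (Matrix.mat m m (\<lambda>(i, j). (\<Sum>\<^sub>\<infinity>p\<in>{k. odd k} \<times> {l. odd l}. lambert \<tau> p *
      of_real (of_int (fst p) / 2) ^ (2 * i) * of_real (of_int (fst p) / 2) ^ (2 * j + 1)) /
      (fact (2 * i) * fact (2 * j + 1)))) = (\<Prod>n<m. theta_triangle \<tau> ^ (8 * n + 4))"
proof -
  let ?O = "{k::int. odd k}"
  define \<alpha> where "\<alpha> s p = s * (real_of_int (fst p) / 2)" for s and p :: "int \<times> int"
  define \<gamma> where "\<gamma> p = real_of_int (fst p) / 2" for p :: "int \<times> int"
  define r where "r = pi / 4 * Im \<tau>"
  have r: "r > 0" using \<tau> by (simp add: r_def)
  have sm: "(\<lambda>p. norm (lambert \<tau> p) * exp (r * (\<bar>\<alpha> s p\<bar> + \<bar>\<gamma> p\<bar>))) summable_on ?O \<times> ?O" if "\<bar>s\<bar> = 1" for s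
    unfolding r_def by (rule lambert_summable_exp[OF \<tau>]) (use that in \<open>auto simp: \<alpha>_def \<gamma>_def abs_mult\<close>)
  define G where "G s v = Abs_fps (\<lambda>n. (\<Sum>\<^sub>\<infinity>p\<in>?O \<times> ?O. lambert \<tau> p * exp (of_real (\<alpha> s p) * v) * of_real (\<gamma> p) ^ n) / fact n)" for s v
  define M where "M s j = Abs_fps (\<lambda>i. (\<Sum>\<^sub>\<infinity>p\<in>?O \<times> ?O. lambert \<tau> p * of_real (\<alpha> s p) ^ i * of_real (\<gamma> p) ^ j) / (fact i * fact j))" for s j
  define \<Phi> where "\<Phi> = theta4_fps \<tau> 0"
  define d where "d = fps_nth (theta1_fps \<tau>) 1"
  \<comment> \<open>The series of the v-factor supplied by \<open>theta1_theta4_add_diff\<close>. It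
    will be divided by its value at 0, so that it contributes 1 to the leading coefficient.\<close>
  define R where "R = Abs_fps (\<lambda>n. (\<Sum>\<^sub>\<infinity>k\<in>?O. jterm (\<tau> / 2) 0 k * (of_int k / 2) ^ n) / fact n)"
  have R: "theta2 (\<tau> / 2) has_fps_expansion R"
    using has_fps_expansion_jterm_sum[OF Im_half_double(2)[OF \<tau>], of 0 ?O] by (simp add: R_def theta2_def[abs_def])
  have R0: "theta2 (\<tau> / 2) 0 \<noteq> 0" "fps_nth R 0 = theta2 (\<tau> / 2) 0"
    using theta_nulls_nonzero[OF Im_half_double(2)[OF \<tau>]] by (simp_all add: R_def theta2_def)
  have \<Phi>0: "fps_nth \<Phi> 0 = theta4 \<tau> 0" "theta4 \<tau> 0 \<noteq> 0"
    using theta_nulls_nonzero[OF \<tau>] by (simp_all add: \<Phi>_def)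
  have M: "(\<lambda>v. fps_nth (fps_const (1 / 2) * (G 1 v + G (- 1) v)) j) has_fps_expansion fps_const (1 / 2) * (M 1 j + M (- 1) j)" for j
  proof -
    have "(\<lambda>v. fps_nth (G s v) j) has_fps_expansion M s j" if "\<bar>s\<bar> = 1" for s
      unfolding G_def M_def using has_fps_expansion_exp_sum2(2)[OF r sm[OF that]] by simp
    from has_fps_expansion_cmult_left[OF has_fps_expansion_add[OF this this], of 1 "- 1" "1 / 2"]
    show ?thesis by simp
  qed
  have kron: "kron \<tau> (u + of_real s * v) 0 = (\<Sum>\<^sub>\<infinity>p\<in>?O \<times> ?O. lambert \<tau> p * exp (of_real (\<alpha> s p) * v) * exp (of_real (\<gamma> p) * u))" for s u v
    unfolding kron_def
  proof (rule infsum_cong)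
    fix p :: "int \<times> int"
    have "exp (of_int (fst p) / 2 * (u + of_real s * v) + of_int (snd p) / 2 * 0) = exp (of_real (\<alpha> s p) * v) * exp (of_real (\<gamma> p) * u)"
      unfolding mult_exp_exp by (rule arg_cong[of _ _ exp]) (simp add: \<alpha>_def \<gamma>_def field_simps)
    then show "(case p of (k, l) \<Rightarrow> eps k l * qpow \<tau> (of_int (k * l) / 4) * exp (of_int k / 2 * (u + of_real s * v) + of_int l / 2 * 0)) =
      lambert \<tau> p * exp (of_real (\<alpha> s p) * v) * exp (of_real (\<gamma> p) * u)"
      unfolding case_prod_unfold lambert_def by (simp only: mult.assoc)
  qed
  have ker: "fps_const (1 / 2) * (G 1 v + G (- 1) v) *
       (fps_const ((theta4 \<tau> v)\<^sup>2) * \<Phi>\<^sup>2 - fps_const ((theta1 \<tau> v)\<^sup>2) * (theta1_fps \<tau>)\<^sup>2) =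
      fps_const (theta2 (\<tau> / 2) v * inverse (theta2 (\<tau> / 2) 0)) * (fps_const (d * theta4 \<tau> 0) * (theta1_fps \<tau> * \<Phi>))"
    if v: "norm v < r" for v
  proof (rule has_fps_expansion_unique)
    have K: "(\<lambda>u. kron \<tau> (u + of_real s * v) 0) has_fps_expansion G s v" if "\<bar>s\<bar> = 1" for s
      unfolding kron G_def using has_fps_expansion_exp_sum2(1)[OF r sm[OF that], of v] v by simp
    show "(\<lambda>u. 1 / 2 * (kron \<tau> (u + of_real 1 * v) 0 + kron \<tau> (u + of_real (- 1) * v) 0) *
        ((theta4 \<tau> v)\<^sup>2 * (theta4 \<tau> u)\<^sup>2 - (theta1 \<tau> v)\<^sup>2 * (theta1 \<tau> u)\<^sup>2)) has_fps_expansion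
       fps_const (1 / 2) * (G 1 v + G (- 1) v) *
       (fps_const ((theta4 \<tau> v)\<^sup>2) * \<Phi>\<^sup>2 - fps_const ((theta1 \<tau> v)\<^sup>2) * (theta1_fps \<tau>)\<^sup>2)"
      unfolding \<Phi>_def by (intro has_fps_expansion_mult has_fps_expansion_diff has_fps_expansion_cmult_left has_fps_expansion_add
          has_fps_expansion_power has_fps_expansion_theta4 has_fps_expansion_theta1 \<tau> K) auto
    show "(\<lambda>u. theta2 (\<tau> / 2) v * inverse (theta2 (\<tau> / 2) 0) * (d * theta4 \<tau> 0 * (theta1 \<tau> u * theta4 \<tau> u))) has_fps_expansion
       fps_const (theta2 (\<tau> / 2) v * inverse (theta2 (\<tau> / 2) 0)) * (fps_const (d * theta4 \<tau> 0) * (theta1_fps \<tau> * \<Phi>))"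
      unfolding \<Phi>_def by (intro has_fps_expansion_cmult_left has_fps_expansion_mult has_fps_expansion_theta4 has_fps_expansion_theta1 \<tau>)
    from eventually_norm_less[OF r]
    show "\<forall>\<^sub>F u in nhds 0. 1 / 2 * (kron \<tau> (u + of_real 1 * v) 0 + kron \<tau> (u + of_real (- 1) * v) 0) *
        ((theta4 \<tau> v)\<^sup>2 * (theta4 \<tau> u)\<^sup>2 - (theta1 \<tau> v)\<^sup>2 * (theta1 \<tau> u)\<^sup>2) =
        theta2 (\<tau> / 2) v * inverse (theta2 (\<tau> / 2) 0) * (d * theta4 \<tau> 0 * (theta1 \<tau> u * theta4 \<tau> u))"
    proof eventually_elim
      case (elim u)
      have n: "norm (u + v) < pi * Im \<tau>" "norm (u - v) < pi * Im \<tau>" "norm (0::complex) < pi * Im \<tau>"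
        using norm_triangle_ineq[of u v] norm_triangle_ineq4[of u v] v elim r by (simp_all add: r_def)
      define Kp Km P N where "Kp = kron \<tau> (u + v) 0" and "Km = kron \<tau> (u - v) 0"
        and "P = theta4 \<tau> (u + v)" and "N = theta4 \<tau> (u - v)"
      define t x where "t = theta4 \<tau> 0" and "x = theta2 (\<tau> / 2) 0"
      have p: "Kp * (P * t) = d * theta1 \<tau> (u + v)"
        using kron_eq[OF \<tau> n(1,3)] by (simp add: Kp_def P_def t_def d_def)
      have m: "Km * (N * t) = d * theta1 \<tau> (u - v)"
        using kron_eq[OF \<tau> n(2,3)] by (simp add: Km_def N_def t_def d_def)
      have add: "(theta1 \<tau> (u + v) * N + theta1 \<tau> (u - v) * P) * x = 2 * theta1 \<tau> u * theta4 \<tau> u * theta2 (\<tau> / 2) v"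
        unfolding N_def P_def x_def by (rule theta1_theta4_add_diff[OF \<tau>])
      have "1 / 2 * (Kp + Km) * (P * N * t\<^sup>2) * x = 1 / 2 * t * ((Kp * (P * t)) * N + (Km * (N * t)) * P) * x"
        by (simp add: algebra_simps power2_eq_square)
      also have "\<dots> = 1 / 2 * t * d * ((theta1 \<tau> (u + v) * N + theta1 \<tau> (u - v) * P) * x)"
        unfolding p m by (simp add: algebra_simps)
      also have "\<dots> = theta2 (\<tau> / 2) v * (d * t * (theta1 \<tau> u * theta4 \<tau> u))"
        unfolding add by simp
      finally have "1 / 2 * (Kp + Km) * (P * N * t\<^sup>2) = theta2 (\<tau> / 2) v * inverse x * (d * t * (theta1 \<tau> u * theta4 \<tau> u))"
        using R0 by (simp add: x_def field_simps)
      moreover have "(theta4 \<tau> v)\<^sup>2 * (theta4 \<tau> u)\<^sup>2 - (theta1 \<tau> v)\<^sup>2 * (theta1 \<tau> u)\<^sup>2 = P * N * t\<^sup>2"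
        unfolding P_def N_def t_def theta4_add_diff[OF \<tau>] by (simp add: mult.commute)
      ultimately show ?case
        by (simp add: Kp_def Km_def t_def x_def)
    qed
  qed
  have ev: "\<forall>\<^sub>F v in nhds 0. fps_const (1 / 2) * (G 1 v + G (- 1) v) * (1 - fps_const ((theta1 \<tau> v * inverse (theta4 \<tau> v))\<^sup>2) * (sn_fps \<tau>)\<^sup>2) =
      fps_const ((inverse (theta4 \<tau> v))\<^sup>2 * (theta2 (\<tau> / 2) v * inverse (theta2 (\<tau> / 2) 0))) *
      (fps_const (d * theta4 \<tau> 0) * (theta1_fps \<tau> * \<Phi>) * (inverse \<Phi>)\<^sup>2)"
    using eventually_norm_less[OF r] eventually_theta4_nonzero[OF \<tau>]
  proof eventually_elim
    case (elim v)
    have "fps_nth \<Phi> 0 \<noteq> 0" using \<Phi>0 by simp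
    from kernel_normalize[OF ker[OF elim(1)] elim(2) this] show ?case
      unfolding sn_fps_def \<Phi>_def[symmetric] fps_const_mult[symmetric] by (simp only: mult.assoc)
  qed
  have a: "(\<lambda>v. (inverse (theta4 \<tau> v))\<^sup>2 * (theta2 (\<tau> / 2) v * inverse (theta2 (\<tau> / 2) 0))) has_fps_expansion
      (inverse \<Phi>)\<^sup>2 * (R * fps_const (inverse (theta2 (\<tau> / 2) 0)))"
    unfolding \<Phi>_def by (intro has_fps_expansion_mult has_fps_expansion_cmult_right has_fps_expansion_power has_fps_expansion_inverse_theta4 \<tau> R)
  have D: "Determinant.det (Matrix.mat m m (\<lambda>(i, j). fps_nth (fps_const (1 / 2) * (M 1 (2 * j + 1) + M (- 1) (2 * j + 1))) (2 * i + 0))) =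
     (\<Prod>n<m. fps_nth ((inverse \<Phi>)\<^sup>2 * (R * fps_const (inverse (theta2 (\<tau> / 2) 0)))) 0 *
        fps_nth (fps_const (d * theta4 \<tau> 0) * (theta1_fps \<tau> * \<Phi>) * (inverse \<Phi>)\<^sup>2) 1 * fps_nth (sn_fps \<tau>) 1 ^ (4 * n))"
    by (rule det_kernel[OF ev has_fps_expansion_sn[OF \<tau>] a sn_fps_0 M]) auto
  have AB: "fps_nth ((inverse \<Phi>)\<^sup>2 * (R * fps_const (inverse (theta2 (\<tau> / 2) 0)))) 0 *
        fps_nth (fps_const (d * theta4 \<tau> 0) * (theta1_fps \<tau> * \<Phi>) * (inverse \<Phi>)\<^sup>2) 1 = theta_triangle \<tau> ^ 4"
  proof -
    have "fps_nth (fps_const (d * theta4 \<tau> 0) * (theta1_fps \<tau> * \<Phi>) * (inverse \<Phi>)\<^sup>2) 1 =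
        d * theta4 \<tau> 0 * (d * theta4 \<tau> 0) * (inverse (theta4 \<tau> 0))\<^sup>2"
      using \<Phi>0 by (simp add: fps_mult_nth power2_eq_square d_def)
    moreover have "fps_nth ((inverse \<Phi>)\<^sup>2 * (R * fps_const (inverse (theta2 (\<tau> / 2) 0)))) 0 = (inverse (theta4 \<tau> 0))\<^sup>2"
      using R0 \<Phi>0 by (simp add: power2_eq_square)
    moreover have "d = (theta_triangle \<tau>)\<^sup>2 * theta4 \<tau> 0"
      unfolding d_def by (rule theta1_deriv_theta_triangle[OF \<tau>])
    ultimately show ?thesis
      using \<Phi>0 by (simp add: power2_eq_square power4_eq_xxxx field_simps)
  qed
  have pw: "theta_triangle \<tau> ^ 4 * (theta_triangle \<tau>)\<^sup>2 ^ (4 * n) = theta_triangle \<tau> ^ (8 * n + 4)" for n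
    by (simp add: power_add flip: power_mult)
  have Mn: "fps_nth (fps_const (1 / 2) * (M 1 (2 * j + 1) + M (- 1) (2 * j + 1))) (2 * i + 0) =
      (\<Sum>\<^sub>\<infinity>p\<in>?O \<times> ?O. lambert \<tau> p *
      of_real (of_int (fst p) / 2) ^ (2 * i) * of_real (of_int (fst p) / 2) ^ (2 * j + 1)) / (fact (2 * i) * fact (2 * j + 1))" for i j
    by (simp add: M_def \<alpha>_def \<gamma>_def)
  show ?thesis
    using D unfolding Mn AB sn_fps_1[OF \<tau>] pw .
qed

text \<open>Termwise differentiation. By x \<le> exp x, half of the exponential weight pays for the
  new factor n / 2.\<close>

lemma has_fps_expansion_theta4_deriv:
  assumes "Im \<tau> > 0"
  shows "(\<lambda>z. \<Sum>\<^sub>\<infinity>n\<in>{n. even n}. of_int n / 2 * jterm \<tau> (z + c + of_real pi * \<i>) n) has_fps_expansion fps_deriv (theta4_fps \<tau> c)"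
proof -
  let ?c = "c + of_real pi * \<i>"
  have "(\<lambda>n. norm (of_int n / 2 * jterm \<tau> ?c n) * exp (1 * \<bar>real_of_int n / 2\<bar>)) summable_on {n. even n}"
  proof (rule summable_on_comparison_test[OF jterm_summable_exp[OF assms, of ?c 1 "{n. even n}"]])
    fix n :: int
    have "\<bar>real_of_int n\<bar> / 2 \<le> exp (\<bar>real_of_int n\<bar> / 2)"
      using exp_ge_add_one_self[of "\<bar>real_of_int n\<bar> / 2"] by linarith
    then have "\<bar>real_of_int n\<bar> / 2 * exp (\<bar>real_of_int n\<bar> / 2) \<le> exp (\<bar>real_of_int n\<bar> / 2) * exp (\<bar>real_of_int n\<bar> / 2)"
      by (rule mult_right_mono) simp
    also have "\<dots> = exp (1 * \<bar>real_of_int n\<bar>)" by (simp flip: exp_add)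
    finally have "norm (jterm \<tau> ?c n) * (\<bar>real_of_int n\<bar> / 2 * exp (\<bar>real_of_int n\<bar> / 2)) \<le> norm (jterm \<tau> ?c n) * exp (1 * \<bar>real_of_int n\<bar>)"
      by (rule mult_left_mono) simp
    then show "norm (of_int n / 2 * jterm \<tau> ?c n) * exp (1 * \<bar>real_of_int n / 2\<bar>) \<le> norm (jterm \<tau> ?c n) * exp (1 * \<bar>real_of_int n\<bar>)"
      by (simp add: norm_mult norm_divide mult_ac)
  qed auto
  from has_fps_expansion_exp_sum[OF _ this]
  have "(\<lambda>z. \<Sum>\<^sub>\<infinity>n\<in>{n. even n}. of_int n / 2 * jterm \<tau> ?c n * exp (of_real (real_of_int n / 2) * z)) has_fps_expansion
     Abs_fps (\<lambda>k. (\<Sum>\<^sub>\<infinity>n\<in>{n. even n}. of_int n / 2 * jterm \<tau> ?c n * of_real (real_of_int n / 2) ^ k) / fact k)"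
    by simp
  also have "Abs_fps (\<lambda>k. (\<Sum>\<^sub>\<infinity>n\<in>{n. even n}. of_int n / 2 * jterm \<tau> ?c n * of_real (real_of_int n / 2) ^ k) / fact k) = fps_deriv (theta4_fps \<tau> c)"
  proof (rule fps_ext)
    fix k
    have "(\<Sum>\<^sub>\<infinity>n\<in>{n. even n}. of_int n / 2 * jterm \<tau> ?c n * of_real (real_of_int n / 2) ^ k) =
       (\<Sum>\<^sub>\<infinity>n\<in>{n. even n}. jterm \<tau> ?c n * (of_int n / 2) ^ (Suc k))"
      by (rule infsum_cong) simp
    then show "fps_nth (Abs_fps (\<lambda>k. (\<Sum>\<^sub>\<infinity>n\<in>{n. even n}. of_int n / 2 * jterm \<tau> ?c n * of_real (real_of_int n / 2) ^ k) / fact k)) k =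
       fps_nth (fps_deriv (theta4_fps \<tau> c)) k"
      by (simp add: theta4_fps_def del: power_Suc of_nat_Suc)
  qed
  also have "(\<lambda>z. \<Sum>\<^sub>\<infinity>n\<in>{n. even n}. of_int n / 2 * jterm \<tau> ?c n * exp (of_real (real_of_int n / 2) * z)) =
     (\<lambda>z. \<Sum>\<^sub>\<infinity>n\<in>{n. even n}. of_int n / 2 * jterm \<tau> (z + c + of_real pi * \<i>) n)"
    by (simp add: fun_eq_iff add.assoc jterm_shift[of _ _ ?c] mult.assoc)
  finally show ?thesis .
qed

text \<open>After normalisation the row factor is \<sigma>(v)^2 and the column factor is the
  derivative of \<sigma>(u)^2. The first starts at order 2, hence the rows 2 i + 2; the leading
  coefficients multiply to 2 \<sigma>'(0)^4, that is
  \<open>2 * theta_triangle \<tau> ^ 8\<close>.\<close>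

lemma det_kernel_f2:
  assumes \<tau>: "Im \<tau> > 0"
  shows "Determinant.det (Matrix.mat m m (\<lambda>(i, j). 2 * (\<Sum>\<^sub>\<infinity>p\<in>{k. even k \<and> k \<noteq> 0} \<times> {l. odd l}. lambert \<tau> p *
      of_real (of_int (fst p) / 2) ^ (2 * i + 2) * of_real (of_int (fst p) / 2) ^ (2 * j + 1)) /
      (fact (2 * i + 2) * fact (2 * j + 1)))) = (\<Prod>n<m. 2 * theta_triangle \<tau> ^ (8 * n + 8))"
proof -
  let ?P = "{k::int. even k \<and> k \<noteq> 0} \<times> {k::int. odd k}"
  define \<alpha> where "\<alpha> s p = s * (real_of_int (fst p) / 2)" for s and p :: "int \<times> int"
  define \<gamma> where "\<gamma> p = real_of_int (fst p) / 2" for p :: "int \<times> int"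
  define r where "r = pi / 4 * Im \<tau>"
  have r: "r > 0" using \<tau> by (simp add: r_def)
  have sm: "(\<lambda>p. norm (lambert \<tau> p) * exp (r * (\<bar>\<alpha> s p\<bar> + \<bar>\<gamma> p\<bar>))) summable_on ?P" if "\<bar>s\<bar> \<le> 1" for s
    unfolding r_def
  proof (rule lambert_summable_exp[OF \<tau>])
    fix p :: "int \<times> int"
    have "\<bar>\<alpha> s p\<bar> \<le> 1 * (\<bar>real_of_int (fst p)\<bar> / 2)"
      unfolding \<alpha>_def abs_mult using that by (intro mult_mono) auto
    then show "\<bar>\<alpha> s p\<bar> + \<bar>\<gamma> p\<bar> \<le> \<bar>real_of_int (fst p)\<bar> + \<bar>real_of_int (snd p)\<bar>"
      by (simp add: \<gamma>_def)
  qed auto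
  define G where "G s v = Abs_fps (\<lambda>n. (\<Sum>\<^sub>\<infinity>p\<in>?P. lambert \<tau> p * exp (of_real (\<alpha> s p) * v) * of_real (\<gamma> p) ^ n) / fact n)" for s v
  define M where "M s j = Abs_fps (\<lambda>i. (\<Sum>\<^sub>\<infinity>p\<in>?P. lambert \<tau> p * of_real (\<alpha> s p) ^ i * of_real (\<gamma> p) ^ j) / (fact i * fact j))" for s j
  define \<Phi> where "\<Phi> = theta4_fps \<tau> 0"
  define \<Theta> where "\<Theta> = theta1_fps \<tau>"
  define d where "d = fps_nth \<Theta> 1"
  define B where "B = 2 * (\<Theta> * (fps_deriv \<Theta> * \<Phi> - fps_deriv \<Phi> * \<Theta>)) * inverse \<Phi>"
  have \<Phi>0: "fps_nth \<Phi> 0 = theta4 \<tau> 0" "theta4 \<tau> 0 \<noteq> 0"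
    using theta_nulls_nonzero[OF \<tau>] by (simp_all add: \<Phi>_def)
  have inv: "\<Phi> * inverse \<Phi> = 1" using \<Phi>0 by (intro inverse_mult_eq_1') simp
  have M: "(\<lambda>v. fps_nth (G 1 v + G (- 1) v - 2 * G 0 v) j) has_fps_expansion M 1 j + M (- 1) j - fps_const 2 * M 0 j" for j
  proof -
    have *: "(\<lambda>v. fps_nth (G s v) j) has_fps_expansion M s j" if "\<bar>s\<bar> \<le> 1" for s
      unfolding G_def M_def using has_fps_expansion_exp_sum2(2)[OF r sm[OF that]] by simp
    have "(\<lambda>v. fps_nth (G 1 v) j + fps_nth (G (- 1) v) j - 2 * fps_nth (G 0 v) j) has_fps_expansion M 1 j + M (- 1) j - fps_const 2 * M 0 j"
      by (intro has_fps_expansion_diff has_fps_expansion_add has_fps_expansion_cmult_left *) auto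
    then show ?thesis by (simp add: numeral_fps_const)
  qed
  have lser: "lser \<tau> (u + of_real s * v) = (\<Sum>\<^sub>\<infinity>p\<in>?P. lambert \<tau> p * exp (of_real (\<alpha> s p) * v) * exp (of_real (\<gamma> p) * u))" for s u v
    unfolding lser_def
  proof (rule infsum_cong)
    fix p :: "int \<times> int"
    have "exp (of_int (fst p) / 2 * (u + of_real s * v)) = exp (of_real (\<alpha> s p) * v) * exp (of_real (\<gamma> p) * u)"
      unfolding mult_exp_exp by (rule arg_cong[of _ _ exp]) (simp add: \<alpha>_def \<gamma>_def field_simps)
    then show "(case p of (k, l) \<Rightarrow> eps k l * qpow \<tau> (of_int (k * l) / 4) * exp (of_int k / 2 * (u + of_real s * v))) =
      lambert \<tau> p * exp (of_real (\<alpha> s p) * v) * exp (of_real (\<gamma> p) * u)"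
      unfolding case_prod_unfold lambert_def by (simp only: mult.assoc)
  qed
  have LF: "G s v * theta4_fps \<tau> (of_real s * v) = - fps_deriv (theta4_fps \<tau> (of_real s * v))" if v: "norm v < r" and s: "\<bar>s\<bar> \<le> 1" for s v
  proof (rule has_fps_expansion_unique)
    have "(\<lambda>u. lser \<tau> (u + of_real s * v)) has_fps_expansion G s v"
      unfolding lser G_def using has_fps_expansion_exp_sum2(1)[OF r sm[OF s], of v] v by simp
    then show "(\<lambda>u. lser \<tau> (u + of_real s * v) * theta4 \<tau> (u + of_real s * v)) has_fps_expansion G s v * theta4_fps \<tau> (of_real s * v)"
      by (intro has_fps_expansion_mult has_fps_expansion_theta4_shift \<tau>)
    show "(\<lambda>u. - (\<Sum>\<^sub>\<infinity>n\<in>{n. even n}. of_int n / 2 * jterm \<tau> (u + of_real s * v + of_real pi * \<i>) n)) has_fps_expansion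
        - fps_deriv (theta4_fps \<tau> (of_real s * v))"
      by (intro has_fps_expansion_minus has_fps_expansion_theta4_deriv \<tau>)
    from eventually_norm_less[OF r]
    show "\<forall>\<^sub>F u in nhds 0. lser \<tau> (u + of_real s * v) * theta4 \<tau> (u + of_real s * v) =
       - (\<Sum>\<^sub>\<infinity>n\<in>{n. even n}. of_int n / 2 * jterm \<tau> (u + of_real s * v + of_real pi * \<i>) n)"
    proof eventually_elim
      case (elim u)
      have "norm (of_real s * v) \<le> 1 * norm v"
        unfolding norm_mult using s by (intro mult_right_mono) auto
      then have "norm (u + of_real s * v) < pi * Im \<tau>"
        using norm_triangle_ineq[of u "of_real s * v"] v elim r by (simp add: r_def)
      then show ?case by (rule lser_theta4[OF \<tau>])
    qed
  qed
  have ker: "(G 1 v + G (- 1) v - 2 * G 0 v) *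
       (fps_const ((theta4 \<tau> v)\<^sup>2) * \<Phi>\<^sup>2 - fps_const ((theta1 \<tau> v)\<^sup>2) * \<Theta>\<^sup>2) = fps_const ((theta1 \<tau> v)\<^sup>2) * B"
    if v: "norm v < r" for v
  proof -
    define Fp Fm where "Fp = theta4_fps \<tau> v" and "Fm = theta4_fps \<tau> (- v)"
    define X where "X = fps_const ((theta4 \<tau> v)\<^sup>2) * \<Phi>\<^sup>2 - fps_const ((theta1 \<tau> v)\<^sup>2) * \<Theta>\<^sup>2"
    define t where "t = fps_const ((theta4 \<tau> 0)\<^sup>2)"
    have X: "Fp * Fm * t = X"
    proof (rule has_fps_expansion_unique)
      have "(\<lambda>u. theta4 \<tau> (u + v) * theta4 \<tau> (u + - v) * (theta4 \<tau> 0)\<^sup>2) has_fps_expansion Fp * Fm * t"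
        unfolding Fp_def Fm_def t_def
        by (intro has_fps_expansion_mult[of "\<lambda>u. theta4 \<tau> (u + v)"] has_fps_expansion_cmult_right has_fps_expansion_theta4_shift \<tau>)
      then show "(\<lambda>u. theta4 \<tau> (u + v) * theta4 \<tau> (u - v) * (theta4 \<tau> 0)\<^sup>2) has_fps_expansion Fp * Fm * t" by simp
      show "(\<lambda>u. (theta4 \<tau> v)\<^sup>2 * (theta4 \<tau> u)\<^sup>2 - (theta1 \<tau> v)\<^sup>2 * (theta1 \<tau> u)\<^sup>2) has_fps_expansion X"
        unfolding X_def \<Phi>_def \<Theta>_def by (intro has_fps_expansion_diff has_fps_expansion_cmult_left
          has_fps_expansion_power has_fps_expansion_theta4 has_fps_expansion_theta1 \<tau>)
      show "\<forall>\<^sub>F u in nhds 0. theta4 \<tau> (u + v) * theta4 \<tau> (u - v) * (theta4 \<tau> 0)\<^sup>2 =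
         (theta4 \<tau> v)\<^sup>2 * (theta4 \<tau> u)\<^sup>2 - (theta1 \<tau> v)\<^sup>2 * (theta1 \<tau> u)\<^sup>2"
        unfolding theta4_add_diff[OF \<tau>] by (simp add: mult.commute)
    qed
    have p: "G 1 v * Fp = - fps_deriv Fp" and m: "G (- 1) v * Fm = - fps_deriv Fm" and z: "G 0 v * \<Phi> = - fps_deriv \<Phi>"
      using LF[OF v, of 1] LF[OF v, of "- 1"] LF[OF v, of 0] by (simp_all add: Fp_def Fm_def \<Phi>_def)
    \<comment> \<open>X is a constant times \<open>Fp * Fm\<close>, so the two logarithmic
      derivatives add up to that of X.\<close>
    have "(G 1 v + G (- 1) v) * X = ((G 1 v * Fp) * Fm + Fp * (G (- 1) v * Fm)) * t"
      unfolding X[symmetric] by (simp only: distrib_left distrib_right mult_ac)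
    also have "\<dots> = - fps_deriv X"
      unfolding p m X[symmetric] by (simp add: t_def algebra_simps)
    finally have 1: "(G 1 v + G (- 1) v) * X = - fps_deriv X" .
    have "(G 1 v + G (- 1) v - 2 * G 0 v) * X * \<Phi> = ((G 1 v + G (- 1) v) * X) * \<Phi> - 2 * (G 0 v * \<Phi>) * X"
      by (simp add: algebra_simps)
    also have "\<dots> = 2 * fps_deriv \<Phi> * X - fps_deriv X * \<Phi>"
      unfolding 1 z by (simp add: algebra_simps)
    \<comment> \<open>The part of X containing \<open>theta4 \<tau> v\<close> is a multiple of
      \<Phi>^2 and cancels, because (\<Phi>^2)' \<Phi> = 2 \<Phi>' \<Phi>^2. Subtracting 2 L(u) is
      what makes the kernel separate.\<close>
    also have "\<dots> = fps_const ((theta1 \<tau> v)\<^sup>2) * (2 * (\<Theta> * (fps_deriv \<Theta> * \<Phi> - fps_deriv \<Phi> * \<Theta>)))"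
      unfolding X_def by (simp add: power2_eq_square algebra_simps)
    finally have "(G 1 v + G (- 1) v - 2 * G 0 v) * X * (\<Phi> * inverse \<Phi>) =
       fps_const ((theta1 \<tau> v)\<^sup>2) * (2 * (\<Theta> * (fps_deriv \<Theta> * \<Phi> - fps_deriv \<Phi> * \<Theta>))) * inverse \<Phi>"
      by (simp only: mult.assoc[symmetric])
    then show ?thesis
      unfolding inv X_def B_def by (simp only: mult_1_right mult.assoc)
  qed
  have ev: "\<forall>\<^sub>F v in nhds 0. (G 1 v + G (- 1) v - 2 * G 0 v) * (1 - fps_const ((theta1 \<tau> v * inverse (theta4 \<tau> v))\<^sup>2) * (sn_fps \<tau>)\<^sup>2) =
      fps_const ((inverse (theta4 \<tau> v))\<^sup>2 * (theta1 \<tau> v)\<^sup>2) * (B * (inverse \<Phi>)\<^sup>2)"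
    using eventually_norm_less[OF r] eventually_theta4_nonzero[OF \<tau>]
  proof eventually_elim
    case (elim v)
    have "fps_nth \<Phi> 0 \<noteq> 0" using \<Phi>0 by simp
    from kernel_normalize[OF ker[OF elim(1)] elim(2) this] show ?case
      unfolding sn_fps_def \<Phi>_def[symmetric] \<Theta>_def[symmetric] fps_const_mult[symmetric] by (simp only: mult.assoc)
  qed
  have a: "(\<lambda>v. (inverse (theta4 \<tau> v))\<^sup>2 * (theta1 \<tau> v)\<^sup>2) has_fps_expansion (inverse \<Phi>)\<^sup>2 * \<Theta>\<^sup>2"
    unfolding \<Phi>_def \<Theta>_def
    by (intro has_fps_expansion_mult has_fps_expansion_power has_fps_expansion_inverse_theta4 has_fps_expansion_theta1 \<tau>)
  have \<Theta>0: "fps_nth \<Theta> 0 = 0" by (simp add: \<Theta>_def)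
  have low: "fps_nth ((inverse \<Phi>)\<^sup>2 * \<Theta>\<^sup>2) i = 0" if "i < 2" for i
    using fps_power_lowest(1)[of 0 "(inverse \<Phi>)\<^sup>2" \<Theta> i 2] \<Theta>0 that by simp
  have D: "Determinant.det (Matrix.mat m m (\<lambda>(i, j). fps_nth (M 1 (2 * j + 1) + M (- 1) (2 * j + 1) - fps_const 2 * M 0 (2 * j + 1)) (2 * i + 2))) =
     (\<Prod>n<m. fps_nth ((inverse \<Phi>)\<^sup>2 * \<Theta>\<^sup>2) 2 * fps_nth (B * (inverse \<Phi>)\<^sup>2) 1 * fps_nth (sn_fps \<tau>) 1 ^ (4 * n))"
    by (rule det_kernel[OF ev has_fps_expansion_sn[OF \<tau>] a sn_fps_0 M]) (auto simp: low B_def \<Theta>0)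
  have AB: "fps_nth ((inverse \<Phi>)\<^sup>2 * \<Theta>\<^sup>2) 2 * fps_nth (B * (inverse \<Phi>)\<^sup>2) 1 = 2 * theta_triangle \<tau> ^ 8"
  proof -
    have "fps_nth B 0 = 0" and "fps_nth B 1 = 2 * (d * (d * theta4 \<tau> 0)) * inverse (theta4 \<tau> 0)"
      using \<Phi>0 by (simp_all add: B_def \<Theta>0 fps_mult_nth d_def fps_numeral_nth)
    then have "fps_nth (B * (inverse \<Phi>)\<^sup>2) 1 = 2 * (d * (d * theta4 \<tau> 0)) * inverse (theta4 \<tau> 0) * (inverse (theta4 \<tau> 0))\<^sup>2"
      using \<Phi>0 by (simp add: fps_mult_nth power2_eq_square)
    moreover have "fps_nth ((inverse \<Phi>)\<^sup>2 * \<Theta>\<^sup>2) 2 = (inverse (theta4 \<tau> 0))\<^sup>2 * d\<^sup>2"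
      using fps_power_lowest(2)[of 0 "(inverse \<Phi>)\<^sup>2" \<Theta> 2] \<Theta>0 \<Phi>0 by (simp add: d_def power2_eq_square)
    moreover have "d = (theta_triangle \<tau>)\<^sup>2 * theta4 \<tau> 0"
      unfolding d_def \<Theta>_def by (rule theta1_deriv_theta_triangle[OF \<tau>])
    moreover have "theta_triangle \<tau> ^ 8 = ((theta_triangle \<tau>)\<^sup>2)\<^sup>2 * ((theta_triangle \<tau>)\<^sup>2)\<^sup>2"
      by (simp flip: power_mult power_add)
    ultimately show ?thesis
      using \<Phi>0 by (simp add: power2_eq_square field_simps)
  qed
  have pw: "2 * theta_triangle \<tau> ^ 8 * (theta_triangle \<tau>)\<^sup>2 ^ (4 * n) = 2 * theta_triangle \<tau> ^ (8 * n + 8)" for n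
    by (simp add: power_add flip: power_mult)
  have Mn: "fps_nth (M 1 (2 * j + 1) + M (- 1) (2 * j + 1) - fps_const 2 * M 0 (2 * j + 1)) (2 * i + 2) =
      2 * (\<Sum>\<^sub>\<infinity>p\<in>?P. lambert \<tau> p *
      of_real (of_int (fst p) / 2) ^ (2 * i + 2) * of_real (of_int (fst p) / 2) ^ (2 * j + 1)) / (fact (2 * i + 2) * fact (2 * j + 1))" for i j
  proof -
    \<comment> \<open>At s = 0 the form \<alpha> vanishes, so this series has only a constant term
      in v and does not touch the rows 2 i + 2.\<close>
    have "M 0 (2 * j + 1) = Abs_fps (\<lambda>i. (\<Sum>\<^sub>\<infinity>p\<in>?P. lambert \<tau> p * 0 ^ i * of_real (\<gamma> p) ^ (2 * j + 1)) / (fact i * fact (2 * j + 1)))"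
      by (simp add: M_def \<alpha>_def)
    then have "fps_nth (M 0 (2 * j + 1)) (2 * i + 2) = 0" by simp
    moreover have "fps_nth (M s (2 * j + 1)) (2 * i + 2) = (\<Sum>\<^sub>\<infinity>p\<in>?P. lambert \<tau> p *
      of_real (of_int (fst p) / 2) ^ (2 * i + 2) * of_real (of_int (fst p) / 2) ^ (2 * j + 1)) / (fact (2 * i + 2) * fact (2 * j + 1))"
      if "s = 1 \<or> s = - 1" for s
      using that by (auto simp: M_def \<alpha>_def \<gamma>_def)
    ultimately show ?thesis by simp
  qed
  show ?thesis
    using D unfolding Mn AB sn_fps_1[OF \<tau>] pw .
qed

section \<open>Determinants and the sums over vectors\<close>

text \<open>Absolute summability is carried through the induction because each step multiplies two
  infinite series.\<close>

lemma has_sum_prod_PiE: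
  fixes f :: "'a \<Rightarrow> 'b \<Rightarrow> complex"
  assumes "finite A" and "\<And>x. x \<in> A \<Longrightarrow> (\<lambda>y. norm (f x y)) summable_on B x"
  shows "(\<lambda>g. norm (\<Prod>x\<in>A. f x (g x))) summable_on PiE A B \<and>
    ((\<lambda>g. \<Prod>x\<in>A. f x (g x)) has_sum (\<Prod>x\<in>A. infsum (f x) (B x))) (PiE A B)"
  using assms
proof (induction A rule: finite_induct)
  case empty
  then show ?case by (auto intro!: has_sum_finiteI)
next
  case (insert x A)
  let ?F = "\<lambda>g. \<Prod>x\<in>A. f x (g x)"
  have bij: "bij_betw (\<lambda>(y, g). g(x := y)) (B x \<times> PiE A B) (PiE (insert x A) B)"
    unfolding bij_betw_def using insert.hyps by (auto simp: PiE_insert_eq intro!: inj_combinator)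
  have fx: "(\<lambda>y. norm (f x y)) summable_on B x" using insert.prems by simp
  have IH: "(\<lambda>g. norm (?F g)) summable_on PiE A B" "(?F has_sum (\<Prod>x\<in>A. infsum (f x) (B x))) (PiE A B)"
    using insert.IH insert.prems by auto
  have eq: "(\<Prod>z\<in>insert x A. f z ((case q of (y, g) \<Rightarrow> g(x := y)) z)) = (case q of (y, g) \<Rightarrow> f x y * ?F g)" for q
  proof -
    obtain y g where q: "q = (y, g)" by (cases q)
    have "(\<Prod>z\<in>A. f z ((g(x := y)) z)) = ?F g"
      using insert.hyps by (intro prod.cong) auto
    then show ?thesis using insert.hyps by (simp add: q)
  qed
  have "(\<lambda>q. norm (case q of (y, g) \<Rightarrow> f x y * ?F g)) summable_on B x \<times> PiE A B"
    by (rule abs_summable_on_times[OF fx IH(1)])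
  then have 1: "(\<lambda>g. norm (\<Prod>z\<in>insert x A. f z (g z))) summable_on PiE (insert x A) B"
    using summable_on_reindex_bij_betw[OF bij, of "\<lambda>g. norm (\<Prod>z\<in>insert x A. f z (g z))"] unfolding eq by simp
  have "((\<lambda>(y, g). f x y * ?F g) has_sum infsum (f x) (B x) * (\<Prod>x\<in>A. infsum (f x) (B x))) (B x \<times> PiE A B)"
    by (rule has_sum_times[OF fx IH(1) _ IH(2)]) (rule has_sum_infsum[OF abs_summable_summable[OF fx]])
  then have "((\<lambda>g. \<Prod>z\<in>insert x A. f z (g z)) has_sum infsum (f x) (B x) * (\<Prod>x\<in>A. infsum (f x) (B x))) (PiE (insert x A) B)"
    using has_sum_reindex_bij_betw[OF bij, of "\<lambda>g. \<Prod>z\<in>insert x A. f z (g z)"] unfolding eq by simp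
  with 1 show ?case using insert.hyps by simp
qed

lemma has_sum_finite_sum:
  fixes f :: "'a \<Rightarrow> 'b \<Rightarrow> complex"
  assumes "\<And>i. i \<in> I \<Longrightarrow> (f i has_sum s i) A"
  shows "((\<lambda>x. \<Sum>i\<in>I. f i x) has_sum (\<Sum>i\<in>I. s i)) A"
  using assms by (induction I rule: infinite_finite_induct) (auto intro!: has_sum_add)

lemma det_Leibniz:
  "Determinant.det (Matrix.mat m m (\<lambda>(i, j). K i j)) =
     (\<Sum>p\<in>{p. p permutes {0..<m}}. signof p * (\<Prod>i = 0..<m. K i (p i)))"
proof -
  have "(\<Prod>i = 0..<m. Matrix.mat m m (\<lambda>(i, j). K i j) $$ (i, p i)) = (\<Prod>i = 0..<m. K i (p i))"
    if "p permutes {0..<m}" for p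
    using permutes_in_image[OF that] by (intro prod.cong) auto
  then show ?thesis
    by (subst det_def'[of _ m]) (auto intro!: sum.cong)
qed

lemma det_scale:
  fixes K :: "nat \<Rightarrow> nat \<Rightarrow> complex"
  shows "Determinant.det (Matrix.mat m m (\<lambda>(i, j). c i * d j * K i j)) =
     (\<Prod>n<m. c n * d n) * Determinant.det (Matrix.mat m m (\<lambda>(i, j). K i j))"
  unfolding det_Leibniz sum_distrib_left
proof (intro sum.cong refl)
  fix p assume "p \<in> {p. p permutes {0..<m}}"
  then have p: "p permutes {0..<m}" by simp
  have "(\<Prod>i = 0..<m. d (p i)) = (\<Prod>i = 0..<m. d i)"
    using prod.permute[OF p, of d] by (simp add: o_def)
  then show "signof p * (\<Prod>i = 0..<m. c i * d (p i) * K i (p i)) = (\<Prod>n<m. c n * d n) * (signof p * (\<Prod>i = 0..<m. K i (p i)))"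
    by (simp add: prod.distrib lessThan_atLeast0 mult_ac)
qed

text \<open>For each pair (p, r) of permutations from the two expansions, the sum over vectors is a
  product of one-point sums. At fixed p the sum over r is a determinant with permuted rows, whose
  sign cancels that of p, so all m! choices of p agree. Vectors are indexed from 1 and matrices from
  0, hence \<open>x - 1\<close> and \<open>Suc j\<close>.\<close>

lemma andreief:
  fixes w :: "'p \<Rightarrow> complex" and \<phi> \<psi> :: "nat \<Rightarrow> 'p \<Rightarrow> complex"
  assumes sm: "\<And>i j. (\<lambda>p. norm (w p * \<phi> i p * \<psi> j p)) summable_on P"
  shows "((\<lambda>v. (\<Prod>x\<in>{1..m}. w (v x)) * (Determinant.det (Matrix.mat m m (\<lambda>(j, i). \<phi> i (v (Suc j)))) *
       Determinant.det (Matrix.mat m m (\<lambda>(j, i). \<psi> i (v (Suc j)))))) has_sum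
     fact m * Determinant.det (Matrix.mat m m (\<lambda>(i, j). \<Sum>\<^sub>\<infinity>p\<in>P. w p * \<phi> i p * \<psi> j p))) ({1..m} \<rightarrow>\<^sub>E P)"
proof -
  let ?S = "{p. p permutes {0..<m}}"
  define H where "H i j = (\<Sum>\<^sub>\<infinity>p\<in>P. w p * \<phi> i p * \<psi> j p)" for i j
  have shift: "(\<Prod>x\<in>{1..m}. h x) = (\<Prod>j = 0..<m. h (Suc j))" for h :: "nat \<Rightarrow> complex"
    by (simp add: prod.atLeast_Suc_lessThan_Suc_shift atLeastLessThanSuc_atLeastAtMost[symmetric] del: prod.op_ivl_Suc)
  have "((\<lambda>v. \<Sum>p\<in>?S. \<Sum>r\<in>?S. signof p * signof r *
      (\<Prod>x\<in>{1..m}. w (v x) * \<phi> (p (x - 1)) (v x) * \<psi> (r (x - 1)) (v x))) has_sum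
      (\<Sum>p\<in>?S. \<Sum>r\<in>?S. signof p * signof r * (\<Prod>x\<in>{1..m}. H (p (x - 1)) (r (x - 1))))) ({1..m} \<rightarrow>\<^sub>E P)"
    unfolding H_def
    by (intro has_sum_finite_sum has_sum_cmult_right conjunct2[OF has_sum_prod_PiE] sm) auto
  moreover have "(\<Sum>p\<in>?S. \<Sum>r\<in>?S. signof p * signof r *
      (\<Prod>x\<in>{1..m}. w (v x) * \<phi> (p (x - 1)) (v x) * \<psi> (r (x - 1)) (v x))) =
     (\<Prod>x\<in>{1..m}. w (v x)) * (Determinant.det (Matrix.mat m m (\<lambda>(j, i). \<phi> i (v (Suc j)))) *
       Determinant.det (Matrix.mat m m (\<lambda>(j, i). \<psi> i (v (Suc j)))))" for v
    unfolding det_Leibniz unfolding sum_product unfolding sum_distrib_left shift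
    by (intro sum.cong refl) (simp add: prod.distrib mult_ac)
  moreover have "(\<Sum>p\<in>?S. \<Sum>r\<in>?S. signof p * signof r * (\<Prod>x\<in>{1..m}. H (p (x - 1)) (r (x - 1)))) =
     fact m * Determinant.det (Matrix.mat m m (\<lambda>(i, j). H i j))"
  proof -
    have "(\<Sum>r\<in>?S. signof p * signof r * (\<Prod>x\<in>{1..m}. H (p (x - 1)) (r (x - 1)))) = Determinant.det (Matrix.mat m m (\<lambda>(i, j). H i j))"
      if p: "p permutes {0..<m}" for p
    proof -
      have "(\<Sum>r\<in>?S. signof p * signof r * (\<Prod>x\<in>{1..m}. H (p (x - 1)) (r (x - 1)))) =
          signof p * Determinant.det (Matrix.mat m m (\<lambda>(i, j). H (p i) j))"
        unfolding det_Leibniz sum_distrib_left shift by (intro sum.cong refl) (simp add: mult.assoc)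
      also have "Matrix.mat m m (\<lambda>(i, j). H (p i) j) = Matrix.mat m m (\<lambda>(i, j). Matrix.mat m m (\<lambda>(i, j). H i j) $$ (p i, j))"
        using permutes_in_image[OF p] by (intro eq_matI) auto
      also have "Determinant.det \<dots> = signof p * Determinant.det (Matrix.mat m m (\<lambda>(i, j). H i j))"
        by (rule det_permute_rows[OF _ p]) simp
      also have "signof p * (signof p * Determinant.det (Matrix.mat m m (\<lambda>(i, j). H i j))) = Determinant.det (Matrix.mat m m (\<lambda>(i, j). H i j))"
        by (simp add: sign_def)
      finally show ?thesis .
    qed
    then show ?thesis
      by (simp add: card_permutations[of _ m])
  qed
  ultimately show ?thesis by (simp add: H_def)
qed

text \<open>The coefficient of N_k = (x - t 0) ... (x - t (k - 1)) in x^i; for k \<le> i it is the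
  complete homogeneous symmetric polynomial of degree i - k in t 0, ..., t k. The recursion is x N_k
  = N_(k+1) + t_k N_k.\<close>

fun newton_coeff :: "(nat \<Rightarrow> complex) \<Rightarrow> nat \<Rightarrow> nat \<Rightarrow> complex" where
  "newton_coeff t 0 k = (if k = 0 then 1 else 0)"
| "newton_coeff t (Suc i) k = (if k = 0 then 0 else newton_coeff t i (k - 1)) + t k * newton_coeff t i k"

lemma newton_coeff_gt: "i < k \<Longrightarrow> newton_coeff t i k = 0"
  by (induction i arbitrary: k) auto

lemma newton_coeff_same: "newton_coeff t i i = 1"
  by (induction i) (auto simp: newton_coeff_gt)

lemma newton_expansion:
  "i < m \<Longrightarrow> (\<Sum>k<m. (\<Prod>l<k. x - t l) * newton_coeff t i k) = x ^ i"
proof (induction i arbitrary: m)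
  case 0
  then obtain m' where "m = Suc m'" by (cases m) auto
  then show ?case by (simp add: sum.lessThan_Suc_shift del: sum.lessThan_Suc)
next
  case (Suc i)
  then obtain m' where m: "m = Suc m'" "i < m'" by (cases m) auto
  let ?N = "\<lambda>k. \<Prod>l<k. x - t l"
  have "(\<Sum>k<m. ?N k * newton_coeff t (Suc i) k) =
      (\<Sum>k<m. ?N k * (if k = 0 then 0 else newton_coeff t i (k - 1))) + (\<Sum>k<m. ?N k * (t k * newton_coeff t i k))"
    by (simp add: distrib_left sum.distrib)
  also have "(\<Sum>k<m. ?N k * (if k = 0 then 0 else newton_coeff t i (k - 1))) = (\<Sum>k<m'. (x - t k) * ?N k * newton_coeff t i k)"
    unfolding m(1) by (subst sum.lessThan_Suc_shift) (simp add: mult_ac)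
  also have "(\<Sum>k<m. ?N k * (t k * newton_coeff t i k)) = (\<Sum>k<m'. ?N k * (t k * newton_coeff t i k))"
    unfolding m(1) using m(2) by (simp add: newton_coeff_gt)
  also have "(\<Sum>k<m'. (x - t k) * ?N k * newton_coeff t i k) + (\<Sum>k<m'. ?N k * (t k * newton_coeff t i k)) =
      x * (\<Sum>k<m'. ?N k * newton_coeff t i k)"
    unfolding sum.distrib[symmetric] sum_distrib_left by (intro sum.cong refl) (simp add: algebra_simps)
  also have "\<dots> = x ^ Suc i" using Suc.IH[OF m(2)] by simp
  finally show ?case .
qed

text \<open>At x = t j the product N_k contains the factor t j - t j when j < k. So Newton's
  expansion factors the matrix into triangular ones, the second with unit diagonal.\<close>

lemma det_vandermonde:
  "Determinant.det (Matrix.mat m m (\<lambda>(j, i). t j ^ i)) = (\<Prod>k<m. \<Prod>l<k. t k - (t l :: complex))"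
proof -
  have "Matrix.mat m m (\<lambda>(j, i). t j ^ i) =
      Matrix.mat m m (\<lambda>(j, i). \<Sum>k<m. (\<Prod>l<k. t j - t l) * newton_coeff t i k)"
    by (rule eq_matI) (simp_all add: newton_expansion)
  also have "Determinant.det \<dots> = (\<Prod>k<m. (\<Prod>l<k. t k - t l) * newton_coeff t k k)"
    by (rule det_triangular_product) (auto simp: newton_coeff_gt)
  finally show ?thesis by (simp add: newton_coeff_same)
qed

lemma prod_index_pairs:
  fixes h :: "nat \<Rightarrow> nat \<Rightarrow> 'a :: comm_monoid_mult"
  shows "(\<Prod>k<m. \<Prod>l<k. h (Suc l) (Suc k)) = (\<Prod>(i, j)\<in>index_pairs m. h i j)"
proof -
  have "(\<Prod>k<m. \<Prod>l<k. h (Suc l) (Suc k)) = (\<Prod>(k, l)\<in>(SIGMA k:{..<m}. {..<k}). h (Suc l) (Suc k))"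
    by (simp add: prod.Sigma)
  also have "\<dots> = (\<Prod>(i, j)\<in>index_pairs m. h i j)"
    by (rule prod.reindex_bij_witness[of _ "\<lambda>(i, j). (j - 1, i - 1)" "\<lambda>(k, l). (Suc l, Suc k)"])
       (auto simp: index_pairs_def)
  finally show ?thesis .
qed

lemma det_vandermonde_mult:
  fixes a b :: "nat \<Rightarrow> complex"
  shows "Determinant.det (Matrix.mat m m (\<lambda>(j, i). a (Suc j) ^ i)) * Determinant.det (Matrix.mat m m (\<lambda>(j, i). b (Suc j) ^ i)) =
    (\<Prod>(i, j)\<in>index_pairs m. (a i - a j) * (b i - b j))"
  unfolding det_vandermonde[of m "\<lambda>j. a (Suc j)"] det_vandermonde[of m "\<lambda>j. b (Suc j)"]
    prod_index_pairs[symmetric] prod.distrib[symmetric]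
  by (intro prod.cong refl) (simp add: algebra_simps)

section \<open>From sums over vectors to determinants of Lambert series\<close>

lemma qpow_sum: "qpow \<tau> (\<Sum>j\<in>A. h j) = (\<Prod>j\<in>A. qpow \<tau> (h j))"
proof -
  have "qpow \<tau> 0 = 1" by (simp add: qpow_def)
  then show ?thesis by (induction A rule: infinite_finite_induct) (auto simp: qpow_add)
qed

text \<open>The hypothesis on f is the common shape of the three polynomials. Vectors are regrouped
  from a pair of functions into one function with values in pairs, which is the domain of Andreief's
  identity.\<close>

lemma theta_term_has_sum:
  fixes f :: "nat \<Rightarrow> (nat \<Rightarrow> real) \<times> (nat \<Rightarrow> real) \<Rightarrow> real" and wt a b :: "real \<times> real \<Rightarrow> real" and \<tau> :: complex
  defines "W \<equiv> \<lambda>p. of_real ((sgn_minus (fst p) + sgn_minus (snd p)) * wt p) * qpow \<tau> (fst p * snd p)"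
  assumes f: "\<And>x y. f m (x, y) = (\<Prod>j = 1..m. wt (x j, y j)) *
     (\<Prod>(i, j)\<in>index_pairs m. (a (x i, y i) - a (x j, y j)) * (b (x i, y i) - b (x j, y j)))"
    and sm: "\<And>i j. (\<lambda>p. norm (W p * of_real (a p) ^ i * of_real (b p) ^ j)) summable_on X \<times> Y"
  shows "(theta_term f m \<tau> has_sum fact m * Determinant.det (Matrix.mat m m
     (\<lambda>(i, j). \<Sum>\<^sub>\<infinity>p\<in>X \<times> Y. W p * of_real (a p) ^ i * of_real (b p) ^ j))) (vecs m X Y)"
proof -
  have vm: "Determinant.det (Matrix.mat m m (\<lambda>(j, i). of_real (a (v (Suc j))) ^ i)) *
      Determinant.det (Matrix.mat m m (\<lambda>(j, i). of_real (b (v (Suc j))) ^ i)) =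
    (\<Prod>(i, j)\<in>index_pairs m. (of_real (a (v i)) - of_real (a (v j))) * (of_real (b (v i)) - (of_real (b (v j)) :: complex)))" for v
    by (rule det_vandermonde_mult[of m "\<lambda>k. of_real (a (v k))" "\<lambda>k. of_real (b (v k))"])
  have "((\<lambda>v. (\<Prod>x\<in>{1..m}. W (v x)) *
       (\<Prod>(i, j)\<in>index_pairs m. (of_real (a (v i)) - of_real (a (v j))) * (of_real (b (v i)) - of_real (b (v j))))) has_sum
     fact m * Determinant.det (Matrix.mat m m (\<lambda>(i, j). \<Sum>\<^sub>\<infinity>p\<in>X \<times> Y. W p * of_real (a p) ^ i * of_real (b p) ^ j)))
     ({1..m} \<rightarrow>\<^sub>E X \<times> Y)"
    using andreief[of W "\<lambda>i p. of_real (a p) ^ i" "\<lambda>i p. of_real (b p) ^ i" "X \<times> Y" m, OF sm]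
    unfolding vm .
  also have "?this \<longleftrightarrow> ?thesis"
  proof (rule has_sum_reindex_bij_witness[of _ "\<lambda>(x, y). \<lambda>j\<in>{1..m}. (x j, y j)"
        "\<lambda>v. (\<lambda>j\<in>{1..m}. fst (v j), \<lambda>j\<in>{1..m}. snd (v j))"], goal_cases)
    case (5 v)
    define x y where "x = (\<lambda>j\<in>{1..m}. fst (v j))" and "y = (\<lambda>j\<in>{1..m}. snd (v j))"
    have xy: "(x j, y j) = v j" "x j = fst (v j)" "y j = snd (v j)" if "j \<in> {1..m}" for j
      using that by (simp_all add: x_def y_def)
    have 1: "(\<Prod>j = 1..m. wt (x j, y j)) = (\<Prod>j = 1..m. wt (v j))"
      by (intro prod.cong refl arg_cong[of _ _ wt] xy)
    have 2: "(\<Prod>(i, j)\<in>index_pairs m. (a (x i, y i) - a (x j, y j)) * (b (x i, y i) - b (x j, y j))) =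
        (\<Prod>(i, j)\<in>index_pairs m. (a (v i) - a (v j)) * (b (v i) - b (v j)))"
      by (rule prod.cong) (auto simp: index_pairs_def xy)
    have 3: "sgn_factor m (x, y) = (\<Prod>j = 1..m. sgn_minus (fst (v j)) + sgn_minus (snd (v j)))"
      unfolding sgn_factor_def prod.case by (intro prod.cong refl) (auto simp: xy)
    have 4: "qpow \<tau> (Qform m (x, y)) = (\<Prod>j = 1..m. qpow \<tau> (fst (v j) * snd (v j)))"
      unfolding Qform_def prod.case qpow_sum by (intro prod.cong refl) (auto simp: xy)
    show ?case
      unfolding x_def[symmetric] y_def[symmetric] theta_term_def f 1 2 3 4 W_def
      by (simp add: prod.distrib case_prod_unfold mult_ac)
  qed (auto simp: vecs_def fun_eq_iff PiE_iff extensional_def mem_Times_iff)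
  finally show ?thesis .
qed

lemma lambert_poly_summable:
  fixes \<alpha> \<gamma> :: "int \<times> int \<Rightarrow> real"
  assumes \<tau>: "Im \<tau> > 0" and S: "S \<subseteq> {(k, l). k \<noteq> 0 \<and> l \<noteq> 0}"
    and le: "\<And>p. p \<in> S \<Longrightarrow> \<bar>\<alpha> p\<bar> + \<bar>\<gamma> p\<bar> \<le> \<bar>real_of_int (fst p)\<bar> + \<bar>real_of_int (snd p)\<bar>"
  shows "(\<lambda>p. norm (lambert \<tau> p * of_real (\<alpha> p) ^ i * of_real (\<gamma> p) ^ j)) summable_on S"
proof -
  define r where "r = pi / 4 * Im \<tau>"
  have r: "r > 0" using \<tau> by (simp add: r_def)
  have sm: "(\<lambda>p. fact i / r ^ i * (fact j / r ^ j) * (norm (lambert \<tau> p) * exp (r * (\<bar>\<alpha> p\<bar> + \<bar>\<gamma> p\<bar>)))) summable_on S"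
    unfolding r_def by (intro summable_on_cmult_right lambert_summable_exp assms)
  show ?thesis
  proof (rule summable_on_comparison_test[OF sm])
    fix p
    have "\<bar>\<alpha> p\<bar> ^ i * \<bar>\<gamma> p\<bar> ^ j \<le> (fact i / r ^ i * exp (r * \<bar>\<alpha> p\<bar>)) * (fact j / r ^ j * exp (r * \<bar>\<gamma> p\<bar>))"
      using r by (intro mult_mono power_le_fact_exp) auto
    from mult_left_mono[OF this, of "norm (lambert \<tau> p)"]
    show "norm (lambert \<tau> p * of_real (\<alpha> p) ^ i * of_real (\<gamma> p) ^ j) \<le>
       fact i / r ^ i * (fact j / r ^ j) * (norm (lambert \<tau> p) * exp (r * (\<bar>\<alpha> p\<bar> + \<bar>\<gamma> p\<bar>)))"
      by (simp add: norm_mult norm_power distrib_left exp_add mult_ac)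
  qed auto
qed

lemma lambert_eq_sgn_minus:
  assumes "k \<noteq> 0" and "l \<noteq> 0"
  shows "of_real (sgn_minus (of_int k / 2) + sgn_minus (of_int l / 2)) * qpow \<tau> (of_int k / 2 * (of_int l / 2)) = 2 * lambert \<tau> (k, l)"
  using assms by (auto simp: sgn_minus_def lambert_def eps_def)

lemma bij_betw_half_ints: "bij_betw (\<lambda>k. real_of_int k / 2) {k. odd k} half_ints"
proof (rule bij_betw_imageI)
  show "(\<lambda>k. real_of_int k / 2) ` {k. odd k} = half_ints"
  proof (intro subset_antisym subsetI)
    fix x assume "x \<in> half_ints"
    then obtain j :: int where "x = real_of_int (2 * j + 1) / 2"
      by (auto simp: half_ints_def field_simps)
    then show "x \<in> (\<lambda>k. real_of_int k / 2) ` {k. odd k}" by (intro image_eqI[of _ _ "2 * j + 1"]) auto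
  qed (auto simp: half_ints_def elim!: oddE)
qed (auto simp: inj_on_def)

lemma bij_betw_ints: "bij_betw (\<lambda>k. real_of_int k / 2) {k. even k} \<int>"
proof (rule bij_betw_imageI)
  show "(\<lambda>k. real_of_int k / 2) ` {k. even k} = \<int>"
  proof (intro subset_antisym subsetI)
    fix x :: real assume "x \<in> \<int>"
    then obtain j :: int where "x = real_of_int (2 * j) / 2"
      by (auto elim!: Ints_cases)
    then show "x \<in> (\<lambda>k. real_of_int k / 2) ` {k. even k}" by (intro image_eqI[of _ _ "2 * j"]) auto
  qed (auto elim!: evenE)
qed (auto simp: inj_on_def)

lemma bij_betw_Times:
  assumes "bij_betw f A B" and "bij_betw g C D"
  shows "bij_betw (\<lambda>p. (f (fst p), g (snd p))) (A \<times> C) (B \<times> D)"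
  using assms unfolding bij_betw_def inj_on_def by (force simp: image_iff)

section \<open>Exponents and factorial constants\<close>

lemma prod_power_4: "(\<Prod>n<m. x ^ (8 * n + 4)) = (x :: complex) ^ (4 * m\<^sup>2)"
  by (induction m) (simp_all add: power2_eq_square algebra_simps flip: power_add)

lemma prod_power_8: "(\<Prod>n<m. x ^ (8 * n + 8)) = (x :: complex) ^ (4 * m * (m + 1))"
  by (induction m) (simp_all add: algebra_simps flip: power_add)

lemma fact_even_Suc: "(fact (2 * Suc n) :: complex) = 2 * (of_nat n + 1) * fact (2 * n + 1)"
  by (simp add: algebra_simps)

text \<open>By (2 n + 2)! = 2 (n + 1) (2 n + 1)! the factor m! 2^m turns the product of the (2 n +
  1)! into that of the (2 j)! for j from 1 to m. The (2 n)! form the same product once (2 m)! is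
  added, since 0! = 1.\<close>

lemma fact_prod_1:
  "fact m * 2 ^ m * (\<Prod>n<m. fact (2 * n) * fact (2 * n + 1)) * fact (2 * m) = (\<Prod>j = 1..m. (fact (2 * j) :: complex)\<^sup>2)"
proof (induction m)
  case (Suc m)
  have "fact (Suc m) * 2 ^ Suc m * (\<Prod>n<Suc m. fact (2 * n) * fact (2 * n + 1)) * (fact (2 * Suc m) :: complex) =
    (fact m * 2 ^ m * (\<Prod>n<m. fact (2 * n) * fact (2 * n + 1)) * fact (2 * m)) *
      ((2 * (of_nat m + 1) * fact (2 * m + 1)) * fact (2 * Suc m))"
    by (simp only: fact_Suc[of m] prod.lessThan_Suc power_Suc of_nat_Suc of_nat_mult) (simp only: mult_ac add.commute)
  also have "\<dots> = (\<Prod>j = 1..m. (fact (2 * j) :: complex)\<^sup>2) * (fact (2 * Suc m) * fact (2 * Suc m))"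
    unfolding Suc.IH fact_even_Suc[symmetric] ..
  finally show ?case by (simp add: power2_eq_square)
qed simp

text \<open>The row factorials now start at 2!, so both products are complete by themselves;
  therefore the second identity has no (2 m)! in its constant.\<close>

lemma fact_prod_2:
  "fact m * 2 ^ m * (\<Prod>n<m. fact (2 * n + 2) * fact (2 * n + 1)) = (\<Prod>j = 1..m. (fact (2 * j) :: complex)\<^sup>2)"
proof (induction m)
  case (Suc m)
  have "fact (Suc m) * 2 ^ Suc m * (\<Prod>n<Suc m. fact (2 * n + 2) * (fact (2 * n + 1) :: complex)) =
    (fact m * 2 ^ m * (\<Prod>n<m. fact (2 * n + 2) * fact (2 * n + 1))) *
      ((2 * (of_nat m + 1) * fact (2 * m + 1)) * fact (2 * m + 2))"
    by (simp only: fact_Suc[of m] prod.lessThan_Suc power_Suc of_nat_Suc of_nat_mult) (simp only: mult_ac add.commute)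
  also have "\<dots> = (\<Prod>j = 1..m. (fact (2 * j) :: complex)\<^sup>2) * (fact (2 * Suc m) * fact (2 * m + 2))"
    unfolding Suc.IH fact_even_Suc[symmetric] ..
  finally show ?case by (simp add: power2_eq_square)
qed simp

text \<open>\<open>half\<close> passes from doubled to true indices. T is the full index set, and S
  omits points where the weight vanishes, for \<open>f2\<close> those with x = 0. One factor of the
  weight goes to the columns and makes their exponents odd; for \<open>f2\<close> the remaining x^2
  goes to the rows.\<close>

lemma theta_term_has_sum_lambert:
  fixes f :: "nat \<Rightarrow> (nat \<Rightarrow> real) \<times> (nat \<Rightarrow> real) \<Rightarrow> real" and wt a b :: "real \<times> real \<Rightarrow> real"
    and \<alpha> \<gamma> :: "int \<times> int \<Rightarrow> real" and e :: "nat \<Rightarrow> nat" and \<tau> :: complex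
  defines "half \<equiv> \<lambda>p. (real_of_int (fst p) / 2, real_of_int (snd p) / 2)"
  assumes \<tau>: "Im \<tau> > 0"
    and f: "\<And>x y. f m (x, y) = (\<Prod>j = 1..m. wt (x j, y j)) *
     (\<Prod>(i, j)\<in>index_pairs m. (a (x i, y i) - a (x j, y j)) * (b (x i, y i) - b (x j, y j)))"
    and bij: "bij_betw half T (X \<times> Y)" and ST: "S \<subseteq> T" and S: "S \<subseteq> {(k, l). k \<noteq> 0 \<and> l \<noteq> 0}"
    and zero: "\<And>p. p \<in> T - S \<Longrightarrow> wt (half p) = 0"
    and summand: "\<And>p i j. p \<in> S \<Longrightarrow> wt (half p) * a (half p) ^ i * b (half p) ^ j = \<alpha> p ^ e i * \<gamma> p ^ (2 * j + 1)"
    and le: "\<And>p. p \<in> S \<Longrightarrow> \<bar>\<alpha> p\<bar> + \<bar>\<gamma> p\<bar> \<le> \<bar>real_of_int (fst p)\<bar> + \<bar>real_of_int (snd p)\<bar>"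
  shows "(theta_term f m \<tau> has_sum fact m * Determinant.det (Matrix.mat m m
     (\<lambda>(i, j). 2 * (\<Sum>\<^sub>\<infinity>p\<in>S. lambert \<tau> p * of_real (\<alpha> p) ^ e i * of_real (\<gamma> p) ^ (2 * j + 1))))) (vecs m X Y)"
proof -
  define W where "W p = of_real ((sgn_minus (fst p) + sgn_minus (snd p)) * wt p) * qpow \<tau> (fst p * snd p)" for p
  have W: "W (half p) * of_real (a (half p)) ^ i * of_real (b (half p)) ^ j =
      2 * (lambert \<tau> p * of_real (\<alpha> p) ^ e i * of_real (\<gamma> p) ^ (2 * j + 1))" if p: "p \<in> S" for p i j
  proof -
    have "of_real (sgn_minus (fst (half p)) + sgn_minus (snd (half p))) * qpow \<tau> (fst (half p) * snd (half p)) = 2 * lambert \<tau> p"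
      using lambert_eq_sgn_minus[of "fst p" "snd p" \<tau>] S p by (auto simp: half_def)
    then have "W (half p) = 2 * lambert \<tau> p * of_real (wt (half p))"
      unfolding W_def by (simp add: mult_ac)
    then have "W (half p) * of_real (a (half p)) ^ i * of_real (b (half p)) ^ j =
        2 * lambert \<tau> p * of_real (wt (half p) * a (half p) ^ i * b (half p) ^ j)"
      by simp
    also have "\<dots> = 2 * (lambert \<tau> p * of_real (\<alpha> p) ^ e i * of_real (\<gamma> p) ^ (2 * j + 1))"
      unfolding summand[OF p] by simp
    finally show ?thesis .
  qed
  have W0: "W (half p) * of_real (a (half p)) ^ i * of_real (b (half p)) ^ j = 0" if "p \<in> T - S" for p i j
    unfolding W_def zero[OF that] by simp
  have sm: "(\<lambda>p. norm (W p * of_real (a p) ^ i * of_real (b p) ^ j)) summable_on X \<times> Y" for i j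
  proof -
    have "(\<lambda>p. 2 * norm (lambert \<tau> p * of_real (\<alpha> p) ^ e i * of_real (\<gamma> p) ^ (2 * j + 1))) summable_on S"
      by (intro summable_on_cmult_right lambert_poly_summable[OF \<tau> S le])
    also have "?this \<longleftrightarrow> (\<lambda>p. norm (W (half p) * of_real (a (half p)) ^ i * of_real (b (half p)) ^ j)) summable_on T"
    proof (rule summable_on_cong_neutral)
      fix p assume "p \<in> S \<inter> T"
      then show "2 * norm (lambert \<tau> p * of_real (\<alpha> p) ^ e i * of_real (\<gamma> p) ^ (2 * j + 1)) =
          norm (W (half p) * of_real (a (half p)) ^ i * of_real (b (half p)) ^ j)"
        by (subst W) (auto simp: norm_mult)
    qed (use ST W0 in auto)
    also have "\<dots> \<longleftrightarrow> ?thesis"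
      by (rule summable_on_reindex_bij_betw[OF bij])
    finally show ?thesis .
  qed
  have eq: "(\<Sum>\<^sub>\<infinity>p\<in>X \<times> Y. W p * of_real (a p) ^ i * of_real (b p) ^ j) =
      2 * (\<Sum>\<^sub>\<infinity>p\<in>S. lambert \<tau> p * of_real (\<alpha> p) ^ e i * of_real (\<gamma> p) ^ (2 * j + 1))" for i j
  proof -
    have "(\<Sum>\<^sub>\<infinity>p\<in>X \<times> Y. W p * of_real (a p) ^ i * of_real (b p) ^ j) =
        (\<Sum>\<^sub>\<infinity>p\<in>T. W (half p) * of_real (a (half p)) ^ i * of_real (b (half p)) ^ j)"
      by (rule infsum_reindex_bij_betw[OF bij, symmetric])
    also have "\<dots> = (\<Sum>\<^sub>\<infinity>p\<in>S. 2 * (lambert \<tau> p * of_real (\<alpha> p) ^ e i * of_real (\<gamma> p) ^ (2 * j + 1)))"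
      by (rule infsum_cong_neutral) (use ST W W0 in auto)
    also have "\<dots> = 2 * (\<Sum>\<^sub>\<infinity>p\<in>S. lambert \<tau> p * of_real (\<alpha> p) ^ e i * of_real (\<gamma> p) ^ (2 * j + 1))"
      by (rule infsum_cmult_right')
    finally show ?thesis .
  qed
  have "(theta_term f m \<tau> has_sum fact m * Determinant.det (Matrix.mat m m
     (\<lambda>(i, j). \<Sum>\<^sub>\<infinity>p\<in>X \<times> Y. W p * of_real (a p) ^ i * of_real (b p) ^ j))) (vecs m X Y)"
    unfolding W_def by (rule theta_term_has_sum[where wt = wt and a = a and b = b]) (rule f, rule sm[unfolded W_def])
  then show ?thesis unfolding eq .
qed

section \<open>Closed forms of the three sums\<close>

lemma has_sum_f1:
  assumes \<tau>: "Im \<tau> > 0"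
  shows "(theta_term f1 m \<tau> has_sum
     fact m * 2 ^ m * (\<Prod>n<m. fact (2 * n) * fact (2 * n + 1)) * theta_triangle \<tau> ^ (4 * m\<^sup>2)) (vecs m half_ints half_ints)"
proof -
  let ?O = "{k::int. odd k}"
  let ?k = "\<lambda>p. real_of_int (fst p) / 2"
  have "(theta_term f1 m \<tau> has_sum fact m * Determinant.det (Matrix.mat m m
     (\<lambda>(i, j). 2 * (\<Sum>\<^sub>\<infinity>p\<in>?O \<times> ?O. lambert \<tau> p * of_real (?k p) ^ (2 * i) * of_real (?k p) ^ (2 * j + 1))))) (vecs m half_ints half_ints)"
  proof (rule theta_term_has_sum_lambert[OF \<tau>, where wt = fst and a = "\<lambda>p. (fst p)\<^sup>2" and b = "\<lambda>p. (fst p)\<^sup>2"])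
    show "bij_betw (\<lambda>p. (?k p, real_of_int (snd p) / 2)) (?O \<times> ?O) (half_ints \<times> half_ints)"
      by (intro bij_betw_Times bij_betw_half_ints)
  qed (auto simp: f1_def power2_eq_square power_mult power_mult_distrib)
  also have "Matrix.mat m m (\<lambda>(i, j). 2 * (\<Sum>\<^sub>\<infinity>p\<in>?O \<times> ?O. lambert \<tau> p * of_real (?k p) ^ (2 * i) * of_real (?k p) ^ (2 * j + 1))) =
      Matrix.mat m m (\<lambda>(i, j). (2 * fact (2 * i)) * fact (2 * j + 1) *
        ((\<Sum>\<^sub>\<infinity>p\<in>?O \<times> ?O. lambert \<tau> p * of_real (?k p) ^ (2 * i) * of_real (?k p) ^ (2 * j + 1)) / (fact (2 * i) * fact (2 * j + 1))))"
    by (rule eq_matI) (simp_all del: fact_Suc)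
  also have "Determinant.det \<dots> = (\<Prod>n<m. 2 * fact (2 * n) * fact (2 * n + 1)) * (\<Prod>n<m. theta_triangle \<tau> ^ (8 * n + 4))"
    unfolding det_scale det_kernel_f1[OF \<tau>] ..
  also have "fact m * \<dots> = fact m * 2 ^ m * (\<Prod>n<m. fact (2 * n) * fact (2 * n + 1)) * theta_triangle \<tau> ^ (4 * m\<^sup>2)"
    unfolding prod_power_4 by (simp add: prod.distrib mult_ac del: fact_Suc)
  finally show ?thesis .
qed

text \<open>The 2 from the signs is already part of the matrix in \<open>det_kernel_f2\<close>,
  where s = 1 and s = - 1 give equal entries that are added. So only factorials are pulled out of
  rows and columns.\<close>

lemma has_sum_f2:
  assumes \<tau>: "Im \<tau> > 0"
  shows "(theta_term f2 m \<tau> has_sum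
     fact m * 2 ^ m * (\<Prod>n<m. fact (2 * n + 2) * fact (2 * n + 1)) * theta_triangle \<tau> ^ (4 * m * (m + 1))) (vecs m \<int> half_ints)"
proof -
  let ?P = "{k::int. even k \<and> k \<noteq> 0} \<times> {l::int. odd l}"
  let ?k = "\<lambda>p. real_of_int (fst p) / 2"
  have "(theta_term f2 m \<tau> has_sum fact m * Determinant.det (Matrix.mat m m
     (\<lambda>(i, j). 2 * (\<Sum>\<^sub>\<infinity>p\<in>?P. lambert \<tau> p * of_real (?k p) ^ (2 * i + 2) * of_real (?k p) ^ (2 * j + 1))))) (vecs m \<int> half_ints)"
  proof (rule theta_term_has_sum_lambert[OF \<tau>, where wt = "\<lambda>p. fst p ^ 3" and a = "\<lambda>p. (fst p)\<^sup>2" and b = "\<lambda>p. (fst p)\<^sup>2"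
        and T = "{k. even k} \<times> {l. odd l}"])
    show "bij_betw (\<lambda>p. (?k p, real_of_int (snd p) / 2)) ({k. even k} \<times> {l. odd l}) (\<int> \<times> half_ints)"
      by (intro bij_betw_Times bij_betw_half_ints bij_betw_ints)
  qed (auto simp: f2_def power2_eq_square power3_eq_cube power_mult power_mult_distrib)
  also have "Matrix.mat m m (\<lambda>(i, j). 2 * (\<Sum>\<^sub>\<infinity>p\<in>?P. lambert \<tau> p * of_real (?k p) ^ (2 * i + 2) * of_real (?k p) ^ (2 * j + 1))) =
      Matrix.mat m m (\<lambda>(i, j). fact (2 * i + 2) * fact (2 * j + 1) *
        (2 * (\<Sum>\<^sub>\<infinity>p\<in>?P. lambert \<tau> p * of_real (?k p) ^ (2 * i + 2) * of_real (?k p) ^ (2 * j + 1)) / (fact (2 * i + 2) * fact (2 * j + 1))))"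
    by (rule eq_matI) (simp_all del: fact_Suc)
  also have "Determinant.det \<dots> = (\<Prod>n<m. fact (2 * n + 2) * fact (2 * n + 1)) * (\<Prod>n<m. 2 * theta_triangle \<tau> ^ (8 * n + 8))"
    unfolding det_scale det_kernel_f2[OF \<tau>] ..
  also have "fact m * \<dots> = fact m * 2 ^ m * (\<Prod>n<m. fact (2 * n + 2) * fact (2 * n + 1)) * (\<Prod>n<m. theta_triangle \<tau> ^ (8 * n + 8))"
    by (simp add: prod.distrib mult_ac del: fact_Suc)
  finally show ?thesis unfolding prod_power_8 .
qed

text \<open>The two powers \<open>2 ^ m\<close> have different origins: one comes from the sign
  factors, the other from the kernel determinant.\<close>

lemma has_sum_f3:
  assumes \<tau>: "Im \<tau> > 0"
  shows "(theta_term f3 m \<tau> has_sum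
     fact m * 2 ^ m * (\<Prod>n<m. fact (2 * n) * fact (2 * n + 1)) * (2 ^ m * theta_triangle \<tau> ^ (4 * m\<^sup>2))) (vecs m half_ints half_ints)"
proof -
  let ?O = "{k::int. odd k}"
  let ?d = "\<lambda>p. real_of_int (fst p - snd p) / 2" and ?s = "\<lambda>p. real_of_int (fst p + snd p) / 2"
  have "(theta_term f3 m \<tau> has_sum fact m * Determinant.det (Matrix.mat m m
     (\<lambda>(i, j). 2 * (\<Sum>\<^sub>\<infinity>p\<in>?O \<times> ?O. lambert \<tau> p * of_real (?d p) ^ (2 * i) * of_real (?s p) ^ (2 * j + 1))))) (vecs m half_ints half_ints)"
  proof (rule theta_term_has_sum_lambert[OF \<tau>, where wt = "\<lambda>p. fst p + snd p"
        and a = "\<lambda>p. (fst p - snd p)\<^sup>2" and b = "\<lambda>p. (fst p + snd p)\<^sup>2"])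
    show "bij_betw (\<lambda>p. (real_of_int (fst p) / 2, real_of_int (snd p) / 2)) (?O \<times> ?O) (half_ints \<times> half_ints)"
      by (intro bij_betw_Times bij_betw_half_ints)
    fix p :: "int \<times> int"
    have "\<bar>x - y\<bar> / 2 + \<bar>x + y\<bar> / 2 \<le> \<bar>x\<bar> + \<bar>y\<bar>" for x y :: real
      using abs_triangle_ineq[of x y] abs_triangle_ineq4[of x y] by simp
    then show "\<bar>?d p\<bar> + \<bar>?s p\<bar> \<le> \<bar>real_of_int (fst p)\<bar> + \<bar>real_of_int (snd p)\<bar>" by simp
    show "(fst (real_of_int (fst p) / 2, real_of_int (snd p) / 2) + snd (real_of_int (fst p) / 2, real_of_int (snd p) / 2)) *
        ((fst (real_of_int (fst p) / 2, real_of_int (snd p) / 2) - snd (real_of_int (fst p) / 2, real_of_int (snd p) / 2))\<^sup>2) ^ i *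
        ((fst (real_of_int (fst p) / 2, real_of_int (snd p) / 2) + snd (real_of_int (fst p) / 2, real_of_int (snd p) / 2))\<^sup>2) ^ j =
        ?d p ^ (2 * i) * ?s p ^ (2 * j + 1)" for i j
    proof -
      have sd: "real_of_int (fst p) / 2 + real_of_int (snd p) / 2 = ?s p" "real_of_int (fst p) / 2 - real_of_int (snd p) / 2 = ?d p"
        by (simp_all add: add_divide_distrib diff_divide_distrib)
      show ?thesis unfolding fst_conv snd_conv sd power_mult power_add power_one_right by (simp only: mult_ac)
    qed
  qed (auto simp: f3_def)
  also have "Matrix.mat m m (\<lambda>(i, j). 2 * (\<Sum>\<^sub>\<infinity>p\<in>?O \<times> ?O. lambert \<tau> p * of_real (?d p) ^ (2 * i) * of_real (?s p) ^ (2 * j + 1))) =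
      Matrix.mat m m (\<lambda>(i, j). (2 * fact (2 * i)) * fact (2 * j + 1) *
        ((\<Sum>\<^sub>\<infinity>p\<in>?O \<times> ?O. lambert \<tau> p * of_real (?d p) ^ (2 * i) * of_real (?s p) ^ (2 * j + 1)) / (fact (2 * i) * fact (2 * j + 1))))"
    by (rule eq_matI) (simp_all del: fact_Suc of_int_add of_int_diff)
  also have "Determinant.det \<dots> = (\<Prod>n<m. 2 * fact (2 * n) * fact (2 * n + 1)) * (\<Prod>n<m. 2 * theta_triangle \<tau> ^ (8 * n + 4))"
    unfolding det_scale det_kernel_f3[OF \<tau>] ..
  also have "fact m * \<dots> = fact m * 2 ^ m * (\<Prod>n<m. fact (2 * n) * fact (2 * n + 1)) * (2 ^ m * (\<Prod>n<m. theta_triangle \<tau> ^ (8 * n + 4)))"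
    by (simp add: prod.distrib mult_ac del: fact_Suc)
  finally show ?thesis unfolding prod_power_4 .
qed

theorem theorem3p3:
  fixes m :: nat and \<tau> :: complex
  assumes "m \<ge> 1" and "Im \<tau> > 0"
  shows
    "(theta_term f1 m \<tau> summable_on vecs m half_ints half_ints \<and>
     theta_triangle \<tau> ^ (4 * m\<^sup>2) =
       fact (2 * m) / (\<Prod>j = 1..m. (fact (2 * j))\<^sup>2) *
       (\<Sum>\<^sub>\<infinity>v\<in>vecs m half_ints half_ints. theta_term f1 m \<tau> v)) \<and>
     (theta_term f2 m \<tau> summable_on vecs m \<int> half_ints \<and>
     theta_triangle \<tau> ^ (4 * m * (m + 1)) =
       1 / (\<Prod>j = 1..m. (fact (2 * j))\<^sup>2) *
       (\<Sum>\<^sub>\<infinity>v\<in>vecs m \<int> half_ints. theta_term f2 m \<tau> v)) \<and>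
     (theta_term f3 m \<tau> summable_on vecs m half_ints half_ints \<and>
     theta_triangle \<tau> ^ (4 * m\<^sup>2) =
       fact (2 * m) / (2 ^ m * (\<Prod>j = 1..m. (fact (2 * j))\<^sup>2)) *
       (\<Sum>\<^sub>\<infinity>v\<in>vecs m half_ints half_ints. theta_term f3 m \<tau> v))"
proof -
  have nz: "(\<Prod>j = 1..m. (fact (2 * j) :: complex)\<^sup>2) \<noteq> 0" by simp
  define C D :: complex where "C = fact m * 2 ^ m * (\<Prod>n<m. fact (2 * n) * fact (2 * n + 1))"
    and "D = fact m * 2 ^ m * (\<Prod>n<m. fact (2 * n + 2) * fact (2 * n + 1))"
  have C: "(\<Prod>j = 1..m. (fact (2 * j) :: complex)\<^sup>2) = C * fact (2 * m)"
    unfolding C_def by (rule fact_prod_1[symmetric])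
  have D: "(\<Prod>j = 1..m. (fact (2 * j) :: complex)\<^sup>2) = D"
    unfolding D_def by (rule fact_prod_2[symmetric])
  note h1 = has_sum_f1[OF assms(2), of m, folded C_def]
  note h2 = has_sum_f2[OF assms(2), of m, folded D_def]
  note h3 = has_sum_f3[OF assms(2), of m, folded C_def]
  have "C \<noteq> 0" "D \<noteq> 0" using nz C D by auto
  have "theta_triangle \<tau> ^ (4 * m\<^sup>2) = fact (2 * m) / (\<Prod>j = 1..m. (fact (2 * j))\<^sup>2) *
       (\<Sum>\<^sub>\<infinity>v\<in>vecs m half_ints half_ints. theta_term f1 m \<tau> v)"
    unfolding infsumI[OF h1] C using \<open>C \<noteq> 0\<close> by simp
  moreover have "theta_triangle \<tau> ^ (4 * m * (m + 1)) = 1 / (\<Prod>j = 1..m. (fact (2 * j))\<^sup>2) *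
       (\<Sum>\<^sub>\<infinity>v\<in>vecs m \<int> half_ints. theta_term f2 m \<tau> v)"
    unfolding infsumI[OF h2] D using \<open>D \<noteq> 0\<close> by simp
  moreover have "theta_triangle \<tau> ^ (4 * m\<^sup>2) = fact (2 * m) / (2 ^ m * (\<Prod>j = 1..m. (fact (2 * j))\<^sup>2)) *
       (\<Sum>\<^sub>\<infinity>v\<in>vecs m half_ints half_ints. theta_term f3 m \<tau> v)"
    unfolding infsumI[OF h3] C using \<open>C \<noteq> 0\<close> by simp
  ultimately show ?thesis
    using has_sum_imp_summable[OF h1] has_sum_imp_summable[OF h2] has_sum_imp_summable[OF h3] by blast
qed

end
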